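(* $\mathsf{FSAT}\in\mathsf{CL}^{\mathsf{NP}}_{2\text{-round}}$: there is a $\mathsf{CL}^{\mathsf{NP}}_{2\text{-round}}$ machine that, given a CNF formula $\phi$, outputs a satisfying assignment of $\phi$ if $\phi$ is satisfiable.
   Context: A catalytic logspace ($\mathsf{CL}$) machine has a read-only input tape, a write-only output tape, a read-write work tape of $O(\log n)$ cells and a read-write catalytic tape of $n^{O(1)}$ cells, and must, for every input and every initial catalytic content $\tau$, halt with the correct output and the catalytic tape restored to $\tau$. A configuration is the pair $(u,\tau)$ of work-tape and catalytic-tape contents. A one-way in-place $\mathsf{FL}$ machine has a single read-write input/output tape holding $z=z_1\dots z_p$ and a read-write work tape of $O(\log p)$ cells; the write head moves only to the right, and the read head never moves to the left of the write head. $\mathsf{CL}^{\mathsf{NP}}_{2\text{-round}}$ consists of functions computed by $\mathsf{CL}$ machines with an $\mathsf{NP}$ oracle $A$ that make at most $2$ rounds of non-adaptive queries: in a round, the machine writes queries $q_1,\dots,q_m$ ($m$ polynomial) on a one-way write-only query tape via an $\mathsf{FL}$ computation treating the catalytic tape as read-only input, then receives $A(q_1),\dots,A(q_m)$ on an answer tape that it reads once left to right; before reading $A(q_1)$ and between reading $A(q_i)$ and $A(q_{i+1})$ it may only perform a one-way in-place $\mathsf{FL}$ computation on its configuration; afterwards it resumes ordinary $\mathsf{CL}$ computation. *)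

theory Defs
  imports Main "HOL-Library.Discrete_Functions"
begin

section \<open>Bounded tapes\<close>

text \<open>
  The cells of a bounded tape \<open>xs\<close> sit at positions \<open>1, \<dots>, length xs\<close>; positions \<open>0\<close> and
  \<open>length xs + 1\<close> hold unwritable end markers. Heads start at the left end marker unless stated
  otherwise, and cannot run past an end marker. Machine states and tape symbols are natural
  numbers; finiteness is imposed by the well-formedness predicates.
\<close>

datatype 'a cell = LEnd | Sym 'a | REnd

datatype move = Go_Left | Stay | Go_Right

definition scan :: "'a list \<Rightarrow> nat \<Rightarrow> 'a cell" where
  "scan xs h = (if h = 0 then LEnd else if h \<le> length xs then Sym (xs ! (h - 1)) else REnd)"

definition put :: "'a list \<Rightarrow> nat \<Rightarrow> 'a \<Rightarrow> 'a list" where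
  "put xs h a = (if h = 0 then xs else xs[h - 1 := a])"

fun shift :: "'a list \<Rightarrow> move \<Rightarrow> nat \<Rightarrow> nat" where
  "shift xs Go_Left h = h - 1"
| "shift xs Stay h = h"
| "shift xs Go_Right h = min (h + 1) (length xs + 1)"

definition emit :: "'a option \<Rightarrow> 'a list" where
  "emit w = (case w of None \<Rightarrow> [] | Some a \<Rightarrow> [a])"

definition cells_over :: "nat \<Rightarrow> nat cell set" where
  "cells_over g = {LEnd, REnd} \<union> Sym ` {..<g}"

definition log_cells :: "nat \<Rightarrow> nat \<Rightarrow> nat" where
  "log_cells c n = c * (floor_log n + 1)"

definition poly_bound :: "nat \<Rightarrow> nat \<Rightarrow> nat" where
  "poly_bound k n = n ^ k + k"


section \<open>The class NP\<close>

text \<open>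
  NP is given by polynomial-time verifiers: deterministic Turing machines with two read-only tapes
  (instance and certificate) and finitely many work tapes, infinite to the right, blank symbol \<open>0\<close>.
\<close>

datatype tm_action =
    Accept
  | Reject
  | Tm_Step nat "(nat \<times> move) list" move move

record tm =
  tm_states :: nat
  tm_syms :: nat
  tm_tapes :: nat
  tm_delta :: "nat \<Rightarrow> bool cell \<Rightarrow> bool cell \<Rightarrow> nat list \<Rightarrow> tm_action"

definition wf_tm :: "tm \<Rightarrow> bool" where
  "wf_tm V \<longleftrightarrow> 0 < tm_states V \<and> 0 < tm_syms V \<and>
     (\<forall>q < tm_states V. \<forall>a b s q' ws m m'.
        length s = tm_tapes V \<and> set s \<subseteq> {..<tm_syms V} \<and>
        tm_delta V q a b s = Tm_Step q' ws m m' \<longrightarrow>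
          q' < tm_states V \<and> length ws = tm_tapes V \<and> fst ` set ws \<subseteq> {..<tm_syms V})"

fun tape_step :: "(nat \<Rightarrow> nat) \<times> nat \<Rightarrow> nat \<times> move \<Rightarrow> (nat \<Rightarrow> nat) \<times> nat" where
  "tape_step (t, h) (a, m) =
     (t(h := a), case m of Go_Left \<Rightarrow> h - 1 | Stay \<Rightarrow> h | Go_Right \<Rightarrow> h + 1)"

text \<open>The verdict reached within the given number of steps, if any.\<close>

fun tm_verdict ::
  "tm \<Rightarrow> bool list \<Rightarrow> bool list \<Rightarrow> nat \<Rightarrow> nat \<Rightarrow> nat \<Rightarrow> nat \<Rightarrow> ((nat \<Rightarrow> nat) \<times> nat) list \<Rightarrow> bool option"
where
  "tm_verdict V x w 0 q i j ts = None"
| "tm_verdict V x w (Suc n) q i j ts =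
     (case tm_delta V q (scan x i) (scan w j) (map (\<lambda>(t, h). t h) ts) of
        Accept \<Rightarrow> Some True
      | Reject \<Rightarrow> Some False
      | Tm_Step q' ws m m' \<Rightarrow>
          tm_verdict V x w n q' (shift x m i) (shift w m' j) (map2 tape_step ts ws))"

definition tm_run :: "tm \<Rightarrow> bool list \<Rightarrow> bool list \<Rightarrow> nat \<Rightarrow> bool option" where
  "tm_run V x w n = tm_verdict V x w n 0 0 0 (replicate (tm_tapes V) (\<lambda>_. 0, 0))"

definition NP :: "bool list set set" where
  "NP = {L. \<exists>V k. wf_tm V \<and>
     (\<forall>x w. length w \<le> poly_bound k (length x) \<longrightarrow>
        tm_run V x w (poly_bound k (length x)) \<noteq> None) \<and>
     (\<forall>x. x \<in> L \<longleftrightarrow> (\<exists>w. length w \<le> poly_bound k (length x) \<and>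
        tm_run V x w (poly_bound k (length x)) = Some True))}"


section \<open>Catalytic logspace machines with rounds of non-adaptive queries\<close>

text \<open>
  The machine has one finite control, with a separate transition function for each kind of phase.
  Its configuration is the pair of the work tape \<open>u\<close> and the catalytic tape \<open>\<tau>\<close>. Only the control
  state and the configuration survive a change of phase; all heads are reset.

  A \<open>Cl_Step\<close> consists of the new state, the symbols written to the work and the catalytic tape,
  the moves of the input, work and catalytic head, and an optional output bit.
  A \<open>Q_Step\<close> has no catalytic symbol, and writes to the query tape instead of the output tape:
  \<open>Some (Some b)\<close> writes a bit, \<open>Some None\<close> ends a query.
  An \<open>Ip_Step\<close> consists of the new state, the symbol written to the auxiliary work tape and the move
  of its head, the optional symbol written at the write head, whether the write head then moves
  right, and the move of the read head.
\<close>

datatype cl_action =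
    Halt
  | Ask nat
  | Cl_Step nat nat bool move move move "bool option"

datatype query_action =
    Submit nat
  | Q_Step nat nat move move move "bool option option"

datatype inplace_action =
    Await nat
  | Ip_Step nat nat move "nat option" bool move

record cl_machine =
  states :: nat
  syms :: nat
  work_const :: nat
  cat_exp :: nat
  query_exp :: nat
  cl_delta :: "nat \<Rightarrow> bool cell \<Rightarrow> nat cell \<Rightarrow> bool cell \<Rightarrow> cl_action"
  query_delta :: "nat \<Rightarrow> bool cell \<Rightarrow> nat cell \<Rightarrow> bool cell \<Rightarrow> query_action"
  inplace_delta :: "nat \<Rightarrow> nat cell \<Rightarrow> nat cell \<Rightarrow> inplace_action"
  answer_delta :: "nat \<Rightarrow> bool \<Rightarrow> nat \<times> bool option"

definition wf_cl_machine :: "cl_machine \<Rightarrow> bool" where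
  "wf_cl_machine M \<longleftrightarrow> 0 < states M \<and> 2 \<le> syms M \<and>
     (\<forall>q < states M. \<forall>a. \<forall>s \<in> cells_over (syms M). \<forall>b.
        (case cl_delta M q a s b of
           Halt \<Rightarrow> True
         | Ask q' \<Rightarrow> q' < states M
         | Cl_Step q' s' _ _ _ _ _ \<Rightarrow> q' < states M \<and> s' < syms M) \<and>
        (case query_delta M q a s b of
           Submit q' \<Rightarrow> q' < states M
         | Q_Step q' s' _ _ _ _ \<Rightarrow> q' < states M \<and> s' < syms M)) \<and>
     (\<forall>q < states M. \<forall>a \<in> cells_over (syms M). \<forall>s \<in> cells_over (syms M).
        (case inplace_delta M q a s of
           Await q' \<Rightarrow> q' < states M
         | Ip_Step q' s' _ wr _ _ \<Rightarrow>
             q' < states M \<and> s' < syms M \<and> set_option wr \<subseteq> {..<syms M})) \<and>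
     (\<forall>q < states M. \<forall>b. fst (answer_delta M q b) < states M)"

text \<open>
  \<open>cl_phase M x q i h j u \<tau> y r u' \<tau>'\<close>: ordinary computation from state \<open>q\<close> with input, work and
  catalytic heads at \<open>i\<close>, \<open>h\<close>, \<open>j\<close> writes \<open>y\<close> to the output tape and ends in configuration
  \<open>(u', \<tau>')\<close>, either by halting (\<open>r = None\<close>) or by opening a round in state \<open>q'\<close> (\<open>r = Some q'\<close>).
\<close>

inductive cl_phase ::
  "cl_machine \<Rightarrow> bool list \<Rightarrow> nat \<Rightarrow> nat \<Rightarrow> nat \<Rightarrow> nat \<Rightarrow> nat list \<Rightarrow> bool list \<Rightarrow>
   bool list \<Rightarrow> nat option \<Rightarrow> nat list \<Rightarrow> bool list \<Rightarrow> bool"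
  for M x
where
  cl_halt:
    "cl_delta M q (scan x i) (scan u h) (scan \<tau> j) = Halt \<Longrightarrow>
     cl_phase M x q i h j u \<tau> [] None u \<tau>"
| cl_ask:
    "cl_delta M q (scan x i) (scan u h) (scan \<tau> j) = Ask q' \<Longrightarrow>
     cl_phase M x q i h j u \<tau> [] (Some q') u \<tau>"
| cl_step:
    "cl_delta M q (scan x i) (scan u h) (scan \<tau> j) = Cl_Step q' a b mi mh mj w \<Longrightarrow>
     cl_phase M x q' (shift x mi i) (shift u mh h) (shift \<tau> mj j) (put u h a) (put \<tau> j b) y r u' \<tau>' \<Longrightarrow>
     cl_phase M x q i h j u \<tau> (emit w @ y) r u' \<tau>'"

text \<open>The FL computation that writes the query tape; the catalytic tape is only read.\<close>

inductive query_phase ::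
  "cl_machine \<Rightarrow> bool list \<Rightarrow> bool list \<Rightarrow> nat \<Rightarrow> nat \<Rightarrow> nat \<Rightarrow> nat \<Rightarrow> nat list \<Rightarrow>
   bool option list \<Rightarrow> nat \<Rightarrow> nat list \<Rightarrow> bool"
  for M x \<tau>
where
  query_submit:
    "query_delta M q (scan x i) (scan u h) (scan \<tau> j) = Submit q' \<Longrightarrow>
     query_phase M x \<tau> q i h j u [] q' u"
| query_step:
    "query_delta M q (scan x i) (scan u h) (scan \<tau> j) = Q_Step q' a mi mh mj w \<Longrightarrow>
     query_phase M x \<tau> q' (shift x mi i) (shift u mh h) (shift \<tau> mj j) (put u h a) t q'' u' \<Longrightarrow>
     query_phase M x \<tau> q i h j u (emit w @ t) q'' u'"

text \<open>The first argument is the part of the current query read so far.\<close>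

fun parse_queries :: "bool list \<Rightarrow> bool option list \<Rightarrow> bool list list" where
  "parse_queries acc [] = []"
| "parse_queries acc (Some b # t) = parse_queries (acc @ [b]) t"
| "parse_queries acc (None # t) = acc # parse_queries [] t"

text \<open>
  One-way in-place FL computation on \<open>z\<close>, with read head at \<open>r\<close>, write head at \<open>w\<close>, and auxiliary
  work tape \<open>v\<close> with head at \<open>h\<close>. A step that would leave the read head to the left of the write
  head is not possible. The input tape is not accessible.
\<close>

inductive inplace_phase ::
  "cl_machine \<Rightarrow> nat \<Rightarrow> nat \<Rightarrow> nat \<Rightarrow> nat \<Rightarrow> nat list \<Rightarrow> nat list \<Rightarrow> nat \<Rightarrow> nat list \<Rightarrow> bool"
  for M
where
  inplace_await:
    "inplace_delta M q (scan z r) (scan v h) = Await q' \<Longrightarrow>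
     inplace_phase M q r w h v z q' z"
| inplace_step:
    "inplace_delta M q (scan z r) (scan v h) = Ip_Step q' a mh wr adv mr \<Longrightarrow>
     w' = (if adv then w + 1 else w) \<Longrightarrow>
     r' = shift z mr r \<Longrightarrow>
     w' \<le> r' \<Longrightarrow>
     inplace_phase M q' r' w' (shift v mh h) (put v h a)
       (case wr of None \<Rightarrow> z | Some c \<Rightarrow> put z w c) q'' z' \<Longrightarrow>
     inplace_phase M q r w h v z q'' z'"

definition conf_string :: "nat list \<Rightarrow> bool list \<Rightarrow> nat list" where
  "conf_string u \<tau> = u @ map of_bool \<tau>"

text \<open>The computation must turn configurations into configurations.\<close>

definition inplace_on_conf ::
  "cl_machine \<Rightarrow> nat \<Rightarrow> nat list \<Rightarrow> bool list \<Rightarrow> nat \<Rightarrow> nat list \<Rightarrow> bool list \<Rightarrow> bool"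
where
  "inplace_on_conf M q u \<tau> q' u' \<tau>' \<longleftrightarrow>
     length u' = length u \<and> length \<tau>' = length \<tau> \<and>
     inplace_phase M q 1 1 0 (replicate (log_cells (work_const M) (length u + length \<tau>)) 0)
       (conf_string u \<tau>) q' (conf_string u' \<tau>')"

text \<open>
  Reading an answer changes the control state and may append a bit to the output tape, which is not
  part of the configuration.
\<close>

inductive answer_phase ::
  "cl_machine \<Rightarrow> bool list \<Rightarrow> nat \<Rightarrow> nat list \<Rightarrow> bool list \<Rightarrow>
   bool list \<Rightarrow> nat \<Rightarrow> nat list \<Rightarrow> bool list \<Rightarrow> bool"
  for M
where
  answer_done: "answer_phase M [] q u \<tau> [] q u \<tau>"
| answer_read:
    "inplace_on_conf M q u \<tau> q1 u1 \<tau>1 \<Longrightarrow>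
     answer_delta M q1 a = (q2, w) \<Longrightarrow>
     answer_phase M as q2 u1 \<tau>1 y q' u' \<tau>' \<Longrightarrow>
     answer_phase M (a # as) q u \<tau> (emit w @ y) q' u' \<tau>'"

text \<open>
  \<open>run M A x k q u \<tau> y \<tau>'\<close>: from state \<open>q\<close> and configuration \<open>(u, \<tau>)\<close>, the machine halts after
  exactly \<open>k\<close> rounds of queries to \<open>A\<close>, having written \<open>y\<close>, with catalytic tape \<open>\<tau>'\<close>.
\<close>

inductive run ::
  "cl_machine \<Rightarrow> bool list set \<Rightarrow> bool list \<Rightarrow> nat \<Rightarrow> nat \<Rightarrow> nat list \<Rightarrow> bool list \<Rightarrow>
   bool list \<Rightarrow> bool list \<Rightarrow> bool"
  for M A x
where
  run_halt:
    "cl_phase M x q 0 0 0 u \<tau> y None u' \<tau>' \<Longrightarrow> run M A x 0 q u \<tau> y \<tau>'"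
| run_round:
    "cl_phase M x q 0 0 0 u \<tau> y1 (Some q1) u1 \<tau>1 \<Longrightarrow>
     query_phase M x \<tau>1 q1 0 0 0 u1 t q2 u2 \<Longrightarrow>
     qs = parse_queries [] t \<Longrightarrow>
     length qs \<le> poly_bound (query_exp M) (length x) \<Longrightarrow>
     answer_phase M (map (\<lambda>p. p \<in> A) qs) q2 u2 \<tau>1 y2 q3 u3 \<tau>3 \<Longrightarrow>
     run M A x k q3 u3 \<tau>3 y3 \<tau>' \<Longrightarrow>
     run M A x (Suc k) q u \<tau> (y1 @ y2 @ y3) \<tau>'"

text \<open>
  The class consists of search problems, given as relations between inputs and correct outputs; a
  function is identified with its graph. The output may depend on the initial catalytic content.
\<close>

definition CL_NP_rounds :: "nat \<Rightarrow> (bool list \<times> bool list) set set" where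
  "CL_NP_rounds k = {S. \<exists>A \<in> NP. \<exists>M. wf_cl_machine M \<and>
     (\<forall>x \<tau>. length \<tau> = poly_bound (cat_exp M) (length x) \<longrightarrow>
        (\<exists>k' \<le> k. \<exists>y.
           run M A x k' 0 (replicate (log_cells (work_const M) (length x)) 0) \<tau> y \<tau> \<and>
           (x, y) \<in> S))}"


section \<open>The search problem FSAT\<close>

text \<open>
  A CNF formula consists of its number of variables and its clauses; the literal \<open>(v, s)\<close> is true iff
  variable \<open>v\<close> has value \<open>s\<close>.
\<close>

type_synonym cnf = "nat \<times> (nat \<times> bool) list list"

definition wf_cnf :: "cnf \<Rightarrow> bool" where
  "wf_cnf \<phi> \<longleftrightarrow> (\<forall>c \<in> set (snd \<phi>). \<forall>(v, s) \<in> set c. v < fst \<phi>)"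

definition satisfies :: "bool list \<Rightarrow> cnf \<Rightarrow> bool" where
  "satisfies y \<phi> \<longleftrightarrow> length y = fst \<phi> \<and> (\<forall>c \<in> set (snd \<phi>). \<exists>(v, s) \<in> set c. y ! v = s)"

fun nat_bits :: "nat \<Rightarrow> bool list" where
  "nat_bits n = (if n = 0 then [] else odd n # nat_bits (n div 2))"

declare nat_bits.simps [simp del]

text \<open>
  The number of variables is written in unary and ended by \<open>0\<close>. The clauses follow as a sequence of
  two-bit tokens: \<open>11\<close> opens a clause, \<open>10\<close> opens a literal, and \<open>0b\<close> is the digit \<open>b\<close>. The digits of
  a literal are its sign and its variable in binary, least significant bit first.
\<close>

definition digit :: "bool \<Rightarrow> bool list" where
  "digit b = [False, b]"

definition encode_literal :: "nat \<times> bool \<Rightarrow> bool list" where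
  "encode_literal l = [True, False] @ concat (map digit (snd l # nat_bits (fst l)))"

definition encode_clause :: "(nat \<times> bool) list \<Rightarrow> bool list" where
  "encode_clause c = [True, True] @ concat (map encode_literal c)"

definition encode_cnf :: "cnf \<Rightarrow> bool list" where
  "encode_cnf \<phi> = replicate (fst \<phi>) True @ [False] @ concat (map encode_clause (snd \<phi>))"

definition FSAT :: "(bool list \<times> bool list) set" where
  "FSAT = {(x, y). \<forall>\<phi>. wf_cnf \<phi> \<and> x = encode_cnf \<phi> \<and> (\<exists>\<alpha>. satisfies \<alpha> \<phi>) \<longrightarrow> satisfies y \<phi>}"

end

theory Submission
  imports Defs "HOL-Library.Countable_Set" "HOL-Library.Sublist"
begin

text \<open>
  The catalytic tape is cut into blocks, each holding a weight for every variable and one spare slot.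
  For a block, an NP oracle tells for every variable and every threshold whether some satisfying
  assignment that is at least that heavy gives the variable the value 0, respectively 1. If for no
  variable the two maximal weights agree, the heaviest satisfying assignment is unique and can be read
  off these answers. Otherwise some variable is ambiguous, and its weight is the difference of two
  maxima that do not involve it: the weight is redundant, its slot can take over the contents of the
  spare slot, and the spare slot stores the name of the variable, which is one bit shorter.

  In the first round, either some block isolates a solution, which is output, or every block is
  compressed. In the latter case there is one free bit per block, enough to find a satisfying assignment
  by exhaustive search, and the second round recomputes the erased weights.

  Queries whose answers are known in advance serve as commands to the answer phase. Its only effect on
  the configuration is to rotate it by one cell, possibly replacing the cell that moves to the end.
\<close>

section \<open>Structured programs and the machine that runs them\<close>

text \<open>Between two answers only the control state and the configuration survive; heads and
  auxiliary tape are reset, so the answer phase cannot keep an address. Addressing is therefore left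
  to the query phase, which sees the whole tape but no answer: it lists every conceivable overwrite
  in advance, and a full pass of rotations puts every cell back in place. The answers decide only
  one bit, whether a pass takes effect.

  The tape has to be restored on every input, so each bit string is read as a token list, and
  satisfiability and weights refer to that list.

  Let \<open>n\<close> be the input length and \<open>L = log_cells 2 n\<close>. Then
  \<open>n < 2 ^ (L - 1)\<close>, so the name of a variable leaves the top bit of a slot free. There
  are \<open>2 ^ L\<close> blocks because the tokens of a malformed input may mention any
  \<open>L\<close>-bit variable and the search needs a bit for each. Thresholds below
  \<open>2 ^ L * 2 ^ L\<close> cover all total weights. Only space is bounded, so the search may
  take exponential time.\<close>

abbreviation (input) tracks :: nat where "tracks \<equiv> 16"

section \<open>Small-step semantics of while programs\<close>

type_synonym eff = "(nat \<times> bool) option \<times> move \<times> move \<times> move \<times> bool option option"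

datatype com =
    Skip
  | Prim "bool cell \<Rightarrow> nat cell \<Rightarrow> bool cell \<Rightarrow> eff"
  | Cat_Write bool
  | Seq com com (infixr ";;" 60)
  | Cond "bool cell \<Rightarrow> nat cell \<Rightarrow> bool cell \<Rightarrow> bool" com com
  | While "bool cell \<Rightarrow> nat cell \<Rightarrow> bool cell \<Rightarrow> bool" com

abbreviation idle :: eff where "idle \<equiv> (None, Stay, Stay, Stay, None)"

text \<open>Passing over \<open>Skip\<close> and evaluating a test are idle steps of their own, so a
  condition always sees the cells reached by the preceding command.\<close>

fun nxt :: "com \<Rightarrow> bool cell \<Rightarrow> nat cell \<Rightarrow> bool cell \<Rightarrow> com \<times> eff \<times> bool option" where
  "nxt Skip a s b = (Skip, idle, None)"
| "nxt (Prim f) a s b = (Skip, f a s b, None)"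
| "nxt (Cat_Write v) a s b = (Skip, idle, Some v)"
| "nxt (c ;; d) a s b =
     (if c = Skip then (d, idle, None) else (case nxt c a s b of (c', e, v) \<Rightarrow> (c' ;; d, e, v)))"
| "nxt (Cond p c d) a s b = (if p a s b then c else d, idle, None)"
| "nxt (While p c) a s b = (if p a s b then c ;; While p c else Skip, idle, None)"

text \<open>These residual programs become control states of the machine. A loop contributes only
  unfoldings of its own body, so the set is finite although executions are unbounded.\<close>

fun residuals :: "com \<Rightarrow> com set" where
  "residuals Skip = {Skip}"
| "residuals (Prim f) = {Prim f, Skip}"
| "residuals (Cat_Write v) = {Cat_Write v, Skip}"
| "residuals (c ;; d) = (\<lambda>c'. c' ;; d) ` residuals c \<union> residuals d"
| "residuals (Cond p c d) = {Cond p c d} \<union> residuals c \<union> residuals d"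
| "residuals (While p c) = {While p c, Skip} \<union> (\<lambda>c'. c' ;; While p c) ` residuals c"

lemma finite_residuals: "finite (residuals c)"
  by (induction c) auto

lemma self_in_residuals [simp]: "c \<in> residuals c"
  by (induction c) auto

lemma Skip_in_residuals [simp]: "Skip \<in> residuals c"
  by (induction c) auto

lemma nxt_in_residuals: "d \<in> residuals c \<Longrightarrow> fst (nxt d a s b) \<in> residuals c"
proof (induction c arbitrary: d)
  case (Seq c1 c2)
  from Seq.prems consider d' where "d = d' ;; c2" "d' \<in> residuals c1" | "d \<in> residuals c2"
    by auto
  then show ?case
  proof cases
    case 1
    then show ?thesis
      using Seq.IH(1)[OF 1(2)] by (cases "d' = Skip"; cases "nxt d' a s b") simp_all
  qed (simp add: Seq.IH(2))
next
  case (While p c)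
  from While.prems consider d' where "d = d' ;; While p c" "d' \<in> residuals c" | "d = While p c" | "d = Skip"
    by auto
  then show ?case
  proof cases
    case 1
    then show ?thesis
      using While.IH[OF 1(2)] by (cases "d' = Skip"; cases "nxt d' a s b") simp_all
  qed simp_all
next
  case (Cond p c1 c2)
  from Cond.prems consider "d = Cond p c1 c2" | "d \<in> residuals c1" | "d \<in> residuals c2" by auto
  then show ?case using Cond.IH by cases auto
qed auto

text \<open>The query phase may only read the catalytic tape; \<open>Cat_Write\<close> is reserved
  for the exhaustive search.\<close>

fun read_only :: "com \<Rightarrow> bool" where
  "read_only (Cat_Write v) = False"
| "read_only (c ;; d) = (read_only c \<and> read_only d)"
| "read_only (Cond p c d) = (read_only c \<and> read_only d)"
| "read_only (While p c) = read_only c"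
| "read_only _ = True"

lemma read_only_nxt:
  "read_only c \<Longrightarrow> nxt c a s b = (c', e, v) \<Longrightarrow> read_only c' \<and> v = None"
proof (induction c arbitrary: c')
  case (Seq c1 c2)
  show ?case
  proof (cases "c1 = Skip")
    case False
    obtain d e' v' where n: "nxt c1 a s b = (d, e', v')" by (cases "nxt c1 a s b")
    with False Seq.prems have "c' = d ;; c2" "e' = e" "v' = v" by auto
    then show ?thesis using Seq.IH(1)[of d] n Seq.prems by simp
  qed (use Seq.prems in auto)
next
  case (Cond p c1 c2)
  show ?case using Cond.prems by (clarsimp split: if_splits)
next
  case (While p c)
  show ?case using While.prems by (clarsimp split: if_splits)
qed simp_all

text \<open>A symbol packs one bit of each of the 16 registers, hence \<open>65536\<close> symbols.
  \<open>take_bit\<close> keeps the result inside the alphabet whatever was read; the value 0 at an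
  end marker is never written.\<close>

definition wsym :: "nat cell \<Rightarrow> (nat \<times> bool) option \<Rightarrow> nat" where
  "wsym s wo = (case s of
     Sym k \<Rightarrow> take_bit tracks
       (case wo of None \<Rightarrow> k | Some (r, v) \<Rightarrow> if v then set_bit r k else unset_bit r k)
   | _ \<Rightarrow> 0)"

lemma wsym_less: "wsym s wo < 65536"
proof -
  have "take_bit 16 m < 65536" for m :: nat
    using take_bit_nat_less_exp[of 16 m] by simp
  then show ?thesis by (auto simp: wsym_def split: cell.splits)
qed

type_synonym conf = "nat \<times> nat \<times> nat \<times> nat list \<times> bool list"

text \<open>The stream collects all that is written: in a query phase it is the content of the query
  tape, in the exhaustive search its entries \<open>Some b\<close> are output bits.\<close>

inductive steps :: "bool list \<Rightarrow> com \<Rightarrow> conf \<Rightarrow> bool option list \<Rightarrow> com \<Rightarrow> conf \<Rightarrow> bool" for x where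
  steps_refl: "steps x c s [] c s"
| steps_step:
    "c \<noteq> Skip \<Longrightarrow>
     nxt c (scan x i) (scan u h) (scan \<tau> j) = (c', (wo, mi, mh, mj, w), v) \<Longrightarrow>
     steps x c' (shift x mi i, shift u mh h, shift \<tau> mj j, put u h (wsym (scan u h) wo),
       case v of None \<Rightarrow> \<tau> | Some b \<Rightarrow> put \<tau> j b) ws c'' s' \<Longrightarrow>
     steps x c (i, h, j, u, \<tau>) (emit w @ ws) c'' s'"

lemma steps_trans:
  "steps x c s ws c' s' \<Longrightarrow> steps x c' s' ws' c'' s'' \<Longrightarrow> steps x c s (ws @ ws') c'' s''"
  by (induction rule: steps.induct) (auto intro: steps_step)

lemma steps_SeqI:
  "steps x c s ws c' s' \<Longrightarrow> steps x (c ;; d) s ws (c' ;; d) s'"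
proof (induction rule: steps.induct)
  case (steps_step c i u h \<tau> j c' wo mi mh mj w v ws c'' s')
  show ?case
    by (rule steps.steps_step[OF _ _ steps_step.IH]) (use steps_step.hyps in auto)
qed (rule steps_refl)

section \<open>Flags and commands of the answer phase\<close>

type_synonym flags = "bool \<times> bool \<times> bool \<times> bool \<times> bool \<times> bool \<times> bool \<times> bool"

text \<open>
  The flags are, in this order: the threshold sets read so far for the current variable agree
  (\<open>eq\<close>); the value 1 is strictly heavier (\<open>gt\<close>); the last answer for the value 0 (\<open>p\<close>); some
  answer was positive (\<open>sat\<close>); no ambiguous variable in the current block so far (\<open>uq\<close>); a solution
  has been output (\<open>found\<close>); the current block is compressed (\<open>dn\<close>); overwriting is enabled (\<open>ac\<close>).

  The commands \<open>m\<close> are: 0 start a variable, 1 and 2 answers for the values 0 and 1, 3 record ambiguity,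
  4 output a bit, 5 end of block, 6 new block, 7 decide whether to overwrite, 8 rotate, 9 and 10 rotate
  and, if enabled, overwrite by 0 and 1.
\<close>

definition flags0 :: flags where
  "flags0 = (True, False, False, False, True, False, False, False)"

definition f_sat :: "flags \<Rightarrow> bool" where "f_sat = (\<lambda>(eq, gt, p, sat, uq, found, dn, ac). sat)"
definition f_found :: "flags \<Rightarrow> bool" where "f_found = (\<lambda>(eq, gt, p, sat, uq, found, dn, ac). found)"
definition f_ac :: "flags \<Rightarrow> bool" where "f_ac = (\<lambda>(eq, gt, p, sat, uq, found, dn, ac). ac)"

fun exec_flags :: "nat \<Rightarrow> flags \<Rightarrow> bool \<Rightarrow> flags" where
  "exec_flags m (eq, gt, p, sat, uq, found, dn, ac) d =
    (if m = 0 then (True, False, p, sat, uq, found, dn, ac)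
     else if m = 1 then (eq, gt, d, sat, uq, found, dn, ac)
     else if m = 2 then (eq \<and> p = d, gt \<or> d \<and> \<not> p, p, sat \<or> p \<or> d, uq, found, dn, ac)
     else if m = 3 then (eq, gt, p, sat, uq \<and> \<not> eq, found, dn, ac)
     else if m = 5 then (eq, gt, p, sat, True, found \<or> uq, dn, ac)
     else if m = 6 then (eq, gt, p, sat, uq, found, False, ac)
     else if m = 7 then (let a = eq \<and> \<not> dn \<and> \<not> found \<and> sat in (eq, gt, p, sat, uq, found, dn \<or> a, a))
     else (eq, gt, p, sat, uq, found, dn, ac))"

fun exec_out :: "nat \<Rightarrow> flags \<Rightarrow> bool option" where
  "exec_out m (eq, gt, p, sat, uq, found, dn, ac) = (if m = 4 \<and> uq \<and> \<not> found then Some gt else None)"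

definition new_bit :: "nat \<Rightarrow> flags \<Rightarrow> bool \<Rightarrow> bool" where
  "new_bit m f b = (if f_ac f \<and> m = 9 then False else if f_ac f \<and> m = 10 then True else b)"

text \<open>In \<open>Ans r m e f\<close>, \<open>m\<close> is the opcode counted so far in round
  \<open>r\<close>, and \<open>e\<close> says that it is complete, so that the next answer is its
  operand. \<open>Rot\<close> carries the bit that will be appended at the end of a rotation, and
  \<open>Fin\<close> separates the last write from the return to the answer tape.\<close>

datatype mstate =
    Start
  | Qry nat com
  | Brute com
  | Ans nat nat bool flags
  | Rot nat nat flags bool
  | Fin nat nat flags

section \<open>The machine assembled from three programs\<close>

locale machine =
  fixes p1 pb p2 :: com and kc kq :: nat
begin

text \<open>Opcodes end at 10. The value 11 absorbs longer runs of negative answers, which closes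
  the finite set under all transitions.\<close>

definition all_states :: "mstate set" where
  "all_states = {Start} \<union> Qry 1 ` residuals p1 \<union> Qry 2 ` residuals p2 \<union> Brute ` residuals pb
     \<union> (\<lambda>(r, m, e, f). Ans r m e f) ` ({1,2} \<times> {..11} \<times> UNIV \<times> UNIV)
     \<union> (\<lambda>(r, m, f, b). Rot r m f b) ` ({1,2} \<times> {..11} \<times> UNIV \<times> UNIV)
     \<union> (\<lambda>(r, m, f). Fin r m f) ` ({1,2} \<times> {..11} \<times> UNIV)"

lemma finite_all_states: "finite all_states"
  unfolding all_states_def by (simp add: finite_residuals)

text \<open>The run has to begin in state 0, so this number is given to \<open>Start\<close> and the
  enumeration of the state set is shifted by one.\<close>

definition st :: "nat \<Rightarrow> mstate" where
  "st q = (case q of 0 \<Rightarrow> Start | Suc p \<Rightarrow> from_nat_into all_states p)"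

definition en :: "mstate \<Rightarrow> nat" where
  "en s = Suc (to_nat_on all_states s)"

lemma st_en [simp]: "s \<in> all_states \<Longrightarrow> st (en s) = s"
  by (simp add: st_def en_def countable_finite finite_all_states)

lemma st_0 [simp]: "st 0 = Start"
  by (simp add: st_def)

lemma en_less: "s \<in> all_states \<Longrightarrow> en s < Suc (card all_states)"
  using bij_betwE[OF to_nat_on_finite[OF finite_all_states]] by (simp add: en_def)

lemma st_in: "st q \<in> all_states"
proof -
  have "Start \<in> all_states" by (simp add: all_states_def)
  then show ?thesis using from_nat_into[of all_states] by (auto simp: st_def split: nat.splits)
qed

lemma Ans_in [simp]: "Ans r m e f \<in> all_states \<longleftrightarrow> r \<in> {1,2} \<and> m \<le> 11"
  by (cases f) (auto simp: all_states_def image_iff)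

lemma Rot_in [simp]: "Rot r m f b \<in> all_states \<longleftrightarrow> r \<in> {1,2} \<and> m \<le> 11"
  by (cases f) (auto simp: all_states_def image_iff)

lemma Fin_in [simp]: "Fin r m f \<in> all_states \<longleftrightarrow> r \<in> {1,2} \<and> m \<le> 11"
  by (cases f) (auto simp: all_states_def image_iff)

lemma Brute_in [simp]: "Brute c \<in> all_states \<longleftrightarrow> c \<in> residuals pb"
  by (auto simp: all_states_def image_iff)

lemma Qry_in [simp]:
  "Qry r c \<in> all_states \<longleftrightarrow> r = 1 \<and> c \<in> residuals p1 \<or> r = 2 \<and> c \<in> residuals p2"
  by (auto simp: all_states_def image_iff)

text \<open>A rotation rewrites every cell as 0 or 1, also those of the work tape. It is faithful
  only if all registers have been cleared, so the query programs end with an all-zero work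
  tape.\<close>

definition M :: cl_machine where
  "M = \<lparr>states = Suc (card all_states), syms = 65536, work_const = 2, cat_exp = kc, query_exp = kq,
    cl_delta = (\<lambda>q a s b. case st q of
        Start \<Rightarrow> Ask (en (Qry 1 p1))
      | Brute c \<Rightarrow> if c = Skip then Ask (en (Qry 2 p2))
          else (case nxt c a s b of (c', (wo, mi, mh, mj, w), v) \<Rightarrow>
            Cl_Step (en (Brute c')) (wsym s wo) (case v of None \<Rightarrow> b = Sym True | Some b' \<Rightarrow> b')
              mi mh mj (case w of Some (Some y) \<Rightarrow> Some y | _ \<Rightarrow> None))
      | Ans r m e f \<Rightarrow> if r = 1 \<and> f_sat f \<and> \<not> f_found f
          then Cl_Step (en (Brute pb)) 0 False Stay Stay Stay None else Halt
      | _ \<Rightarrow> Halt),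
    query_delta = (\<lambda>q a s b. case st q of
        Qry r c \<Rightarrow> if c = Skip then Submit (en (Ans r 0 False flags0))
          else (case nxt c a s b of (c', (wo, mi, mh, mj, w), v) \<Rightarrow>
            Q_Step (en (Qry r c')) (wsym s wo) mi mh mj w)
      | _ \<Rightarrow> Submit 0),
    inplace_delta = (\<lambda>q a s. case st q of
        Ans r m e f \<Rightarrow> (case a of
            Sym b \<Rightarrow> if e \<and> 8 \<le> m \<and> m \<le> 10
              then Ip_Step (en (Rot r m f (new_bit m f (b = 1)))) 0 Stay None False Go_Right
              else Await (en (Ans r m e f))
          | _ \<Rightarrow> Await (en (Ans r m e f)))
      | Rot r m f c \<Rightarrow> (case a of
            Sym b \<Rightarrow> Ip_Step (en (Rot r m f c)) 0 Stay (Some (of_bool (b = 1))) True Go_Right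
          | _ \<Rightarrow> Ip_Step (en (Fin r m f)) 0 Stay (Some (of_bool c)) False Stay)
      | Fin r m f \<Rightarrow> Await (en (Ans r m True f))
      | _ \<Rightarrow> Await 0),
    answer_delta = (\<lambda>q d. case st q of
        Ans r m e f \<Rightarrow> if e then (en (Ans r 0 False (exec_flags m f d)), exec_out m f)
          else if d then (en (Ans r m True f), None) else (en (Ans r (min (m + 1) 11) False f), None)
      | _ \<Rightarrow> (0, None))\<rparr>"

lemma M_simps [simp]:
  "states M = Suc (card all_states)" "syms M = 65536" "work_const M = 2" "cat_exp M = kc"
  "query_exp M = kq"
  by (simp_all add: M_def)

lemma wf_M: "wf_cl_machine M"
proof -
  have cl: "case cl_delta M q a s b of
           Halt \<Rightarrow> True
         | Ask q' \<Rightarrow> q' < states M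
         | Cl_Step q' s' _ _ _ _ _ \<Rightarrow> q' < states M \<and> s' < syms M" for q a s b
  proof (cases "st q")
    case (Brute c)
    obtain c' wo mi mh mj w v where n: "nxt c a s b = (c', (wo, mi, mh, mj, w), v)"
      by (cases "nxt c a s b") auto
    have "c \<in> residuals pb" using st_in[of q] Brute by simp
    then have "c' \<in> residuals pb" using nxt_in_residuals[of c pb a s b] n by simp
    with Brute n show ?thesis by (simp add: M_def wsym_less en_less)
  qed (simp_all add: M_def en_less)
  have query: "case query_delta M q a s b of
           Submit q' \<Rightarrow> q' < states M
         | Q_Step q' s' _ _ _ _ \<Rightarrow> q' < states M \<and> s' < syms M" for q a s b
  proof (cases "st q")
    case (Qry r c)
    obtain c' wo mi mh mj w v where n: "nxt c a s b = (c', (wo, mi, mh, mj, w), v)"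
      by (cases "nxt c a s b") auto
    have c: "Qry r c \<in> all_states" using st_in[of q] Qry by simp
    then have "Qry r c' \<in> all_states"
      using nxt_in_residuals[of c p1 a s b] nxt_in_residuals[of c p2 a s b] n by auto
    moreover have "Ans r 0 False flags0 \<in> all_states" using c by auto
    ultimately show ?thesis using Qry n by (simp add: M_def wsym_less en_less)
  qed (simp_all add: M_def)
  have inplace: "case inplace_delta M q a s of
           Await q' \<Rightarrow> q' < states M
         | Ip_Step q' s' _ wr _ _ \<Rightarrow>
             q' < states M \<and> s' < syms M \<and> set_option wr \<subseteq> {..<syms M}" for q a s
    using st_in[of q] by (cases "st q"; cases a) (auto simp: M_def en_less)
  have answer: "fst (answer_delta M q b) < states M" for q b
    using st_in[of q] by (cases "st q") (auto simp: M_def en_less)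
  show ?thesis
    unfolding wf_cl_machine_def using cl query inplace answer by simp
qed

lemma put_scan [simp]: "scan \<tau> j = Sym b \<Longrightarrow> put \<tau> j b = \<tau>"
  by (auto simp: scan_def put_def split: if_splits)

lemma put_scan_end: "scan \<tau> j = LEnd \<or> scan \<tau> j = REnd \<Longrightarrow> put \<tau> j b = \<tau>"
  by (auto simp: scan_def put_def split: if_splits intro!: list_update_beyond)

text \<open>A \<open>Cl_Step\<close> always writes to the catalytic tape, so a command without
  catalytic effect has to write back the scanned bit; on an end marker nothing happens.\<close>

lemma put_idle: "put \<tau> j (scan \<tau> j = Sym True) = \<tau>"
  by (cases "scan \<tau> j") (auto simp: put_scan_end)

lemma brute_phase:
  assumes "steps x c (i, h, j, u, \<tau>) ws Skip (i', h', j', u', \<tau>')" "c \<in> residuals pb"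
  shows "cl_phase M x (en (Brute c)) i h j u \<tau> (List.map_filter id ws) (Some (en (Qry 2 p2))) u' \<tau>'"
proof -
  have "steps x c s ws d s' \<Longrightarrow> d = Skip \<Longrightarrow> c \<in> residuals pb \<Longrightarrow>
    (case s of (i, h, j, u, \<tau>) \<Rightarrow> case s' of (i', h', j', u', \<tau>') \<Rightarrow>
     cl_phase M x (en (Brute c)) i h j u \<tau> (List.map_filter id ws) (Some (en (Qry 2 p2))) u' \<tau>')"
    for c s ws d s'
  proof (induction rule: steps.induct)
    case (steps_refl c s)
    then show ?case by (cases s) (auto simp: M_def List.map_filter_def intro!: cl_ask)
  next
    case (steps_step c i u h \<tau> j c' wo mi mh mj w v ws c'' s')
    obtain i' h' j' u' \<tau>' where s': "s' = (i', h', j', u', \<tau>')" by (cases s')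
    have c': "c' \<in> residuals pb"
      using nxt_in_residuals[OF steps_step.prems(2), of "scan x i" "scan u h" "scan \<tau> j"] steps_step.hyps(2) by simp
    have t: "(case v of None \<Rightarrow> \<tau> | Some b \<Rightarrow> put \<tau> j b)
        = put \<tau> j (case v of None \<Rightarrow> scan \<tau> j = Sym True | Some b' \<Rightarrow> b')"
      by (auto simp: put_idle split: option.splits)
    have o: "List.map_filter id (emit w @ ws) =
       emit (case w of Some (Some y) \<Rightarrow> Some y | _ \<Rightarrow> None) @ List.map_filter id ws"
      by (auto simp: emit_def List.map_filter_def split: option.splits)
    have d: "cl_delta M (en (Brute c)) (scan x i) (scan u h) (scan \<tau> j) =
        Cl_Step (en (Brute c')) (wsym (scan u h) wo)
          (case v of None \<Rightarrow> scan \<tau> j = Sym True | Some b' \<Rightarrow> b') mi mh mj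
          (case w of Some (Some y) \<Rightarrow> Some y | _ \<Rightarrow> None)"
      using steps_step.hyps steps_step.prems by (simp add: M_def)
    show ?case
      unfolding s' prod.case o
      using steps_step.IH[OF steps_step.prems(1) c'] unfolding s' t prod.case by (rule cl_step[OF d])
  qed
  from this[OF assms(1) refl assms(2)] show ?thesis by simp
qed

lemma query_phase_run:
  assumes "steps x c (i, h, j, u, \<tau>) ws Skip (i', h', j', u', \<tau>')" "read_only c"
    "r = 1 \<and> c \<in> residuals p1 \<or> r = 2 \<and> c \<in> residuals p2"
  shows "query_phase M x \<tau> (en (Qry r c)) i h j u ws (en (Ans r 0 False flags0)) u'"
proof -
  have "steps x c s ws d s' \<Longrightarrow> d = Skip \<Longrightarrow> read_only c \<Longrightarrow>
     r = 1 \<and> c \<in> residuals p1 \<or> r = 2 \<and> c \<in> residuals p2 \<Longrightarrow>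
    (case s of (i, h, j, u, \<tau>) \<Rightarrow> case s' of (i', h', j', u', \<tau>') \<Rightarrow>
      query_phase M x \<tau> (en (Qry r c)) i h j u ws (en (Ans r 0 False flags0)) u')"
    for c s ws d s'
  proof (induction rule: steps.induct)
    case (steps_refl c s)
    then show ?case by (cases s) (auto simp: M_def intro!: query_submit)
  next
    case (steps_step c i u h \<tau> j c' wo mi mh mj w v ws c'' s')
    obtain i' h' j' u' \<tau>' where s': "s' = (i', h', j', u', \<tau>')" by (cases s')
    have c': "r = 1 \<and> c' \<in> residuals p1 \<or> r = 2 \<and> c' \<in> residuals p2"
      using nxt_in_residuals[of c _ "scan x i" "scan u h" "scan \<tau> j"] steps_step.hyps(2)
        steps_step.prems(3) by force
    have ro: "read_only c'" "v = None"
      using read_only_nxt steps_step.hyps(2) steps_step.prems(2) by blast+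
    have d: "query_delta M (en (Qry r c)) (scan x i) (scan u h) (scan \<tau> j) =
        Q_Step (en (Qry r c')) (wsym (scan u h) wo) mi mh mj w"
      using steps_step.hyps steps_step.prems by (simp add: M_def)
    show ?case
      unfolding s' prod.case
      using steps_step.IH[OF steps_step.prems(1) ro(1) c'] unfolding s' ro(2) prod.case option.case
      by (rule query_step[OF d])
  qed
  from this[OF assms(1) refl assms(2,3)] show ?thesis by simp
qed

end

section \<open>Work-tape registers and a Hoare logic\<close>

lemma concat_Nils [simp]: "concat (map (\<lambda>_. []) xs) = []"
  by (induction xs) auto

text \<open>The content of a register whose first \<open>k\<close> cells have already received the
  bits of \<open>v\<close>. This is the invariant of the loops that rewrite a register cell by
  cell.\<close>

definition mix :: "nat \<Rightarrow> nat \<Rightarrow> nat \<Rightarrow> nat" where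
  "mix k v m = or (take_bit k v) (push_bit k (drop_bit k m))"

lemma bit_mix: "bit (mix k v m) i = (if i < k then bit v i else bit m i)"
  by (auto simp: mix_def bit_simps)

definition set_to :: "nat \<Rightarrow> bool \<Rightarrow> nat \<Rightarrow> nat" where
  "set_to k b m = (if b then set_bit k m else unset_bit k m)"

lemma bit_set_to: "bit (set_to k b m) i = (if i = k then b else bit m i)"
  by (auto simp: set_to_def bit_simps)

lemma mix_0 [simp]: "mix 0 v m = m"
  by (rule bit_eqI) (simp add: bit_mix)

lemma mix_Suc: "set_to k (bit v k) (mix k v m) = mix (Suc k) v m"
  by (rule bit_eqI) (auto simp: bit_mix bit_set_to less_Suc_eq)

lemma bit_less_exp: "bit (m::nat) i \<Longrightarrow> m < 2 ^ n \<Longrightarrow> i < n"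
  by (metis bit_take_bit_iff take_bit_nat_eq_self)

lemma mix_all: "v < 2 ^ n \<Longrightarrow> m < 2 ^ n \<Longrightarrow> mix n v m = v"
  by (rule bit_eqI) (auto simp: bit_mix dest: bit_less_exp)

lemma less_exp_if_bits: "(\<And>i. bit (m::nat) i \<Longrightarrow> i < n) \<Longrightarrow> m < 2 ^ n"
  by (metis bit_eqI bit_take_bit_iff take_bit_nat_less_exp)

lemma nat_eq_iff_low_bits:
  "m < 2 ^ n \<Longrightarrow> m' < 2 ^ n \<Longrightarrow> (\<forall>k<n. bit (m::nat) k = bit m' k) \<longleftrightarrow> m = m'"
  by (metis bit_eqI bit_less_exp)

text \<open>The \<open>k\<close> low ones are worth \<open>2 ^ k - 1\<close>. Clearing them and
  setting bit \<open>k\<close> is a net gain of 1.\<close>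

lemma inc_bits:
  assumes "\<And>i. i < k \<Longrightarrow> bit (m::nat) i" "\<not> bit m k"
  shows "set_to k True (mix k 0 m) = m + 1"
proof -
  have t: "take_bit k m = mask k"
    by (rule bit_eqI) (use assms in \<open>auto simp: bit_simps\<close>)
  have mx: "mix k 0 m = push_bit k (drop_bit k m)" by (simp add: mix_def)
  have "push_bit k (drop_bit k m) + take_bit k m = m" by (rule bits_ident)
  then have e: "mix k 0 m + (2 ^ k - 1) = m" using t mx by (simp add: mask_eq_exp_minus_1)
  have "\<not> bit (mix k 0 m) k" using assms by (simp add: bit_mix)
  then have "set_to k True (mix k 0 m) = mix k 0 m + 2 ^ k"
    by (simp add: set_to_def set_bit_eq)
  moreover have "(2::nat) ^ k \<ge> 1" by simp
  ultimately show ?thesis using e by linarith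
qed

text \<open>The bit changes of an increment undo those of a decrement, so \<open>inc_bits\<close>
  applied to the result gives back \<open>m\<close>.\<close>

lemma dec_bits:
  assumes "\<And>i. i < k \<Longrightarrow> \<not> bit (m::nat) i" "bit m k"
  shows "set_to k False (mix k (mask k) m) = m - 1"
proof -
  have e: "set_to k True (mix k 0 (set_to k False (mix k (mask k) m))) = set_to k False (mix k (mask k) m) + 1"
    by (rule inc_bits) (auto simp: bit_set_to bit_mix bit_simps)
  have "set_to k True (mix k 0 (set_to k False (mix k (mask k) m))) = m"
    by (rule bit_eqI) (use assms in \<open>auto simp: bit_set_to bit_mix\<close>)
  with e show ?thesis by simp
qed

section \<open>Registers as tracks of the work tape\<close>

definition symb :: "(nat \<Rightarrow> nat) \<Rightarrow> nat \<Rightarrow> nat" where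
  "symb \<rho> k = horner_sum of_bool 2 (map (\<lambda>r. bit (\<rho> r) k) [0..<tracks])"

lemma bit_symb: "bit (symb \<rho> k) r \<longleftrightarrow> r < tracks \<and> bit (\<rho> r) k"
  unfolding symb_def by (auto simp: bit_horner_sum_bit_iff simp del: upt_rec_numeral)

definition upd :: "(nat \<Rightarrow> nat) \<Rightarrow> nat \<Rightarrow> nat \<Rightarrow> bool \<Rightarrow> nat \<Rightarrow> nat" where
  "upd \<rho> r k b = \<rho>(r := set_to k b (\<rho> r))"

type_synonym state = "nat \<times> nat \<times> nat \<times> (nat \<Rightarrow> nat) \<times> bool list"

text \<open>A loop condition sees only the scanned cells. A property of a whole register is
  therefore tested by a program \<open>t\<close> that leaves its verdict in the position of the work
  head.\<close>

definition While_Test :: "com \<Rightarrow> (bool cell \<Rightarrow> nat cell \<Rightarrow> bool cell \<Rightarrow> bool) \<Rightarrow> com \<Rightarrow> com" where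
  "While_Test t p c = t ;; While p (c ;; t)"

text \<open>Head positions are known only up to sets, because most programs leave the heads wherever
  they stop; registers and tape are known exactly.\<close>

definition At :: "nat set \<Rightarrow> nat set \<Rightarrow> nat set \<Rightarrow> (nat \<Rightarrow> nat) \<Rightarrow> bool list \<Rightarrow> state \<Rightarrow> bool" where
  "At I H J \<rho> \<tau> = (\<lambda>(i, h, j, \<rho>', \<tau>'). i \<in> I \<and> h \<in> H \<and> j \<in> J \<and> \<rho>' = \<rho> \<and> \<tau>' = \<tau>)"

definition move_work :: "move \<Rightarrow> com" where
  "move_work m = Prim (\<lambda>_ _ _. (None, Stay, m, Stay, None))"
definition move_in :: "move \<Rightarrow> com" where
  "move_in m = Prim (\<lambda>_ _ _. (None, m, Stay, Stay, None))"
definition move_cat :: "move \<Rightarrow> com" where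
  "move_cat m = Prim (\<lambda>_ _ _. (None, Stay, Stay, m, None))"
definition out :: "bool option \<Rightarrow> com" where
  "out w = Prim (\<lambda>_ _ _. (None, Stay, Stay, Stay, Some w))"
definition wset :: "nat \<Rightarrow> (bool cell \<Rightarrow> nat cell \<Rightarrow> bool cell \<Rightarrow> bool) \<Rightarrow> com" where
  "wset r g = Prim (\<lambda>a s b. (Some (r, g a s b), Stay, Stay, Stay, None))"

fun em :: "bool option list \<Rightarrow> com" where
  "em [] = Skip"
| "em (w # ws) = out w ;; em ws"

definition wstart :: com where
  "wstart = While (\<lambda>a s b. s \<noteq> LEnd) (move_work Go_Left) ;; move_work Go_Right"
definition istart :: com where
  "istart = While (\<lambda>a s b. a \<noteq> LEnd) (move_in Go_Left) ;; move_in Go_Right"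
definition cstart :: com where
  "cstart = While (\<lambda>a s b. b \<noteq> LEnd) (move_cat Go_Left) ;; move_cat Go_Right"

definition on_sym :: "(nat \<Rightarrow> bool) \<Rightarrow> nat cell \<Rightarrow> bool" where
  "on_sym \<phi> s = (case s of Sym t \<Rightarrow> \<phi> t | _ \<Rightarrow> False)"

definition scan_work :: "(nat \<Rightarrow> bool) \<Rightarrow> com" where
  "scan_work \<phi> = wstart ;; While (\<lambda>a s b. on_sym \<phi> s) (move_work Go_Right)"

definition inc :: "nat \<Rightarrow> com" where
  "inc r = wstart ;; While (\<lambda>a s b. on_sym (\<lambda>t. bit t r) s) (wset r (\<lambda>_ _ _. False) ;; move_work Go_Right)
     ;; wset r (\<lambda>_ _ _. True)"
definition dec :: "nat \<Rightarrow> com" where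
  "dec r = wstart ;; While (\<lambda>a s b. on_sym (\<lambda>t. \<not> bit t r) s) (wset r (\<lambda>_ _ _. True) ;; move_work Go_Right)
     ;; wset r (\<lambda>_ _ _. False)"

definition for_cells :: "com \<Rightarrow> com" where
  "for_cells c = wstart ;; While (\<lambda>a s b. s \<noteq> REnd) (c ;; move_work Go_Right)"

definition zero :: "nat \<Rightarrow> com" where
  "zero r = for_cells (wset r (\<lambda>_ _ _. False))"
definition copy :: "nat \<Rightarrow> nat \<Rightarrow> com" where
  "copy r r' = for_cells (wset r' (\<lambda>a s b. on_sym (\<lambda>t. bit t r) s))"
definition load :: "nat \<Rightarrow> com" where
  "load r = for_cells (wset r (\<lambda>a s b. b = Sym True) ;; move_cat Go_Right)"
definition clear_top :: "nat \<Rightarrow> com" where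
  "clear_top r = wstart ;; While (\<lambda>a s b. s \<noteq> REnd) (move_work Go_Right) ;; move_work Go_Left
     ;; wset r (\<lambda>_ _ _. False)"
definition set_one :: "nat \<Rightarrow> com" where
  "set_one r = wstart ;; wset r (\<lambda>_ _ _. True)"

definition repeat :: "nat \<Rightarrow> com \<Rightarrow> com" where
  "repeat r c = While_Test (scan_work (\<lambda>t. \<not> bit t r)) (\<lambda>a s b. s \<noteq> REnd) (dec r ;; c)"
text \<open>The counter cannot hold \<open>2 ^ L\<close>. Hence the body runs once before the loop,
  and the loop ends at the all-ones register.\<close>

definition for_all :: "nat \<Rightarrow> com \<Rightarrow> com" where
  "for_all r c = c ;; While_Test (scan_work (\<lambda>t. bit t r)) (\<lambda>a s b. s \<noteq> REnd) (inc r ;; c) ;; zero r"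
text \<open>The counter is incremented before the body, which thus sees \<open>1, ..., n\<close>:
  the slots of the variables, slot 0 being spare.\<close>

definition for_upto :: "nat \<Rightarrow> nat \<Rightarrow> com \<Rightarrow> com" where
  "for_upto r r' c = While_Test (scan_work (\<lambda>t. bit t r = bit t r')) (\<lambda>a s b. s \<noteq> REnd) (inc r ;; c)
     ;; zero r"

abbreviation (input) Any :: "(nat \<Rightarrow> nat) \<Rightarrow> bool list \<Rightarrow> state \<Rightarrow> bool" where
  "Any \<equiv> At UNIV UNIV UNIV"

section \<open>Executions and Hoare triples over registers\<close>

locale work =
  fixes x :: "bool list" and L :: nat
  assumes L_pos: "0 < L"
begin

definition enc :: "(nat \<Rightarrow> nat) \<Rightarrow> nat list" where
  "enc \<rho> = map (symb \<rho>) [0..<L]"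

lemma length_enc [simp]: "length (enc \<rho>) = L"
  by (simp add: enc_def)

lemma scan_enc: "scan (enc \<rho>) h = (if h = 0 then LEnd else if h \<le> L then Sym (symb \<rho> (h - 1)) else REnd)"
  by (auto simp: scan_def enc_def)

lemma put_enc_None [simp]: "put (enc \<rho>) h (wsym (scan (enc \<rho>) h) None) = enc \<rho>"
proof (cases "1 \<le> h \<and> h \<le> L")
  case True
  have "take_bit 16 (symb \<rho> k) = symb \<rho> k" for k
    by (rule bit_eqI) (auto simp: bit_simps bit_symb)
  with True have "wsym (scan (enc \<rho>) h) None = symb \<rho> (h - 1)"
    by (simp add: scan_enc wsym_def)
  with True show ?thesis
    by (auto simp: put_def enc_def intro!: nth_equalityI simp: nth_list_update)
next
  case False
  then show ?thesis by (auto simp: put_def intro!: list_update_beyond)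
qed

lemma put_enc_Some:
  assumes "1 \<le> h" "h \<le> L" "r < tracks"
  shows "put (enc \<rho>) h (wsym (scan (enc \<rho>) h) (Some (r, b))) = enc (upd \<rho> r (h - 1) b)"
proof -
  have e: "take_bit 16 (if b then set_bit r (symb \<rho> k) else unset_bit r (symb \<rho> k)) = symb (upd \<rho> r k b) k" for k
    by (rule bit_eqI) (use assms in \<open>auto simp: bit_simps bit_symb upd_def bit_set_to\<close>)
  have o: "symb (upd \<rho> r (h - 1) b) k = symb \<rho> k" if "k \<noteq> h - 1" for k
    by (rule bit_eqI) (use that in \<open>auto simp: bit_symb upd_def bit_set_to\<close>)
  have "wsym (scan (enc \<rho>) h) (Some (r, b)) = symb (upd \<rho> r (h - 1) b) (h - 1)"
    using assms by (simp add: scan_enc wsym_def e)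
  with assms show ?thesis
    by (auto simp: put_def o[simplified] enc_def nth_list_update intro!: nth_equalityI)
qed

lemma put_enc_Some_end:
  assumes "\<not> h \<le> L"
  shows "put (enc \<rho>) h a = enc \<rho>"
  using assms by (auto simp: put_def intro!: list_update_beyond)

fun lift :: "state \<Rightarrow> conf" where
  "lift (i, h, j, \<rho>, \<tau>) = (i, h, j, enc \<rho>, \<tau>)"

definition ex :: "com \<Rightarrow> state \<Rightarrow> bool option list \<Rightarrow> state \<Rightarrow> bool" where
  "ex c s w s' \<longleftrightarrow> steps x c (lift s) w Skip (lift s')"

fun holds :: "(bool cell \<Rightarrow> nat cell \<Rightarrow> bool cell \<Rightarrow> bool) \<Rightarrow> state \<Rightarrow> bool" where
  "holds p (i, h, j, \<rho>, \<tau>) = p (scan x i) (scan (enc \<rho>) h) (scan \<tau> j)"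

fun wmove :: "move \<Rightarrow> nat \<Rightarrow> nat" where
  "wmove Go_Left h = h - 1"
| "wmove Stay h = h"
| "wmove Go_Right h = min (h + 1) (L + 1)"

lemma shift_enc [simp]: "shift (enc \<rho>) m h = wmove m h"
  by (cases m) auto

lemma ex_idle_step:
  assumes "c \<noteq> Skip" "nxt c (scan x i) (scan (enc \<rho>) h) (scan \<tau> j) = (c', idle, None)"
    "steps x c' (i, h, j, enc \<rho>, \<tau>) w Skip s'"
  shows "steps x c (i, h, j, enc \<rho>, \<tau>) w Skip s'"
  using steps_step[OF assms(1,2)] assms(3) by (simp add: emit_def)

lemma ex_Skip: "ex Skip s [] s"
  by (simp add: ex_def steps_refl)

lemma ex_Prim:
  assumes "f (scan x i) (scan (enc \<rho>) h) (scan \<tau> j) = (None, mi, mh, mj, w)"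
  shows "ex (Prim f) (i, h, j, \<rho>, \<tau>) (emit w) (shift x mi i, wmove mh h, shift \<tau> mj j, \<rho>, \<tau>)"
proof -
  have "steps x (Prim f) (i, h, j, enc \<rho>, \<tau>) (emit w @ []) Skip (shift x mi i, wmove mh h, shift \<tau> mj j, enc \<rho>, \<tau>)"
    by (rule steps_step) (auto simp: assms intro: steps_refl)
  then show ?thesis by (simp add: ex_def)
qed

lemma ex_Cat: "ex (Cat_Write v) (i, h, j, \<rho>, \<tau>) [] (i, h, j, \<rho>, put \<tau> j v)"
proof -
  have "steps x (Cat_Write v) (i, h, j, enc \<rho>, \<tau>) (emit None @ []) Skip (i, h, j, enc \<rho>, put \<tau> j v)"
    by (rule steps_step) (auto intro: steps_refl)
  then show ?thesis by (simp add: ex_def emit_def)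
qed

lemma ex_wset:
  assumes "r < tracks" "1 \<le> h" "h \<le> L"
  shows "ex (wset r g) (i, h, j, \<rho>, \<tau>) [] (i, h, j, upd \<rho> r (h - 1) (g (scan x i) (scan (enc \<rho>) h) (scan \<tau> j)), \<tau>)"
proof -
  have "steps x (wset r g) (i, h, j, enc \<rho>, \<tau>) (emit None @ []) Skip
    (i, h, j, enc (upd \<rho> r (h - 1) (g (scan x i) (scan (enc \<rho>) h) (scan \<tau> j))), \<tau>)"
    unfolding wset_def
    by (rule steps_step) (use assms in \<open>auto intro: steps_refl simp: put_enc_Some\<close>)
  then show ?thesis by (simp add: ex_def emit_def)
qed

lemma ex_wset_end:
  assumes "L < h"
  shows "ex (wset r g) (i, h, j, \<rho>, \<tau>) [] (i, h, j, \<rho>, \<tau>)"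
proof -
  have "steps x (wset r g) (i, h, j, enc \<rho>, \<tau>) (emit None @ []) Skip (i, h, j, enc \<rho>, \<tau>)"
    unfolding wset_def
    by (rule steps_step) (use assms in \<open>auto intro: steps_refl simp: put_enc_Some_end\<close>)
  then show ?thesis by (simp add: ex_def emit_def)
qed

lemma ex_Seq:
  assumes "ex c s w s'" "ex d s' w' s''"
  shows "ex (c ;; d) s (w @ w') s''"
proof -
  obtain i h j \<rho> \<tau> where s': "s' = (i, h, j, \<rho>, \<tau>)" by (cases s')
  have "steps x (Skip ;; d) (lift s') w' Skip (lift s'')"
    using assms(2) unfolding ex_def s' lift.simps by - (rule ex_idle_step, auto)
  with steps_SeqI[OF assms(1)[unfolded ex_def], of d] show ?thesis
    unfolding ex_def by (rule steps_trans)
qed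

lemma ex_Cond:
  assumes "ex (if holds p s then c else d) s w s'"
  shows "ex (Cond p c d) s w s'"
proof -
  obtain i h j \<rho> \<tau> where s: "s = (i, h, j, \<rho>, \<tau>)" by (cases s)
  show ?thesis
    using assms unfolding ex_def s lift.simps by - (rule ex_idle_step, auto)
qed

lemma ex_While_end: "\<not> holds p s \<Longrightarrow> ex (While p c) s [] s"
proof -
  assume a: "\<not> holds p s"
  obtain i h j \<rho> \<tau> where s: "s = (i, h, j, \<rho>, \<tau>)" by (cases s)
  show ?thesis
    using a unfolding ex_def s lift.simps by - (rule ex_idle_step, auto intro: steps_refl)
qed

lemma ex_While_step:
  assumes "holds p s" "ex c s w s'" "ex (While p c) s' w' s''"
  shows "ex (While p c) s (w @ w') s''"
proof -
  obtain i h j \<rho> \<tau> where s: "s = (i, h, j, \<rho>, \<tau>)" by (cases s)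
  show ?thesis
    using assms(1) ex_Seq[OF assms(2,3)] unfolding ex_def s lift.simps by - (rule ex_idle_step, auto)
qed

text \<open>Total correctness with one stream \<open>w\<close> for all start states: the
  precondition has to determine everything that is written.\<close>

definition hoare :: "(state \<Rightarrow> bool) \<Rightarrow> com \<Rightarrow> bool option list \<Rightarrow> (state \<Rightarrow> bool) \<Rightarrow> bool" where
  "hoare P c w Q \<longleftrightarrow> (\<forall>s. P s \<longrightarrow> (\<exists>s'. ex c s w s' \<and> Q s'))"

lemma h_Skip: "hoare P Skip [] P"
  unfolding hoare_def using ex_Skip by blast

lemma h_Seq: "hoare P c w Q \<Longrightarrow> hoare Q d w' R \<Longrightarrow> v = w @ w' \<Longrightarrow> hoare P (c ;; d) v R"
  unfolding hoare_def using ex_Seq by blast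

lemma h_conseq:
  "hoare P c w Q \<Longrightarrow> (\<And>s. P' s \<Longrightarrow> P s) \<Longrightarrow> (\<And>s. Q s \<Longrightarrow> Q' s) \<Longrightarrow> w = w' \<Longrightarrow> hoare P' c w' Q'"
  unfolding hoare_def by blast

lemma h_Cond:
  assumes "\<And>s. P s \<Longrightarrow> holds p s = b" "b \<Longrightarrow> hoare P c w Q" "\<not> b \<Longrightarrow> hoare P d w Q"
  shows "hoare P (Cond p c d) w Q"
  unfolding hoare_def
proof (intro allI impI)
  fix s assume "P s"
  then show "\<exists>s'. ex (Cond p c d) s w s' \<and> Q s'"
    using assms ex_Cond[of p s c d w] unfolding hoare_def by (cases b) (metis (full_types))+
qed

lemma h_Cond_Test:
  assumes "hoare P t [] (\<lambda>s. P s \<and> holds p s = b)" "b \<Longrightarrow> hoare P c w Q" "\<not> b \<Longrightarrow> hoare P d w Q"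
  shows "hoare P (t ;; Cond p c d) w Q"
  by (rule h_Seq[OF assms(1)], rule h_Cond[where b = b])
    (use assms(2,3) in \<open>auto intro: h_conseq\<close>)

text \<open>The number \<open>n\<close> of iterations is known beforehand, so the induction is on
  the iterations left, beginning at the exit of the loop.\<close>

lemma h_While:
  assumes "\<And>k s. k < n \<Longrightarrow> R k s \<Longrightarrow> holds p s" "\<And>s. R n s \<Longrightarrow> \<not> holds p s"
    and "\<And>k. k < n \<Longrightarrow> hoare (R k) c (w k) (R (Suc k))"
  shows "hoare (R 0) (While p c) (concat (map w [0..<n])) (R n)"
proof -
  have "m \<le> n \<Longrightarrow> hoare (R (n - m)) (While p c) (concat (map w [n - m..<n])) (R n)" for m
  proof (induction m)
    case 0
    show ?case
      unfolding hoare_def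
    proof (intro allI impI)
      fix s assume "R (n - 0) s"
      then have "ex (While p c) s [] s \<and> R n s" using assms(2) ex_While_end by simp
      then show "\<exists>s'. ex (While p c) s (concat (map w [n - 0..<n])) s' \<and> R n s'" by (intro exI[of _ s]) simp
    qed
  next
    case (Suc m)
    let ?k = "n - Suc m"
    have k: "?k < n" "Suc ?k = n - m" using Suc.prems by auto
    have u: "[?k..<n] = ?k # [n - m..<n]" using k by (metis upt_conv_Cons)
    show ?case
      unfolding hoare_def
    proof (intro allI impI)
      fix s assume s: "R ?k s"
      then obtain s' where s': "ex c s (w ?k) s'" "R (n - m) s'"
        using assms(3)[OF k(1)] k(2) unfolding hoare_def by metis
      then obtain s'' where "ex (While p c) s' (concat (map w [n - m..<n])) s''" "R n s''"
        using Suc unfolding hoare_def by (meson Suc_leD)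
      then show "\<exists>s'. ex (While p c) s (concat (map w [?k..<n])) s' \<and> R n s'"
        using ex_While_step[OF assms(1)[OF k(1) s] s'(1)] u by (intro exI[of _ s'']) auto
    qed
  qed
  from this[of n] show ?thesis by simp
qed

lemma h_While_Test:
  assumes "\<And>k. k \<le> n \<Longrightarrow> hoare (P k) t [] (\<lambda>s. P k s \<and> holds p s = (k < n))"
    and "\<And>k. k < n \<Longrightarrow> hoare (P k) c (w k) (P (Suc k))"
  shows "hoare (P 0) (While_Test t p c) (concat (map w [0..<n])) (P n)"
  unfolding While_Test_def
proof (rule h_Seq)
  let ?R = "\<lambda>k s. P k s \<and> holds p s = (k < n)"
  show "hoare (P 0) t [] (?R 0)" using assms(1)[of 0] by simp
  have "hoare (?R 0) (While p (c ;; t)) (concat (map w [0..<n])) (?R n)"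
  proof (rule h_While)
    fix k assume k: "k < n"
    show "hoare (?R k) (c ;; t) (w k) (?R (Suc k))"
    proof (rule h_Seq)
      show "hoare (?R k) c (w k) (P (Suc k))" using assms(2)[OF k] by (rule h_conseq) auto
      show "hoare (P (Suc k)) t [] (?R (Suc k))" using k by (intro assms(1)) simp
    qed simp
  qed auto
  then show "hoare (?R 0) (While p (c ;; t)) (concat (map w [0..<n])) (P n)" by (rule h_conseq) auto
qed simp

lemma h_atD: "hoare (At I H J \<rho> \<tau>) c w Q \<longleftrightarrow>
  (\<forall>i\<in>I. \<forall>h\<in>H. \<forall>j\<in>J. \<exists>s'. ex c (i, h, j, \<rho>, \<tau>) w s' \<and> Q s')"
  by (auto simp: hoare_def At_def)

lemma h_weaken:
  "hoare (At I H J \<rho> \<tau>) c w (At I' H' J' \<rho>' \<tau>') \<Longrightarrow> I2 \<subseteq> I \<Longrightarrow> H2 \<subseteq> H \<Longrightarrow> J2 \<subseteq> J \<Longrightarrow>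
   I' \<subseteq> I3 \<Longrightarrow> H' \<subseteq> H3 \<Longrightarrow> J' \<subseteq> J3 \<Longrightarrow> hoare (At I2 H2 J2 \<rho> \<tau>) c w (At I3 H3 J3 \<rho>' \<tau>')"
  by (erule h_conseq) (auto simp: At_def)

lemma h_AtI:
  "(\<And>i h j. i \<in> I \<Longrightarrow> h \<in> H \<Longrightarrow> j \<in> J \<Longrightarrow>
     \<exists>i'\<in>I'. \<exists>h'\<in>H'. \<exists>j'\<in>J'. ex c (i, h, j, \<rho>, \<tau>) w (i', h', j', \<rho>', \<tau>')) \<Longrightarrow>
   hoare (At I H J \<rho> \<tau>) c w (At I' H' J' \<rho>' \<tau>')"
  unfolding h_atD by (fastforce simp: At_def)

lemma At_holds: "At {i} {h} {j} \<rho> \<tau> s \<Longrightarrow> holds p s = p (scan x i) (scan (enc \<rho>) h) (scan \<tau> j)"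
  by (auto simp: At_def)

lemma At_holds_work: "At I {h} J \<rho> \<tau> s \<Longrightarrow> holds (\<lambda>a s b. p s) s = p (scan (enc \<rho>) h)"
  by (auto simp: At_def)

lemma At_holds_in: "At {i} H J \<rho> \<tau> s \<Longrightarrow> holds (\<lambda>a s b. p a) s = p (scan x i)"
  by (auto simp: At_def)

lemma At_holds_cat: "At I H {j} \<rho> \<tau> s \<Longrightarrow> holds (\<lambda>a s b. p b) s = p (scan \<tau> j)"
  by (auto simp: At_def)

lemma h_pointwise:
  "(\<And>i h j. i \<in> I \<Longrightarrow> h \<in> H \<Longrightarrow> j \<in> J \<Longrightarrow> hoare (At {i} {h} {j} \<rho> \<tau>) c w Q) \<Longrightarrow> hoare (At I H J \<rho> \<tau>) c w Q"
  by (auto simp: h_atD)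

lemma h_move_work: "hoare (At I {h} J \<rho> \<tau>) (move_work m) [] (At I {wmove m h} J \<rho> \<tau>)"
proof -
  have "ex (move_work m) (i, h, j, \<rho>, \<tau>) [] (i, wmove m h, j, \<rho>, \<tau>)" for i j
    using ex_Prim[of "\<lambda>_ _ _. (None, Stay, m, Stay, None)" i \<rho> h \<tau> j] by (auto simp: move_work_def emit_def)
  then show ?thesis by (intro h_AtI) (simp, blast)
qed

lemma h_move_in: "hoare (At {i} H J \<rho> \<tau>) (move_in m) [] (At {shift x m i} H J \<rho> \<tau>)"
proof -
  have "ex (move_in m) (i, h, j, \<rho>, \<tau>) [] (shift x m i, h, j, \<rho>, \<tau>)" for h j
    using ex_Prim[of "\<lambda>_ _ _. (None, m, Stay, Stay, None)" i \<rho> h \<tau> j] by (auto simp: move_in_def emit_def)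
  then show ?thesis by (intro h_AtI) (simp, blast)
qed

lemma h_move_cat: "hoare (At I H {j} \<rho> \<tau>) (move_cat m) [] (At I H {shift \<tau> m j} \<rho> \<tau>)"
proof -
  have "ex (move_cat m) (i, h, j, \<rho>, \<tau>) [] (i, h, shift \<tau> m j, \<rho>, \<tau>)" for h i
    using ex_Prim[of "\<lambda>_ _ _. (None, Stay, Stay, m, None)" i \<rho> h \<tau> j] by (auto simp: move_cat_def emit_def)
  then show ?thesis by (intro h_AtI) (simp, blast)
qed

lemma ex_out: "ex (out w) s [w] s"
proof -
  obtain i h j \<rho> \<tau> where s: "s = (i, h, j, \<rho>, \<tau>)" by (cases s)
  show ?thesis
    using ex_Prim[of "\<lambda>_ _ _. (None, Stay, Stay, Stay, Some w)" i \<rho> h \<tau> j] by (auto simp: s out_def emit_def)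
qed

lemma h_out: "hoare P (out w) [w] P"
  unfolding hoare_def using ex_out by blast

lemma h_em: "hoare P (em ws) ws P"
  by (induction ws) (auto intro: h_Skip h_out h_Seq)

lemma h_wset:
  assumes "r < tracks" "1 \<le> h" "h \<le> L"
    and "\<And>i j. i \<in> I \<Longrightarrow> j \<in> J \<Longrightarrow> g (scan x i) (Sym (symb \<rho> (h - 1))) (scan \<tau> j) = b"
  shows "hoare (At I {h} J \<rho> \<tau>) (wset r g) [] (At I {h} J (upd \<rho> r (h - 1) b) \<tau>)"
proof (rule h_AtI)
  fix i h' j assume a: "i \<in> I" "h' \<in> {h}" "j \<in> J"
  then show "\<exists>i'\<in>I. \<exists>h''\<in>{h}. \<exists>j'\<in>J. ex (wset r g) (i, h', j, \<rho>, \<tau>) [] (i', h'', j', upd \<rho> r (h - 1) b, \<tau>)"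
    using ex_wset[OF assms(1-3), of g i j \<rho> \<tau>] assms(2-4) by (simp add: scan_enc) blast
qed

lemma h_wstart: "hoare (At I UNIV J \<rho> \<tau>) wstart [] (At I {1} J \<rho> \<tau>)"
proof (rule h_pointwise)
  fix i h j assume a: "i \<in> I" "j \<in> J"
  have "hoare (At {i} {h - 0} {j} \<rho> \<tau>) (While (\<lambda>a s b. s \<noteq> LEnd) (move_work Go_Left)) (concat (map (\<lambda>_. []) [0..<h])) (At {i} {h - h} {j} \<rho> \<tau>)"
    by (rule h_While) (auto simp: At_holds scan_enc split: if_splits intro!: h_weaken[OF h_move_work])
  then have "hoare (At {i} {h} {j} \<rho> \<tau>) (While (\<lambda>a s b. s \<noteq> LEnd) (move_work Go_Left)) [] (At {i} {0} {j} \<rho> \<tau>)"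
    by simp
  moreover have "hoare (At {i} {0} {j} \<rho> \<tau>) (move_work Go_Right) [] (At {i} {1} {j} \<rho> \<tau>)"
    using h_move_work[of "{i}" 0 "{j}" \<rho> \<tau> Go_Right] by simp
  ultimately have "hoare (At {i} {h} {j} \<rho> \<tau>) wstart [] (At {i} {1} {j} \<rho> \<tau>)"
    unfolding wstart_def by (rule h_Seq) simp
  then show "hoare (At {i} {h} {j} \<rho> \<tau>) wstart [] (At I {1} J \<rho> \<tau>)"
    by (rule h_weaken) (use a in auto)
qed

lemma h_istart: "hoare (At UNIV H J \<rho> \<tau>) istart [] (At {1} H J \<rho> \<tau>)"
proof (rule h_pointwise)
  fix i h j assume a: "h \<in> H" "j \<in> J"
  have "hoare (At {i - 0} {h} {j} \<rho> \<tau>) (While (\<lambda>a s b. a \<noteq> LEnd) (move_in Go_Left)) (concat (map (\<lambda>_. []) [0..<i])) (At {i - i} {h} {j} \<rho> \<tau>)"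
    by (rule h_While) (auto simp: At_holds scan_def split: if_splits intro!: h_weaken[OF h_move_in])
  then have "hoare (At {i} {h} {j} \<rho> \<tau>) (While (\<lambda>a s b. a \<noteq> LEnd) (move_in Go_Left)) [] (At {0} {h} {j} \<rho> \<tau>)"
    by simp
  moreover have "hoare (At {0} {h} {j} \<rho> \<tau>) (move_in Go_Right) [] (At {1} {h} {j} \<rho> \<tau>)"
    using h_move_in[of 0 "{h}" "{j}" \<rho> \<tau> Go_Right] by simp
  ultimately have "hoare (At {i} {h} {j} \<rho> \<tau>) istart [] (At {1} {h} {j} \<rho> \<tau>)"
    unfolding istart_def by (rule h_Seq) simp
  then show "hoare (At {i} {h} {j} \<rho> \<tau>) istart [] (At {1} H J \<rho> \<tau>)"
    by (rule h_weaken) (use a in auto)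
qed

lemma h_cstart: "hoare (At I H UNIV \<rho> \<tau>) cstart [] (At I H {1} \<rho> \<tau>)"
proof (rule h_pointwise)
  fix i h j assume a: "i \<in> I" "h \<in> H"
  have "hoare (At {i} {h} {j - 0} \<rho> \<tau>) (While (\<lambda>a s b. b \<noteq> LEnd) (move_cat Go_Left)) (concat (map (\<lambda>_. []) [0..<j])) (At {i} {h} {j - j} \<rho> \<tau>)"
    by (rule h_While) (auto simp: At_holds scan_def split: if_splits intro!: h_weaken[OF h_move_cat])
  then have "hoare (At {i} {h} {j} \<rho> \<tau>) (While (\<lambda>a s b. b \<noteq> LEnd) (move_cat Go_Left)) [] (At {i} {h} {0} \<rho> \<tau>)"
    by simp
  moreover have "hoare (At {i} {h} {0} \<rho> \<tau>) (move_cat Go_Right) [] (At {i} {h} {1} \<rho> \<tau>)"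
    using h_move_cat[of "{i}" "{h}" 0 \<rho> \<tau> Go_Right] by simp
  ultimately have "hoare (At {i} {h} {j} \<rho> \<tau>) cstart [] (At {i} {h} {1} \<rho> \<tau>)"
    unfolding cstart_def by (rule h_Seq) simp
  then show "hoare (At {i} {h} {j} \<rho> \<tau>) cstart [] (At I H {1} \<rho> \<tau>)"
    by (rule h_weaken) (use a in auto)
qed

end

section \<open>Arithmetic on registers and counting loops\<close>

context work
begin

definition ok :: "(nat \<Rightarrow> nat) \<Rightarrow> bool" where
  "ok \<rho> \<longleftrightarrow> (\<forall>r. \<rho> r < 2 ^ L)"

lemma ok_upd [simp]: "ok \<rho> \<Longrightarrow> v < 2 ^ L \<Longrightarrow> ok (\<rho>(r := v))"
  by (simp add: ok_def)

lemma okD: "ok \<rho> \<Longrightarrow> \<rho> r < 2 ^ L"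
  by (simp add: ok_def)

lemma h_scan_work:
  "hoare (At I UNIV J \<rho> \<tau>) (scan_work \<phi>) []
     (\<lambda>s. At I UNIV J \<rho> \<tau> s \<and> holds (\<lambda>a s b. s \<noteq> REnd) s = (\<exists>k<L. \<not> \<phi> (symb \<rho> k)))"
proof -
  \<comment> \<open>The first violating cell, or \<open>L\<close> if there is none; the head makes
    \<open>n\<close> moves, and it rests on the end marker iff \<open>n = L\<close>.\<close>
  define n where "n = (LEAST k. k = L \<or> \<not> \<phi> (symb \<rho> k))"
  have n: "n = L \<or> \<not> \<phi> (symb \<rho> n)" unfolding n_def by (rule LeastI[of _ L]) simp
  have nL: "n \<le> L" unfolding n_def by (rule Least_le) simp
  have lt: "\<phi> (symb \<rho> k)" if "k < n" for k
    using not_less_Least[OF that[unfolded n_def]] by simp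
  have "hoare (At I {0 + 1} J \<rho> \<tau>) (While (\<lambda>a s b. on_sym \<phi> s) (move_work Go_Right)) (concat (map (\<lambda>_. []) [0..<n])) (At I {n + 1} J \<rho> \<tau>)"
  proof (rule h_While)
    fix k assume k: "k < n"
    show "hoare (At I {k + 1} J \<rho> \<tau>) (move_work Go_Right) [] (At I {Suc k + 1} J \<rho> \<tau>)"
      by (rule h_weaken[OF h_move_work]) (use k nL in auto)
  qed (use n nL lt in \<open>auto simp: At_holds_work scan_enc on_sym_def\<close>)
  then have "hoare (At I {1} J \<rho> \<tau>) (While (\<lambda>a s b. on_sym \<phi> s) (move_work Go_Right)) []
     (\<lambda>s. At I UNIV J \<rho> \<tau> s \<and> holds (\<lambda>a s b. s \<noteq> REnd) s = (\<exists>k<L. \<not> \<phi> (symb \<rho> k)))"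
  proof (rule h_conseq)
    fix s assume s: "At I {n + 1} J \<rho> \<tau> s"
    have "holds (\<lambda>a s b. s \<noteq> REnd) s = (n < L)"
      using At_holds_work[OF s] by (simp add: scan_enc)
    moreover have "n < L \<longleftrightarrow> (\<exists>k<L. \<not> \<phi> (symb \<rho> k))"
      using n lt by (metis nat_neq_iff nL not_less)
    ultimately show "At I UNIV J \<rho> \<tau> s \<and> holds (\<lambda>a s b. s \<noteq> REnd) s = (\<exists>k<L. \<not> \<phi> (symb \<rho> k))"
      using s by (auto simp: At_def)
  qed simp_all
  then show ?thesis
    unfolding scan_work_def by (rule h_Seq[OF h_wstart]) simp
qed

lemma test_zero:
  assumes "ok \<rho>" "r < tracks"
  shows "hoare (At I UNIV J \<rho> \<tau>) (scan_work (\<lambda>t. \<not> bit t r)) []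
     (\<lambda>s. At I UNIV J \<rho> \<tau> s \<and> holds (\<lambda>a s b. s \<noteq> REnd) s = (\<rho> r \<noteq> 0))"
proof -
  have "(\<exists>k<L. \<not> \<not> bit (symb \<rho> k) r) = (\<rho> r \<noteq> 0)"
    using nat_eq_iff_low_bits[OF okD[OF assms(1), of r], of 0] assms(2) by (auto simp: bit_symb)
  with h_scan_work[of I J \<rho> \<tau> "\<lambda>t. \<not> bit t r"] show ?thesis by (simp only:)
qed

lemma eq_mask_iff: "(m::nat) < 2 ^ L \<Longrightarrow> (\<forall>k<L. bit m k) \<longleftrightarrow> m = 2 ^ L - 1"
  using nat_eq_iff_low_bits[of m L "mask L"] by (simp add: bit_mask_iff) (simp add: mask_eq_exp_minus_1)

lemma test_ones:
  assumes "ok \<rho>" "r < tracks"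
  shows "hoare (At I UNIV J \<rho> \<tau>) (scan_work (\<lambda>t. bit t r)) []
     (\<lambda>s. At I UNIV J \<rho> \<tau> s \<and> holds (\<lambda>a s b. s \<noteq> REnd) s = (\<rho> r < 2 ^ L - 1))"
proof -
  have "(\<forall>k<L. bit (symb \<rho> k) r) = (\<rho> r = 2 ^ L - 1)"
    using eq_mask_iff[OF okD[OF assms(1), of r]] assms(2) by (simp add: bit_symb)
  moreover have "(\<rho> r \<noteq> 2 ^ L - 1) = (\<rho> r < 2 ^ L - 1)"
    using okD[OF assms(1), of r] by auto
  ultimately have "(\<exists>k<L. \<not> bit (symb \<rho> k) r) = (\<rho> r < 2 ^ L - 1)" by blast
  with h_scan_work[of I J \<rho> \<tau> "\<lambda>t. bit t r"] show ?thesis by (simp only:)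
qed

lemma test_neq:
  assumes "ok \<rho>" "r < tracks" "r' < tracks"
  shows "hoare (At I UNIV J \<rho> \<tau>) (scan_work (\<lambda>t. bit t r = bit t r')) []
     (\<lambda>s. At I UNIV J \<rho> \<tau> s \<and> holds (\<lambda>a s b. s \<noteq> REnd) s = (\<rho> r \<noteq> \<rho> r'))"
proof -
  have "(\<exists>k<L. \<not> (bit (symb \<rho> k) r = bit (symb \<rho> k) r')) = (\<rho> r \<noteq> \<rho> r')"
    using nat_eq_iff_low_bits[OF okD[OF assms(1), of r] okD[OF assms(1), of r']] assms(2,3)
    by (simp add: bit_symb) blast
  with h_scan_work[of I J \<rho> \<tau> "\<lambda>t. bit t r = bit t r'"] show ?thesis by (simp only:)
qed

lemma h_inc:
  assumes "ok \<rho>" "r < tracks" "\<rho> r + 1 < 2 ^ L"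
  shows "hoare (At I UNIV J \<rho> \<tau>) (inc r) [] (At I UNIV J (\<rho>(r := \<rho> r + 1)) \<tau>)"
proof -
  let ?m = "\<rho> r"
  \<comment> \<open>The number of trailing ones. They are cleared one by one, then bit
    \<open>n\<close> is set.\<close>
  define n where "n = (LEAST k. \<not> bit ?m k)"
  have ex: "\<exists>k<L. \<not> bit ?m k"
  proof (rule ccontr)
    assume "\<not> ?thesis"
    then show False using eq_mask_iff[OF okD[OF assms(1), of r]] assms(3) by auto
  qed
  then obtain k0 where k0: "k0 < L" "\<not> bit ?m k0" by blast
  have n: "\<not> bit ?m n" unfolding n_def by (rule LeastI[of _ k0]) (rule k0)
  have nL: "n < L" unfolding n_def using Least_le[of "\<lambda>k. \<not> bit ?m k" k0] k0 by simp
  have lt: "bit ?m k" if "k < n" for k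
    using not_less_Least[OF that[unfolded n_def]] by simp
  let ?R = "\<lambda>k. At I {k + 1} J (\<rho>(r := mix k 0 ?m)) \<tau>"
  have "hoare (?R 0) (While (\<lambda>a s b. on_sym (\<lambda>t. bit t r) s) (wset r (\<lambda>_ _ _. False) ;; move_work Go_Right)) (concat (map (\<lambda>_. []) [0..<n])) (?R n)"
  proof (rule h_While)
    fix k assume k: "k < n"
    have "upd (\<rho>(r := mix k 0 ?m)) r k False = \<rho>(r := mix (Suc k) 0 ?m)"
      using mix_Suc[of k 0 ?m] by (simp add: upd_def)
    then have "hoare (?R k) (wset r (\<lambda>_ _ _. False)) [] (At I {k + 1} J (\<rho>(r := mix (Suc k) 0 ?m)) \<tau>)"
      using h_wset[of r "k + 1" I J "\<lambda>_ _ _. False" "\<rho>(r := mix k 0 ?m)" \<tau> False] assms k nL by simp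
    then show "hoare (?R k) (wset r (\<lambda>_ _ _. False) ;; move_work Go_Right) [] (?R (Suc k))"
      by (rule h_Seq) (rule h_weaken[OF h_move_work], use k nL in auto)
  qed (use n nL lt assms in \<open>auto simp: At_holds_work scan_enc on_sym_def bit_symb bit_mix\<close>)
  then have a: "hoare (At I {1} J \<rho> \<tau>) (While (\<lambda>a s b. on_sym (\<lambda>t. bit t r) s) (wset r (\<lambda>_ _ _. False) ;; move_work Go_Right)) [] (?R n)"
    by simp
  have "upd (\<rho>(r := mix n 0 ?m)) r n True = \<rho>(r := ?m + 1)"
    using inc_bits[OF lt n] by (simp add: upd_def)
  then have b: "hoare (?R n) (wset r (\<lambda>_ _ _. True)) [] (At I {n + 1} J (\<rho>(r := ?m + 1)) \<tau>)"
    using h_wset[of r "n + 1" I J "\<lambda>_ _ _. True" "\<rho>(r := mix n 0 ?m)" \<tau> True] assms nL by simp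
  have b': "hoare (?R n) (wset r (\<lambda>_ _ _. True)) [] (At I UNIV J (\<rho>(r := ?m + 1)) \<tau>)"
    by (rule h_weaken[OF b]) auto
  show ?thesis
    unfolding inc_def
    by (rule h_Seq[OF h_wstart h_Seq[OF a b' refl]]) simp
qed

lemma h_dec:
  assumes "ok \<rho>" "r < tracks" "0 < \<rho> r"
  shows "hoare (At I UNIV J \<rho> \<tau>) (dec r) [] (At I UNIV J (\<rho>(r := \<rho> r - 1)) \<tau>)"
proof -
  let ?m = "\<rho> r"
  define n where "n = (LEAST k. bit ?m k)"
  have "\<exists>k<L. bit ?m k"
    using nat_eq_iff_low_bits[OF okD[OF assms(1), of r], of 0] assms(3) by auto
  then obtain k0 where k0: "k0 < L" "bit ?m k0" by blast
  have n: "bit ?m n" unfolding n_def by (rule LeastI[of _ k0]) (rule k0)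
  have nL: "n < L" unfolding n_def using Least_le[of "\<lambda>k. bit ?m k" k0] k0 by simp
  have lt: "\<not> bit ?m k" if "k < n" for k
    using not_less_Least[OF that[unfolded n_def]] by simp
  \<comment> \<open>The mask of the final \<open>n\<close> serves every stage: its first
    \<open>k\<close> bits are ones for all \<open>k \<le> n\<close>.\<close>
  let ?R = "\<lambda>k. At I {k + 1} J (\<rho>(r := mix k (mask n) ?m)) \<tau>"
  have "hoare (?R 0) (While (\<lambda>a s b. on_sym (\<lambda>t. \<not> bit t r) s) (wset r (\<lambda>_ _ _. True) ;; move_work Go_Right)) (concat (map (\<lambda>_. []) [0..<n])) (?R n)"
  proof (rule h_While)
    fix k assume k: "k < n"
    have "upd (\<rho>(r := mix k (mask n) ?m)) r k True = \<rho>(r := mix (Suc k) (mask n) ?m)"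
      using mix_Suc[of k "mask n" ?m] k by (simp add: upd_def bit_mask_iff)
    then have "hoare (?R k) (wset r (\<lambda>_ _ _. True)) [] (At I {k + 1} J (\<rho>(r := mix (Suc k) (mask n) ?m)) \<tau>)"
      using h_wset[of r "k + 1" I J "\<lambda>_ _ _. True" "\<rho>(r := mix k (mask n) ?m)" \<tau> True] assms k nL by simp
    then show "hoare (?R k) (wset r (\<lambda>_ _ _. True) ;; move_work Go_Right) [] (?R (Suc k))"
      by (rule h_Seq) (rule h_weaken[OF h_move_work], use k nL in auto)
  qed (use n nL lt assms in \<open>auto simp: At_holds_work scan_enc on_sym_def bit_symb bit_mix\<close>)
  then have a: "hoare (At I {1} J \<rho> \<tau>) (While (\<lambda>a s b. on_sym (\<lambda>t. \<not> bit t r) s) (wset r (\<lambda>_ _ _. True) ;; move_work Go_Right)) [] (?R n)"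
    by simp
  have "upd (\<rho>(r := mix n (mask n) ?m)) r n False = \<rho>(r := ?m - 1)"
    using dec_bits[OF lt n] by (simp add: upd_def)
  then have b: "hoare (?R n) (wset r (\<lambda>_ _ _. False)) [] (At I {n + 1} J (\<rho>(r := ?m - 1)) \<tau>)"
    using h_wset[of r "n + 1" I J "\<lambda>_ _ _. False" "\<rho>(r := mix n (mask n) ?m)" \<tau> False] assms nL by simp
  have b': "hoare (?R n) (wset r (\<lambda>_ _ _. False)) [] (At I UNIV J (\<rho>(r := ?m - 1)) \<tau>)"
    by (rule h_weaken[OF b]) auto
  show ?thesis
    unfolding dec_def
    by (rule h_Seq[OF h_wstart h_Seq[OF a b' refl]]) simp
qed

lemma h_for_cells:
  assumes "\<And>k. k < L \<Longrightarrow> hoare (At I {k + 1} (J k) (P k) \<tau>) c (w k) (At I {k + 1} (J (Suc k)) (P (Suc k)) \<tau>)"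
  shows "hoare (At I UNIV (J 0) (P 0) \<tau>) (for_cells c) (concat (map w [0..<L])) (At I UNIV (J L) (P L) \<tau>)"
proof -
  have "hoare (At I {0 + 1} (J 0) (P 0) \<tau>) (While (\<lambda>a s b. s \<noteq> REnd) (c ;; move_work Go_Right)) (concat (map w [0..<L])) (At I {L + 1} (J L) (P L) \<tau>)"
  proof (rule h_While)
    fix k assume k: "k < L"
    show "hoare (At I {k + 1} (J k) (P k) \<tau>) (c ;; move_work Go_Right) (w k) (At I {Suc k + 1} (J (Suc k)) (P (Suc k)) \<tau>)"
      by (rule h_Seq[OF assms[OF k]], rule h_weaken[OF h_move_work]) (use k in auto)
  qed (auto simp: At_holds_work scan_enc)
  then have "hoare (At I {1} (J 0) (P 0) \<tau>) (While (\<lambda>a s b. s \<noteq> REnd) (c ;; move_work Go_Right)) (concat (map w [0..<L])) (At I UNIV (J L) (P L) \<tau>)"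
    by (rule h_conseq) (auto simp: At_def)
  then show ?thesis
    unfolding for_cells_def by (rule h_Seq[OF h_wstart]) simp
qed

lemma h_zero:
  assumes "ok \<rho>" "r < tracks"
  shows "hoare (At I UNIV J \<rho> \<tau>) (zero r) [] (At I UNIV J (\<rho>(r := 0)) \<tau>)"
proof -
  have "hoare (At I UNIV J (\<rho>(r := mix 0 0 (\<rho> r))) \<tau>) (zero r) (concat (map (\<lambda>_. []) [0..<L])) (At I UNIV J (\<rho>(r := mix L 0 (\<rho> r))) \<tau>)"
    unfolding zero_def
  proof (rule h_for_cells)
    fix k assume k: "k < L"
    have "upd (\<rho>(r := mix k 0 (\<rho> r))) r k False = \<rho>(r := mix (Suc k) 0 (\<rho> r))"
      using mix_Suc[of k 0 "\<rho> r"] by (simp add: upd_def)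
    then show "hoare (At I {k + 1} J (\<rho>(r := mix k 0 (\<rho> r))) \<tau>) (wset r (\<lambda>_ _ _. False)) [] (At I {k + 1} J (\<rho>(r := mix (Suc k) 0 (\<rho> r))) \<tau>)"
      using h_wset[of r "k + 1" I J "\<lambda>_ _ _. False" "\<rho>(r := mix k 0 (\<rho> r))" \<tau> False] assms k by simp
  qed
  then show ?thesis using mix_all[of 0 L "\<rho> r"] okD[OF assms(1)] by simp
qed

lemma h_copy:
  assumes "ok \<rho>" "r < tracks" "r' < tracks" "r \<noteq> r'"
  shows "hoare (At I UNIV J \<rho> \<tau>) (copy r r') [] (At I UNIV J (\<rho>(r' := \<rho> r)) \<tau>)"
proof -
  let ?P = "\<lambda>k. \<rho>(r' := mix k (\<rho> r) (\<rho> r'))"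
  have "hoare (At I UNIV J (?P 0) \<tau>) (copy r r') (concat (map (\<lambda>_. []) [0..<L])) (At I UNIV J (?P L) \<tau>)"
    unfolding copy_def
  proof (rule h_for_cells)
    fix k assume k: "k < L"
    have "upd (?P k) r' k (bit (\<rho> r) k) = ?P (Suc k)"
      using mix_Suc[of k "\<rho> r" "\<rho> r'"] by (simp add: upd_def)
    then show "hoare (At I {k + 1} J (?P k) \<tau>) (wset r' (\<lambda>a s b. on_sym (\<lambda>t. bit t r) s)) [] (At I {k + 1} J (?P (Suc k)) \<tau>)"
      using h_wset[of r' "k + 1" I J "\<lambda>a s b. on_sym (\<lambda>t. bit t r) s" "?P k" \<tau> "bit (\<rho> r) k"] assms k
      by (simp add: on_sym_def bit_symb)
  qed
  then show ?thesis using mix_all[of "\<rho> r" L "\<rho> r'"] okD[OF assms(1)] by simp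
qed

lemma h_load:
  assumes "ok \<rho>" "r < tracks" "v < 2 ^ L" "\<And>k. k < L \<Longrightarrow> scan \<tau> (j + k) = Sym (bit v k)"
  shows "hoare (At I UNIV {j} \<rho> \<tau>) (load r) [] (At I UNIV {j + L} (\<rho>(r := v)) \<tau>)"
proof -
  let ?P = "\<lambda>k. \<rho>(r := mix k v (\<rho> r))"
  have "hoare (At I UNIV {j + 0} (?P 0) \<tau>) (load r) (concat (map (\<lambda>_. []) [0..<L])) (At I UNIV {j + L} (?P L) \<tau>)"
    unfolding load_def
  proof (rule h_for_cells)
    fix k assume k: "k < L"
    have "upd (?P k) r k (bit v k) = ?P (Suc k)"
      using mix_Suc[of k v "\<rho> r"] by (simp add: upd_def)
    then have a: "hoare (At I {k + 1} {j + k} (?P k) \<tau>) (wset r (\<lambda>a s b. b = Sym True)) [] (At I {k + 1} {j + k} (?P (Suc k)) \<tau>)"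
      using h_wset[of r "k + 1" I "{j + k}" "\<lambda>a s b. b = Sym True" "?P k" \<tau> "bit v k"] assms k by simp
    have "j + k \<le> length \<tau>" using assms(4)[OF k] by (auto simp: scan_def split: if_splits)
    then have "shift \<tau> Go_Right (j + k) = j + Suc k" by simp
    then show "hoare (At I {k + 1} {j + k} (?P k) \<tau>) (wset r (\<lambda>a s b. b = Sym True) ;; move_cat Go_Right) [] (At I {k + 1} {j + Suc k} (?P (Suc k)) \<tau>)"
      using h_Seq[OF a h_move_cat[of _ _ _ _ _ Go_Right] refl] by simp
  qed
  then show ?thesis using mix_all[of v L "\<rho> r"] okD[OF assms(1)] assms(3) by simp
qed

lemma h_set_one:
  assumes "r < tracks" "\<rho> r = 0 \<or> \<rho> r = 1"
  shows "hoare (At I UNIV J \<rho> \<tau>) (set_one r) [] (At I UNIV J (\<rho>(r := 1)) \<tau>)"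
proof -
  have "upd \<rho> r 0 True = \<rho>(r := 1)"
    using assms(2) by (auto simp: upd_def set_to_def set_bit_0)
  then have "hoare (At I {1} J \<rho> \<tau>) (wset r (\<lambda>_ _ _. True)) [] (At I {1} J (\<rho>(r := 1)) \<tau>)"
    using h_wset[of r 1 I J "\<lambda>_ _ _. True" \<rho> \<tau> True] assms L_pos by simp
  then have "hoare (At I {1} J \<rho> \<tau>) (wset r (\<lambda>_ _ _. True)) [] (At I UNIV J (\<rho>(r := 1)) \<tau>)"
    by (rule h_weaken) auto
  then show ?thesis unfolding set_one_def by (rule h_Seq[OF h_wstart]) simp
qed

lemma h_clear_top:
  assumes "ok \<rho>" "r < tracks"
  shows "hoare (At I UNIV J \<rho> \<tau>) (clear_top r) [] (At I UNIV J (\<rho>(r := take_bit (L - 1) (\<rho> r))) \<tau>)"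
proof -
  have "hoare (At I {0 + 1} J \<rho> \<tau>) (While (\<lambda>a s b. s \<noteq> REnd) (move_work Go_Right)) (concat (map (\<lambda>_. []) [0..<L])) (At I {L + 1} J \<rho> \<tau>)"
  proof (rule h_While)
    fix k assume k: "k < L"
    show "hoare (At I {k + 1} J \<rho> \<tau>) (move_work Go_Right) [] (At I {Suc k + 1} J \<rho> \<tau>)"
      by (rule h_weaken[OF h_move_work]) (use k in auto)
  qed (auto simp: At_holds_work scan_enc)
  then have a: "hoare (At I {1} J \<rho> \<tau>) (While (\<lambda>a s b. s \<noteq> REnd) (move_work Go_Right)) [] (At I {L + 1} J \<rho> \<tau>)" by simp
  have b: "hoare (At I {L + 1} J \<rho> \<tau>) (move_work Go_Left) [] (At I {L} J \<rho> \<tau>)"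
    by (rule h_weaken[OF h_move_work]) auto
  have "set_to (L - 1) False (\<rho> r) = take_bit (L - 1) (\<rho> r)"
    by (rule bit_eqI) (auto simp: bit_set_to bit_simps dest: bit_less_exp[OF _ okD[OF assms(1)]])
  then have "upd \<rho> r (L - 1) False = \<rho>(r := take_bit (L - 1) (\<rho> r))"
    by (simp add: upd_def)
  then have "hoare (At I {L} J \<rho> \<tau>) (wset r (\<lambda>_ _ _. False)) [] (At I {L} J (\<rho>(r := take_bit (L - 1) (\<rho> r))) \<tau>)"
    using h_wset[of r L I J "\<lambda>_ _ _. False" \<rho> \<tau> False] assms L_pos by simp
  then have "hoare (At I {L} J \<rho> \<tau>) (wset r (\<lambda>_ _ _. False)) [] (At I UNIV J (\<rho>(r := take_bit (L - 1) (\<rho> r))) \<tau>)"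
    by (rule h_weaken) auto
  then show ?thesis unfolding clear_top_def
    by (intro h_Seq[OF h_wstart h_Seq[OF a h_Seq[OF b]]]) auto
qed

text \<open>The register is decremented before the body, so iteration \<open>k\<close> runs with the
  value \<open>n - Suc k\<close> and the register is 0 at the end.\<close>

lemma h_repeat:
  assumes "ok \<rho>" "r < tracks" "\<rho> r = n"
    "\<And>k. k < n \<Longrightarrow> hoare (At (I k) UNIV (J k) (\<rho>(r := n - Suc k)) \<tau>) c (w k) (At (I (Suc k)) UNIV (J (Suc k)) (\<rho>(r := n - Suc k)) \<tau>)"
  shows "hoare (At (I 0) UNIV (J 0) \<rho> \<tau>) (repeat r c) (concat (map w [0..<n])) (At (I n) UNIV (J n) (\<rho>(r := 0)) \<tau>)"
proof -
  have n: "n < 2 ^ L" using okD[OF assms(1), of r] assms(3) by simp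
  have "hoare (At (I 0) UNIV (J 0) (\<rho>(r := n - 0)) \<tau>) (repeat r c) (concat (map w [0..<n])) (At (I n) UNIV (J n) (\<rho>(r := n - n)) \<tau>)"
    unfolding repeat_def
  proof (rule h_While_Test)
    fix k assume "k \<le> n"
    then have "(n - k \<noteq> 0) = (k < n)" by auto
    then show "hoare (At (I k) UNIV (J k) (\<rho>(r := n - k)) \<tau>) (scan_work (\<lambda>t. \<not> bit t r)) []
          (\<lambda>s. At (I k) UNIV (J k) (\<rho>(r := n - k)) \<tau> s \<and> holds (\<lambda>a s b. s \<noteq> REnd) s = (k < n))"
      using test_zero[of "\<rho>(r := n - k)" r "I k" "J k" \<tau>] assms n by simp
  next
    fix k assume k: "k < n"
    have "hoare (At (I k) UNIV (J k) (\<rho>(r := n - k)) \<tau>) (dec r) [] (At (I k) UNIV (J k) (\<rho>(r := n - Suc k)) \<tau>)"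
      using h_dec[of "\<rho>(r := n - k)" r "I k" "J k" \<tau>] assms n k by simp
    then show "hoare (At (I k) UNIV (J k) (\<rho>(r := n - k)) \<tau>) (dec r ;; c) (w k) (At (I (Suc k)) UNIV (J (Suc k)) (\<rho>(r := n - Suc k)) \<tau>)"
      by (rule h_Seq[OF _ assms(4)[OF k]]) simp
  qed
  moreover have "\<rho>(r := n - 0) = \<rho>" using assms(3) by auto
  ultimately show ?thesis by simp
qed

lemma h_for_all:
  assumes "ok \<rho>" "r < tracks" "\<rho> r = 0"
    "\<And>k. k < 2 ^ L \<Longrightarrow> hoare (At (I k) UNIV (J k) (\<rho>(r := k)) \<tau>) c (w k) (At (I (Suc k)) UNIV (J (Suc k)) (\<rho>(r := k)) \<tau>)"
  shows "hoare (At (I 0) UNIV (J 0) \<rho> \<tau>) (for_all r c) (concat (map w [0..<2 ^ L])) (At (I (2 ^ L)) UNIV (J (2 ^ L)) \<rho> \<tau>)"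
proof -
  define n where "n = (2::nat) ^ L - 1"
  have n: "2 ^ L = Suc n" by (simp add: n_def)
  have 1: "hoare (At (I 0) UNIV (J 0) \<rho> \<tau>) c (w 0) (At (I (Suc 0)) UNIV (J (Suc 0)) (\<rho>(r := 0)) \<tau>)"
  proof -
    have "\<rho>(r := 0) = \<rho>" using assms(3) by auto
    then show ?thesis using assms(4)[of 0] by simp
  qed
  have 2: "hoare (At (I (Suc 0)) UNIV (J (Suc 0)) (\<rho>(r := 0)) \<tau>) (While_Test (scan_work (\<lambda>t. bit t r)) (\<lambda>a s b. s \<noteq> REnd) (inc r ;; c))
     (concat (map (\<lambda>k. w (Suc k)) [0..<n])) (At (I (Suc n)) UNIV (J (Suc n)) (\<rho>(r := n)) \<tau>)"
  proof (rule h_While_Test)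
    fix k assume "k \<le> n"
    then show "hoare (At (I (Suc k)) UNIV (J (Suc k)) (\<rho>(r := k)) \<tau>) (scan_work (\<lambda>t. bit t r)) []
          (\<lambda>s. At (I (Suc k)) UNIV (J (Suc k)) (\<rho>(r := k)) \<tau> s \<and> holds (\<lambda>a s b. s \<noteq> REnd) s = (k < n))"
      using test_ones[of "\<rho>(r := k)" r "I (Suc k)" "J (Suc k)" \<tau>] assms n by simp
  next
    fix k assume k: "k < n"
    have "hoare (At (I (Suc k)) UNIV (J (Suc k)) (\<rho>(r := k)) \<tau>) (inc r) [] (At (I (Suc k)) UNIV (J (Suc k)) (\<rho>(r := Suc k)) \<tau>)"
      using h_inc[of "\<rho>(r := k)" r "I (Suc k)" "J (Suc k)" \<tau>] assms n k by simp
    then show "hoare (At (I (Suc k)) UNIV (J (Suc k)) (\<rho>(r := k)) \<tau>) (inc r ;; c) (w (Suc k)) (At (I (Suc (Suc k))) UNIV (J (Suc (Suc k))) (\<rho>(r := Suc k)) \<tau>)"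
      by (rule h_Seq[OF _ assms(4)]) (use k n in auto)
  qed
  have 3: "hoare (At (I (Suc n)) UNIV (J (Suc n)) (\<rho>(r := n)) \<tau>) (zero r) [] (At (I (2 ^ L)) UNIV (J (2 ^ L)) \<rho> \<tau>)"
  proof -
    have "\<rho>(r := 0) = \<rho>" using assms(3) by auto
    then show ?thesis using h_zero[of "\<rho>(r := n)" r "I (Suc n)" "J (Suc n)" \<tau>] assms n by simp
  qed
  have "concat (map w [0..<2 ^ L]) = w 0 @ concat (map (\<lambda>k. w (Suc k)) [0..<n])"
    unfolding n upt_conv_Cons[OF zero_less_Suc] map_Suc_upt[symmetric] by (simp add: o_def)
  then show ?thesis
    unfolding for_all_def using 1 2 3 by (intro h_Seq[OF 1 h_Seq[OF 2 3]]) auto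
qed

lemma h_for_upto:
  assumes "ok \<rho>" "r < tracks" "r' < tracks" "r \<noteq> r'" "\<rho> r = 0" "\<rho> r' = n"
    "\<And>k. k < n \<Longrightarrow> hoare (At (I k) UNIV (J k) (\<rho>(r := Suc k)) \<tau>) c (w k) (At (I (Suc k)) UNIV (J (Suc k)) (\<rho>(r := Suc k)) \<tau>)"
  shows "hoare (At (I 0) UNIV (J 0) \<rho> \<tau>) (for_upto r r' c) (concat (map w [0..<n])) (At (I n) UNIV (J n) \<rho> \<tau>)"
proof -
  have n: "n < 2 ^ L" using okD[OF assms(1), of r'] assms(6) by simp
  have z: "\<rho>(r := 0) = \<rho>" using assms(5) by auto
  have 2: "hoare (At (I 0) UNIV (J 0) (\<rho>(r := 0)) \<tau>) (While_Test (scan_work (\<lambda>t. bit t r = bit t r')) (\<lambda>a s b. s \<noteq> REnd) (inc r ;; c))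
     (concat (map w [0..<n])) (At (I n) UNIV (J n) (\<rho>(r := n)) \<tau>)"
  proof (rule h_While_Test)
    fix k assume "k \<le> n"
    then show "hoare (At (I k) UNIV (J k) (\<rho>(r := k)) \<tau>) (scan_work (\<lambda>t. bit t r = bit t r')) []
          (\<lambda>s. At (I k) UNIV (J k) (\<rho>(r := k)) \<tau> s \<and> holds (\<lambda>a s b. s \<noteq> REnd) s = (k < n))"
      using test_neq[of "\<rho>(r := k)" r r' "I k" "J k" \<tau>] assms n by (auto simp: nat_less_le)
  next
    fix k assume k: "k < n"
    have "hoare (At (I k) UNIV (J k) (\<rho>(r := k)) \<tau>) (inc r) [] (At (I k) UNIV (J k) (\<rho>(r := Suc k)) \<tau>)"
      using h_inc[of "\<rho>(r := k)" r "I k" "J k" \<tau>] assms n k by simp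
    then show "hoare (At (I k) UNIV (J k) (\<rho>(r := k)) \<tau>) (inc r ;; c) (w k) (At (I (Suc k)) UNIV (J (Suc k)) (\<rho>(r := Suc k)) \<tau>)"
      by (rule h_Seq[OF _ assms(7)]) (use k in auto)
  qed
  have 3: "hoare (At (I n) UNIV (J n) (\<rho>(r := n)) \<tau>) (zero r) [] (At (I n) UNIV (J n) \<rho> \<tau>)"
    using h_zero[of "\<rho>(r := n)" r "I n" "J n" \<tau>] assms n z by simp
  show ?thesis
    unfolding for_upto_def using 2 3 z by (intro h_Seq[OF 2[unfolded z] 3]) auto
qed

end

section \<open>Programs writing the queries\<close>

text \<open>Keeps the simplifier from unfolding eta-expanded register updates.\<close>

declare fun_upd_apply [simp del] fun_upd_same [simp] fun_upd_other [simp]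

abbreviation (input) "rN \<equiv> 2 :: nat"
abbreviation (input) "rI \<equiv> 3 :: nat"
abbreviation (input) "rJ \<equiv> 4 :: nat"
abbreviation (input) "rC \<equiv> 5 :: nat"
abbreviation (input) "rH \<equiv> 6 :: nat"
abbreviation (input) "rU \<equiv> 7 :: nat"
abbreviation (input) "rV \<equiv> 8 :: nat"
abbreviation (input) "rA \<equiv> 9 :: nat"
abbreviation (input) "rB \<equiv> 10 :: nat"
abbreviation (input) "rS \<equiv> 11 :: nat"
abbreviation (input) "rW \<equiv> 12 :: nat"
abbreviation (input) "rG \<equiv> 13 :: nat"
abbreviation (input) "rP \<equiv> 14 :: nat"
abbreviation (input) "rF \<equiv> 15 :: nat"

definition times :: "nat \<Rightarrow> com \<Rightarrow> com" where
  "times r c = copy r rA ;; repeat rA c"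

definition skip_slot :: com where
  "skip_slot = for_cells (move_cat Go_Right)"

text \<open>A tape position is too large for one register, so the head walks: \<open>rA\<close>
  counts blocks, and \<open>rB\<close> counts the \<open>2 ^ L\<close> slots within each.\<close>

definition goto :: "nat \<Rightarrow> com" where
  "goto r = cstart ;; copy r rA ;; repeat rA (for_all rB skip_slot)"

definition goto_slot :: "nat \<Rightarrow> nat \<Rightarrow> com" where
  "goto_slot r r' = goto r ;; copy r' rA ;; repeat rA skip_slot"

definition count_vars :: com where
  "count_vars = istart ;; While (\<lambda>a s b. a = Sym True) (inc rN ;; move_in Go_Right)"

abbreviation (input) read_digits :: com where
  "read_digits \<equiv> While (\<lambda>a s b. a = Sym False)
       (move_in Go_Right ;; wset rS (\<lambda>a s b. a = Sym True) ;; move_in Go_Right ;; move_work Go_Right)"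

definition read_literal :: "com \<Rightarrow> com" where
  "read_literal c =
     move_in Go_Right ;; wstart ;; wset rG (\<lambda>a s b. a = Sym True) ;; move_in Go_Right ;; wstart ;;
     read_digits ;;
     c ;; zero rS ;; zero rG"

abbreviation (input) read_token :: "com \<Rightarrow> com \<Rightarrow> com" where
  "read_token c d \<equiv> Cond (\<lambda>a s b. a = Sym True)
         (move_in Go_Right ;; Cond (\<lambda>a s b. a = Sym True) (move_in Go_Right ;; c)
            (move_in Go_Right ;; read_literal d))
         (move_in Go_Right)"

definition for_tokens :: "com \<Rightarrow> com \<Rightarrow> com" where
  "for_tokens c d =
     istart ;; While (\<lambda>a s b. a = Sym True) (move_in Go_Right) ;; move_in Go_Right ;;
     While (\<lambda>a s b. a \<noteq> REnd)
       (read_token c d)"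

section \<open>Tokens of an arbitrary input string\<close>

datatype tok = Cl | Lit bool nat

text \<open>Total on all strings: a digit cut off by the end of the input counts as 0.\<close>

fun digs :: "bool list \<Rightarrow> bool list" where
  "digs (False # ys) = (ys \<noteq> [] \<and> hd ys) # digs (tl ys)"
| "digs _ = []"

fun after_digs :: "bool list \<Rightarrow> bool list" where
  "after_digs (False # ys) = after_digs (tl ys)"
| "after_digs xs = xs"

lemma suffix_after_digs: "suffix (after_digs xs) xs"
proof (induction xs rule: after_digs.induct)
  case (1 ys)
  have "suffix (tl ys) (False # ys)" by (metis suffix_ConsI suffix_tl)
  with 1 show ?case by (simp add: suffix_order.trans)
qed auto

lemma length_after_digs: "length (after_digs xs) \<le> length xs"
  using suffix_after_digs by (rule suffix_length_le)

text \<open>Digits from position \<open>l\<close> on are dropped. The machine does the same, because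
  its work head is then on the right end marker, where writing has no effect.\<close>

fun add_digits :: "nat \<Rightarrow> nat \<Rightarrow> nat \<Rightarrow> bool list \<Rightarrow> nat" where
  "add_digits l k v [] = v"
| "add_digits l k v (b # ds) = add_digits l (Suc k) (if k < l then set_to k b v else v) ds"

lemma add_digits_less: "v < 2 ^ l \<Longrightarrow> add_digits l k v ds < 2 ^ l"
proof (induction ds arbitrary: k v)
  case (Cons b ds)
  have "k < l \<Longrightarrow> set_to k b v < 2 ^ l"
    by (rule less_exp_if_bits) (use Cons.prems in \<open>auto simp: bit_set_to dest: bit_less_exp split: if_splits\<close>)
  with Cons show ?case by simp
qed simp

text \<open>Mirrors the behaviour of the machine on malformed strings too, since its tape has to be
  restored there as well.\<close>

function toks :: "nat \<Rightarrow> bool list \<Rightarrow> tok list" where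
  "toks l [] = []"
| "toks l (False # xs) = toks l xs"
| "toks l (True # xs) =
     (if xs \<noteq> [] \<and> hd xs then Cl # toks l (tl xs)
      else Lit (tl (tl xs) \<noteq> [] \<and> hd (tl (tl xs))) (add_digits l 0 0 (digs (tl (tl (tl xs)))))
             # toks l (after_digs (tl (tl (tl xs)))))"
  by pat_completeness auto
termination
  by (relation "measure (\<lambda>(l, xs). length xs)")
    (auto intro!: le_less_trans[OF length_after_digs])

text \<open>
  The verifier keeps a head on the certificate (the value of variable \<open>k\<close> is at position \<open>k + 1\<close>) and a
  counter truncated at 0. Its tokens are: 0 increments the counter, 1 and 2 move the head right and left,
  3 and 4 decrement the counter if the scanned value is 1 and 0, respectively, and 5 rejects unless the
  counter is 0. Both clauses and weight thresholds are thus demands on a weighted sum.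
\<close>

fun formula_vtoks :: "tok \<Rightarrow> nat list" where
  "formula_vtoks Cl = [5, 0]"
| "formula_vtoks (Lit s v) = replicate (v + 1) 1 @ [if s then 3 else 4] @ replicate (v + 1) 2"

text \<open>The first \<open>5\<close> judges the last clause. Then \<open>v\<close> increments and
  the weighted decrements leave the truncated counter at 0 iff the weight reaches \<open>v\<close>.
  The end demands the value \<open>c\<close> at certificate position \<open>J\<close>, which belongs
  to variable \<open>J - 1\<close>.\<close>

definition vquery :: "tok list \<Rightarrow> nat \<Rightarrow> (nat \<Rightarrow> nat) \<Rightarrow> nat \<Rightarrow> nat \<Rightarrow> bool \<Rightarrow> nat list" where
  "vquery ts n w v J c = concat (map formula_vtoks ts) @ [5] @
     replicate v 0 @ concat (map (\<lambda>k. 1 # replicate (w (Suc k)) 3) [0..<n]) @ [5] @ replicate n 2 @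
     [0] @ replicate J 1 @ [if c then 3 else 4, 5]"

text \<open>The verifier has one mode per token: a bit 0 advances the mode cyclically, a bit 1 acts.\<close>

definition code :: "nat \<Rightarrow> bool list" where
  "code m = replicate m False @ [True] @ replicate (6 - m) False"

definition codes :: "nat list \<Rightarrow> bool list" where
  "codes ms = concat (map code ms)"

definition vts :: "nat list \<Rightarrow> com" where
  "vts ms = em (map Some (codes ms))"

text \<open>A threshold may need twice as many bits as a register has, so it is given as
  \<open>U * 2 ^ L + V\<close> by the two registers \<open>rU\<close> and \<open>rV\<close>.\<close>

definition thresholds :: com where
  "thresholds = times rU (for_all rB (vts [0])) ;; times rV (vts [0])"

text \<open>\<open>rC\<close> overrides the weight in slot \<open>rJ\<close>. In the first round it
  holds that very weight, in the second it runs through all candidates for an erased one.\<close>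

abbreviation (input) emit_weight :: com where
  "emit_weight \<equiv> vts [1] ;; load rW ;;
       (scan_work (\<lambda>t. bit t rS = bit t rJ) ;; Cond (\<lambda>a s b. s \<noteq> REnd) Skip (copy rC rW)) ;;
       repeat rW (vts [3])"

definition weights :: com where
  "weights = goto rI ;; skip_slot ;;
     for_upto rS rN emit_weight ;;
     vts [5] ;; times rN (vts [2])"

abbreviation (input) emit_literal :: com where
  "emit_literal \<equiv> vts [1] ;; times rS (vts [1]) ;;
      (scan_work (\<lambda>t. \<not> bit t rG) ;; Cond (\<lambda>a s b. s \<noteq> REnd) (vts [3]) (vts [4])) ;;
      vts [2] ;; times rS (vts [2])"

definition formula :: com where
  "formula = for_tokens (vts [5, 0])
     emit_literal ;; vts [5]"

definition constraint :: "bool \<Rightarrow> com" where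
  "constraint c = vts [0] ;; times rJ (vts [1]) ;; vts [if c then 3 else 4, 5]"

definition query :: "bool \<Rightarrow> com" where
  "query c = formula ;; thresholds ;; weights ;; constraint c ;; out None"

text \<open>The counter is incremented and then required to be 0. Together with the empty query,
  which is accepted, this lets the query phase send bits of its own choice through the
  oracle.\<close>

definition false_query :: "bool list" where
  "false_query = codes [0, 5]"

type_synonym cmd = "nat \<times> bool list"

text \<open>The opcode is in unary: \<open>m\<close> negative answers and a positive one, followed
  by the operand.\<close>

definition cmd_queries :: "cmd \<Rightarrow> bool list list" where
  "cmd_queries = (\<lambda>(m, q). replicate m false_query @ [[], q])"

definition qstream :: "bool list list \<Rightarrow> bool option list" where
  "qstream qs = concat (map (\<lambda>q. map Some q @ [None]) qs)"

definition cstream :: "cmd list \<Rightarrow> bool option list" where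
  "cstream cs = qstream (concat (map cmd_queries cs))"

definition op :: "nat \<Rightarrow> com" where
  "op m = em (qstream (replicate m false_query @ [[]]))"

definition known :: "nat \<Rightarrow> com" where
  "known m = op m ;; out None"

definition test :: com where
  "test = known 0 ;; for_all rU (for_all rV (op 1 ;; query False ;; op 2 ;; query True))"

definition keep_slot :: com where
  "keep_slot = for_cells (known 8 ;; move_cat Go_Right)"

definition set_slot :: "nat \<Rightarrow> com" where
  "set_slot r = for_cells (Cond (\<lambda>a s b. on_sym (\<lambda>t. bit t r) s) (known 10) (known 9) ;; move_cat Go_Right)"

abbreviation (input) overwrite_slot :: "nat \<Rightarrow> nat \<Rightarrow> com" where
  "overwrite_slot r r' \<equiv> scan_work (\<lambda>t. bit t rU = bit t rI) ;; Cond (\<lambda>a s b. s \<noteq> REnd) keep_slot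
        (scan_work (\<lambda>t. \<not> bit t rV) ;; Cond (\<lambda>a s b. s \<noteq> REnd)
          (scan_work (\<lambda>t. bit t rV = bit t rJ) ;; Cond (\<lambda>a s b. s \<noteq> REnd) keep_slot (set_slot r'))
          (set_slot r))"

text \<open>The configuration begins with the \<open>L\<close> cells of the work tape, hence the
  leading rotations. One rotation is written for each cell of the configuration, so a pass ends in
  the original alignment whether or not it overwrites.\<close>

definition overwrite :: "nat \<Rightarrow> nat \<Rightarrow> com" where
  "overwrite r r' = cstart ;; for_cells (known 8) ;;
     for_all rU (for_all rV
      (overwrite_slot r r')) ;;
     While (\<lambda>a s b. b \<noteq> REnd) (known 8 ;; move_cat Go_Right)"

abbreviation (input) test_variable :: "nat \<Rightarrow> com" where
  "test_variable m \<equiv> goto_slot rI rJ ;; load rC ;; test ;; known m ;; zero rC"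

abbreviation (input) compress_variable :: com where
  "compress_variable \<equiv> goto_slot rI rJ ;; load rC ;; goto rI ;; load rH ;; test ;; known 7 ;;
         overwrite rJ rH ;; zero rC ;; zero rH"

text \<open>Output cannot be revoked. Each block is therefore tested twice: once to learn whether
  all its variables are unambiguous, and once more to output their values.\<close>

definition prog1 :: com where
  "prog1 = count_vars ;;
     for_all rI
      (for_upto rJ rN (test_variable 3) ;;
       for_upto rJ rN (test_variable 4) ;; known 5) ;;
     for_all rI (known 6 ;;
       for_upto rJ rN compress_variable) ;;
     zero rN"

text \<open>The top bit of slot 0 stems from the search and is not part of the stored name. A
  complete conditional pass is written for every candidate weight \<open>rC\<close>, because the
  right one is unknown until the answers arrive.\<close>

abbreviation (input) restore_block :: com where
  "restore_block \<equiv> goto rI ;; load rJ ;; clear_top rJ ;; goto_slot rI rJ ;; load rH ;;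
       for_all rC (known 6 ;; test ;; known 7 ;; overwrite rH rC) ;; zero rJ ;; zero rH"

definition prog2 :: com where
  "prog2 = count_vars ;;
     for_all rI
      restore_block ;;
     zero rN"

lemma codes_append: "codes (a @ b) = codes a @ codes b"
  by (simp add: codes_def)

lemma codes_replicate: "codes (replicate k m) = concat (map (\<lambda>_. codes [m]) [0..<k])"
  by (induction k) (simp_all add: codes_def replicate_append_same[symmetric])

lemma map_concat_map: "map f (concat (map g xs)) = concat (map (\<lambda>x. map f (g x)) xs)"
  by (simp add: map_concat o_def)

section \<open>Layout of the catalytic tape and navigation on it\<close>

locale tape = work +
  fixes \<tau>0 :: "bool list"
  assumes long: "2 ^ L * 2 ^ L * L \<le> length \<tau>0" and short: "length x < 2 ^ (L - 1)"
begin

abbreviation Bk :: nat where "Bk \<equiv> 2 ^ L"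

text \<open>
  The tape whose block \<open>I\<close> holds the number \<open>g I S\<close> in slot \<open>S\<close>, least significant bit first; the cells
  behind the last block are those of \<open>\<tau>0\<close>. Slot 0 is the spare slot of a block.
\<close>

definition T :: "(nat \<Rightarrow> nat \<Rightarrow> nat) \<Rightarrow> bool list" where
  "T g = map (\<lambda>p. if p < Bk * Bk * L then bit (g (p div L div Bk) (p div L mod Bk)) (p mod L) else \<tau>0 ! p)
     [0..<length \<tau>0]"

definition okg :: "(nat \<Rightarrow> nat \<Rightarrow> nat) \<Rightarrow> bool" where
  "okg g \<longleftrightarrow> (\<forall>I S. g I S < Bk)"

lemma length_T [simp]: "length (T g) = length \<tau>0"
  by (simp add: T_def)

definition pos :: "nat \<Rightarrow> nat \<Rightarrow> nat" where
  "pos I S = (I * Bk + S) * L + 1"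

lemma pos_Suc: "pos I (Suc S) = pos I S + L"
  by (simp add: pos_def algebra_simps)

lemma pos_Bk: "pos I Bk = pos (Suc I) 0"
  by (simp add: pos_def algebra_simps)

lemma pos_le: "I < Bk \<Longrightarrow> S \<le> Bk \<Longrightarrow> pos I S \<le> length \<tau>0 + 1"
proof -
  assume "I < Bk" "S \<le> Bk"
  then have "I * Bk + S \<le> Suc I * Bk" "Suc I * Bk \<le> Bk * Bk"
    by (simp, intro mult_le_mono1, simp)
  then have "(I * Bk + S) * L \<le> Bk * Bk * L" by (meson le_trans mult_le_mono1)
  with long have "(I * Bk + S) * L \<le> length \<tau>0" by (rule le_trans[rotated])
  then show ?thesis by (simp add: pos_def)
qed

lemma slot_index:
  assumes "I < Bk" "S < Bk" "k < L"
  shows "(I * Bk + S) * L + k < Bk * Bk * L" "((I * Bk + S) * L + k) div L = I * Bk + S"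
    "((I * Bk + S) * L + k) mod L = k"
proof -
  have "I * Bk + S < Suc I * Bk" using assms by simp
  also have "\<dots> \<le> Bk * Bk" using assms by (intro mult_le_mono1) simp
  finally have "Suc (I * Bk + S) * L \<le> Bk * Bk * L" by (intro mult_le_mono1) simp
  then show "(I * Bk + S) * L + k < Bk * Bk * L" using assms by simp
qed (use assms L_pos in auto)

lemma scan_T:
  assumes "I < Bk" "S < Bk" "k < L"
  shows "scan (T g) (pos I S + k) = Sym (bit (g I S) k)"
proof -
  let ?p = "(I * Bk + S) * L + k"
  note p = slot_index[OF assms]
  have "T g ! ?p = bit (g (?p div L div Bk) (?p div L mod Bk)) (?p mod L)"
    unfolding T_def using p(1) long by (subst nth_map) auto
  also have "\<dots> = bit (g I S) k" using p(2,3) assms by simp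
  finally show ?thesis using p(1) long by (simp add: scan_def pos_def)
qed

definition clean :: "(nat \<Rightarrow> nat) \<Rightarrow> bool" where
  "clean \<rho> \<longleftrightarrow> ok \<rho> \<and> \<rho> rA = 0 \<and> \<rho> rB = 0 \<and> \<rho> rS = 0 \<and> \<rho> rW = 0 \<and> \<rho> rG = 0"

lemma h_skip: "j + L \<le> length \<tau> + 1 \<Longrightarrow> hoare (At I UNIV {j} \<rho> \<tau>) skip_slot [] (At I UNIV {j + L} \<rho> \<tau>)"
proof -
  assume a: "j + L \<le> length \<tau> + 1"
  have "hoare (At I UNIV {j + 0} \<rho> \<tau>) skip_slot (concat (map (\<lambda>_. []) [0..<L])) (At I UNIV {j + L} \<rho> \<tau>)"
    unfolding skip_slot_def
  proof (rule h_for_cells)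
    fix k assume k: "k < L"
    show "hoare (At I {k + 1} {j + k} \<rho> \<tau>) (move_cat Go_Right) [] (At I {k + 1} {j + Suc k} \<rho> \<tau>)"
      by (rule h_weaken[OF h_move_cat]) (use k a in auto)
  qed
  then show ?thesis by simp
qed

lemma h_goto:
  assumes "ok \<rho>" "\<rho> rA = 0" "\<rho> rB = 0" "r < tracks" "r \<noteq> rA"
  shows "hoare (At I UNIV UNIV \<rho> (T g)) (goto r) [] (At I UNIV {pos (\<rho> r) 0} \<rho> (T g))"
proof -
  have r: "\<rho> r < Bk" using okD[OF assms(1)] .
  have 1: "hoare (At I UNIV {1} \<rho> (T g)) (copy r rA) [] (At I UNIV {1} (\<rho>(rA := \<rho> r)) (T g))"
    by (rule h_copy) (use assms in auto)
  have 2: "hoare (At I UNIV {pos 0 0} (\<rho>(rA := \<rho> r)) (T g)) (repeat rA (for_all rB skip_slot)) (concat (map (\<lambda>_. []) [0..<\<rho> r]))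
      (At I UNIV {pos (\<rho> r) 0} (\<rho>(rA := \<rho> r, rA := 0)) (T g))"
  proof (rule h_repeat)
    fix k assume k: "k < \<rho> r"
    let ?\<rho> = "\<rho>(rA := \<rho> r, rA := \<rho> r - Suc k)"
    have "hoare (At I UNIV {pos k 0} ?\<rho> (T g)) (for_all rB skip_slot) (concat (map (\<lambda>_. []) [0..<Bk])) (At I UNIV {pos k Bk} ?\<rho> (T g))"
    proof (rule h_for_all)
      fix S :: nat assume S: "S < Bk"
      have "pos k S + L \<le> length (T g) + 1"
        using pos_le[of k "Suc S"] S k r by (simp add: pos_Suc)
      from h_skip[OF this, of I] show "hoare (At I UNIV {pos k S} (?\<rho>(rB := S)) (T g)) skip_slot [] (At I UNIV {pos k (Suc S)} (?\<rho>(rB := S)) (T g))"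
        by (simp add: pos_Suc)
    qed (use assms r in auto)
    then show "hoare (At I UNIV {pos k 0} ?\<rho> (T g)) (for_all rB skip_slot) [] (At I UNIV {pos (Suc k) 0} ?\<rho> (T g))"
      by (simp add: pos_Bk)
  qed (use assms r in auto)
  have e: "\<rho>(rA := 0) = \<rho>" using assms by (simp add: fun_upd_idem)
  have p: "pos 0 0 = 1" by (simp add: pos_def)
  show ?thesis
    unfolding goto_def using 2 unfolding p
    by (intro h_Seq[OF h_cstart h_Seq[OF 1]]) (auto simp: e)
qed

lemma h_goto_slot:
  assumes "ok \<rho>" "\<rho> rA = 0" "\<rho> rB = 0" "r < tracks" "r \<noteq> rA" "r' < tracks" "r' \<noteq> rA"
  shows "hoare (At I UNIV UNIV \<rho> (T g)) (goto_slot r r') [] (At I UNIV {pos (\<rho> r) (\<rho> r')} \<rho> (T g))"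
proof -
  have r: "\<rho> r < Bk" "\<rho> r' < Bk" using okD[OF assms(1)] by auto
  have 1: "hoare (At I UNIV {pos (\<rho> r) 0} \<rho> (T g)) (copy r' rA) [] (At I UNIV {pos (\<rho> r) 0} (\<rho>(rA := \<rho> r')) (T g))"
    by (rule h_copy) (use assms in auto)
  have 2: "hoare (At I UNIV {pos (\<rho> r) 0} (\<rho>(rA := \<rho> r')) (T g)) (repeat rA skip_slot) (concat (map (\<lambda>_. []) [0..<\<rho> r']))
      (At I UNIV {pos (\<rho> r) (\<rho> r')} (\<rho>(rA := \<rho> r', rA := 0)) (T g))"
  proof (rule h_repeat)
    fix k assume k: "k < \<rho> r'"
    have "pos (\<rho> r) k + L \<le> length (T g) + 1"
      using pos_le[of "\<rho> r" "Suc k"] k r by (simp add: pos_Suc)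
    from h_skip[OF this, of I]
    show "hoare (At I UNIV {pos (\<rho> r) k} (\<rho>(rA := \<rho> r', rA := \<rho> r' - Suc k)) (T g)) skip_slot [] (At I UNIV {pos (\<rho> r) (Suc k)} (\<rho>(rA := \<rho> r', rA := \<rho> r' - Suc k)) (T g))"
      by (simp add: pos_Suc)
  qed (use assms r in auto)
  have e: "\<rho>(rA := 0) = \<rho>" using assms by (simp add: fun_upd_idem)
  show ?thesis
    unfolding goto_slot_def using 2
    by (intro h_Seq[OF h_goto h_Seq[OF 1]]) (use assms in \<open>auto simp: e\<close>)
qed

lemma h_load_slot:
  assumes "ok \<rho>" "r < tracks" "okg g" "I < Bk" "S < Bk"
  shows "hoare (At II UNIV {pos I S} \<rho> (T g)) (load r) [] (At II UNIV {pos I (Suc S)} (\<rho>(r := g I S)) (T g))"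
  using h_load[of \<rho> r "g I S" "T g" "pos I S" II] assms scan_T[of I S _ g]
  by (simp add: okg_def pos_Suc)

section \<open>Reading the input along its suffixes\<close>

definition ip :: "bool list \<Rightarrow> nat" where
  "ip xs = length x + 1 - length xs"

lemma scan_ip: "suffix xs x \<Longrightarrow> scan x (ip xs) = (case xs of [] \<Rightarrow> REnd | b # _ \<Rightarrow> Sym b)"
  by (auto simp: scan_def ip_def suffix_def nth_append split: list.splits)

lemma shift_ip: "suffix xs x \<Longrightarrow> shift x Go_Right (ip xs) = ip (tl xs)"
  by (cases xs) (auto simp: ip_def suffix_def)

lemma suffix_tl_input: "suffix xs x \<Longrightarrow> suffix (tl xs) x"
  by (metis suffix_order.trans suffix_tl)

lemma h_iright: "suffix xs x \<Longrightarrow> hoare (At {ip xs} H J \<rho> \<tau>) (move_in Go_Right) [] (At {ip (tl xs)} H J \<rho> \<tau>)"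
  using h_move_in[of "ip xs" H J \<rho> \<tau> Go_Right] shift_ip[of xs] by simp

lemma h_While_true:
  "(\<And>s. P s \<Longrightarrow> holds p s) \<Longrightarrow> hoare P c w Q \<Longrightarrow> hoare Q (While p c) w' R \<Longrightarrow> v = w @ w' \<Longrightarrow> hoare P (While p c) v R"
  unfolding hoare_def using ex_While_step by blast

lemma h_While_false:
  "(\<And>s. P s \<Longrightarrow> \<not> holds p s) \<Longrightarrow> hoare P (While p c) [] P"
  unfolding hoare_def using ex_While_end by blast

definition num_vars :: nat where
  "num_vars = length (takeWhile (\<lambda>b. b) x)"

definition body :: "bool list" where
  "body = tl (dropWhile (\<lambda>b. b) x)"

lemma suffix_dropWhile_tl: "suffix (tl (dropWhile (\<lambda>b. b) x)) x"
  by (metis suffix_dropWhile suffix_order.trans suffix_tl)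

lemma num_vars_less: "num_vars < 2 ^ (L - 1)" "num_vars < Bk"
proof -
  have "num_vars \<le> length x" by (simp add: num_vars_def length_takeWhile_le)
  then show "num_vars < 2 ^ (L - 1)" using short by simp
  also have "(2::nat) ^ (L - 1) \<le> 2 ^ L" by (intro power_increasing) auto
  finally show "num_vars < Bk" .
qed

lemma ip_full: "ip x = 1"
  by (simp add: ip_def)

lemma h_count_vars:
  assumes "ok \<rho>" "\<rho> rN = 0"
  shows "hoare (At UNIV UNIV J \<rho> \<tau>) count_vars [] (At UNIV UNIV J (\<rho>(rN := num_vars)) \<tau>)"
proof -
  have "suffix xs x \<Longrightarrow> v + length (takeWhile (\<lambda>b. b) xs) < Bk \<Longrightarrow>
    hoare (At {ip xs} UNIV J (\<rho>(rN := v)) \<tau>) (While (\<lambda>a s b. a = Sym True) (inc rN ;; move_in Go_Right)) []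
      (At UNIV UNIV J (\<rho>(rN := v + length (takeWhile (\<lambda>b. b) xs))) \<tau>)" for xs v
  proof (induction xs arbitrary: v)
    case Nil
    have "hoare (At {ip []} UNIV J (\<rho>(rN := v)) \<tau>) (While (\<lambda>a s b. a = Sym True) (inc rN ;; move_in Go_Right)) []
      (At {ip []} UNIV J (\<rho>(rN := v)) \<tau>)"
      by (rule h_While_false) (use Nil in \<open>auto simp: At_holds_in scan_ip\<close>)
    then show ?case by (rule h_conseq) (auto simp: At_def)
  next
    case (Cons b xs)
    show ?case
    proof (cases b)
      case True
      show ?thesis
      proof (rule h_While_true)
        show "hoare (At {ip (b # xs)} UNIV J (\<rho>(rN := v)) \<tau>) (inc rN ;; move_in Go_Right) []
          (At {ip xs} UNIV J (\<rho>(rN := Suc v)) \<tau>)"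
          using h_inc[of "\<rho>(rN := v)" rN "{ip (b # xs)}" J \<tau>] h_iright[OF Cons.prems(1)] assms Cons.prems True
          by (intro h_Seq) auto
        show "hoare (At {ip xs} UNIV J (\<rho>(rN := Suc v)) \<tau>) (While (\<lambda>a s b. a = Sym True) (inc rN ;; move_in Go_Right)) []
           (At UNIV UNIV J (\<rho>(rN := v + length (takeWhile (\<lambda>b. b) (b # xs)))) \<tau>)"
          using Cons.IH[of "Suc v"] Cons.prems True suffix_tl_input[of "b # xs"] by simp
      qed (use True Cons.prems in \<open>auto simp: At_holds_in scan_ip\<close>)
    next
      case False
      have "hoare (At {ip (b # xs)} UNIV J (\<rho>(rN := v)) \<tau>) (While (\<lambda>a s b. a = Sym True) (inc rN ;; move_in Go_Right)) []
        (At {ip (b # xs)} UNIV J (\<rho>(rN := v)) \<tau>)"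
        by (rule h_While_false) (use Cons.prems False in \<open>auto simp: At_holds_in scan_ip\<close>)
      then show ?thesis by (rule h_conseq) (use False in \<open>auto simp: At_def\<close>)
    qed
  qed
  from this[of x 0] num_vars_less
  have "hoare (At {1} UNIV J (\<rho>(rN := 0)) \<tau>) (While (\<lambda>a s b. a = Sym True) (inc rN ;; move_in Go_Right)) []
      (At UNIV UNIV J (\<rho>(rN := num_vars)) \<tau>)"
    by (simp add: ip_full num_vars_def)
  moreover have "\<rho>(rN := 0) = \<rho>" using assms by (simp add: fun_upd_idem)
  ultimately show ?thesis unfolding count_vars_def by (intro h_Seq[OF h_istart]) auto
qed

lemma h_digits:
  assumes "suffix zs x" "ok \<rho>"
  shows "hoare (At {ip zs} {min (k + 1) (L + 1)} J (\<rho>(rS := v)) \<tau>)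
    read_digits []
    (At {ip (after_digs zs)} UNIV J (\<rho>(rS := add_digits L k v (digs zs))) \<tau>)"
  using assms(1)
proof (induction zs arbitrary: k v rule: digs.induct)
  case (1 ys)
  let ?h = "min (k + 1) (L + 1)"
  let ?b = "ys \<noteq> [] \<and> hd ys"
  let ?v = "if k < L then set_to k ?b v else v"
  have s: "suffix ys x" using suffix_tl_input[OF 1(2)] by simp
  have s2: "suffix (tl ys) x" using suffix_tl_input[OF s] .
  have sc: "(scan x (ip ys) = Sym True) = ?b" using s by (auto simp: scan_ip split: list.splits)
  have a: "hoare (At {ip (False # ys)} {?h} J (\<rho>(rS := v)) \<tau>) (move_in Go_Right) [] (At {ip ys} {?h} J (\<rho>(rS := v)) \<tau>)"
    using h_iright[OF 1(2)] by simp
  have b: "hoare (At {ip ys} {?h} J (\<rho>(rS := v)) \<tau>) (wset rS (\<lambda>a s b. a = Sym True)) [] (At {ip ys} {?h} J (\<rho>(rS := ?v)) \<tau>)"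
  proof (cases "k < L")
    case True
    then have "?h = k + 1" by simp
    with True show ?thesis
      using h_wset[of rS "k + 1" "{ip ys}" J "\<lambda>a s b. a = Sym True" "\<rho>(rS := v)" \<tau> ?b] sc by (auto simp: upd_def min_def)
  next
    case False
    then show ?thesis
      by (intro h_AtI) (auto intro!: ex_wset_end)
  qed
  have c: "hoare (At {ip ys} {?h} J (\<rho>(rS := ?v)) \<tau>) (move_in Go_Right) [] (At {ip (tl ys)} {?h} J (\<rho>(rS := ?v)) \<tau>)"
    using h_iright[OF s] by simp
  have d: "hoare (At {ip (tl ys)} {?h} J (\<rho>(rS := ?v)) \<tau>) (move_work Go_Right) [] (At {ip (tl ys)} {min (Suc k + 1) (L + 1)} J (\<rho>(rS := ?v)) \<tau>)"
  proof -
    have "wmove Go_Right ?h = min (Suc k + 1) (L + 1)" by (auto simp: min_def)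
    then show ?thesis using h_move_work[of "{ip (tl ys)}" ?h J "\<rho>(rS := ?v)" \<tau> Go_Right] by simp
  qed
  show ?case
    by (rule h_While_true[OF _ h_Seq[OF a h_Seq[OF b h_Seq[OF c d refl] refl] refl]])
      (use 1 s2 in \<open>auto simp: At_holds_in scan_ip\<close>)
next
  case ("2_1")
  have "hoare (At {ip []} {min (k + 1) (L + 1)} J (\<rho>(rS := v)) \<tau>) read_digits []
       (At {ip []} {min (k + 1) (L + 1)} J (\<rho>(rS := v)) \<tau>)"
    by (rule h_While_false) (use "2_1" in \<open>auto simp: At_holds_in scan_ip\<close>)
  then show ?case by (rule h_conseq) (auto simp: At_def)
next
  case ("2_2" va)
  have "hoare (At {ip (True # va)} {min (k + 1) (L + 1)} J (\<rho>(rS := v)) \<tau>) read_digits []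
       (At {ip (True # va)} {min (k + 1) (L + 1)} J (\<rho>(rS := v)) \<tau>)"
    by (rule h_While_false) (use "2_2" in \<open>auto simp: At_holds_in scan_ip\<close>)
  then show ?case by (rule h_conseq) (auto simp: At_def)
qed

end

context tape
begin

lemma h_read_literal:
  assumes "suffix xs x" "ok \<rho>" "\<rho> rS = 0" "\<rho> rG = 0" "ok \<rho>'" "\<rho>' rS = 0" "\<rho>' rG = 0"
    and s: "s = (tl xs \<noteq> [] \<and> hd (tl xs))" and zs: "zs = tl (tl xs)"
    and v: "v = add_digits L 0 0 (digs zs)"
    and c: "\<And>i. hoare (At {i} UNIV UNIV (\<rho>(rG := of_bool s, rS := v)) \<tau>) c w
      (At {i} UNIV UNIV (\<rho>'(rG := of_bool s, rS := v)) \<tau>)"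
  shows "hoare (At {ip xs} UNIV UNIV \<rho> \<tau>) (read_literal c) w (At {ip (after_digs zs)} UNIV UNIV \<rho>' \<tau>)"
proof -
  let ?\<rho> = "\<rho>(rG := of_bool s)"
  have L1: "(1::nat) < 2 ^ L" using one_less_power[of "2::nat" L] L_pos by simp
  have ob: "of_bool s < (2::nat) ^ L" using L1 by (cases s) auto
  have sf: "suffix (tl xs) x" "suffix zs x" using suffix_tl_input assms(1) zs by auto
  have sc: "(scan x (ip (tl xs)) = Sym True) = s" using sf(1) s by (auto simp: scan_ip split: list.splits)
  have vl: "v < 2 ^ L" unfolding v by (rule add_digits_less) simp
  have 1: "hoare (At {ip xs} UNIV UNIV \<rho> \<tau>) (move_in Go_Right) [] (At {ip (tl xs)} UNIV UNIV \<rho> \<tau>)"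
    by (rule h_iright) fact
  have "upd \<rho> rG 0 s = ?\<rho>" using assms(4)
    by (cases s) (auto simp: upd_def set_to_def set_bit_0 unset_bit_0)
  then have "hoare (At {ip (tl xs)} {1} UNIV \<rho> \<tau>) (wset rG (\<lambda>a s b. a = Sym True)) [] (At {ip (tl xs)} {1} UNIV ?\<rho> \<tau>)"
    using h_wset[of rG 1 "{ip (tl xs)}" UNIV "\<lambda>a s b. a = Sym True" \<rho> \<tau> s] L_pos sc by simp
  then have 2: "hoare (At {ip (tl xs)} {1} UNIV \<rho> \<tau>) (wset rG (\<lambda>a s b. a = Sym True)) [] (At {ip (tl xs)} UNIV UNIV ?\<rho> \<tau>)"
    by (rule h_weaken) auto
  have 3: "hoare (At {ip (tl xs)} UNIV UNIV ?\<rho> \<tau>) (move_in Go_Right) [] (At {ip zs} UNIV UNIV ?\<rho> \<tau>)"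
    using h_iright[OF sf(1)] zs by simp
  have "?\<rho>(rS := 0) = ?\<rho>" using assms(3) by (simp add: fun_upd_idem)
  moreover have "ok ?\<rho>" using assms(2) ob by simp
  ultimately have 4: "hoare (At {ip zs} {1} UNIV ?\<rho> \<tau>)
    read_digits []
    (At {ip (after_digs zs)} UNIV UNIV (?\<rho>(rS := v)) \<tau>)"
    using h_digits[OF sf(2), of ?\<rho> 0 UNIV 0 \<tau>] v by simp
  have "\<rho>'(rG := of_bool s, rS := 0) = \<rho>'(rG := of_bool s)" using assms(6) by (simp add: fun_upd_idem)
  then have 5: "hoare (At {ip (after_digs zs)} UNIV UNIV (\<rho>'(rG := of_bool s, rS := v)) \<tau>) (zero rS) []
     (At {ip (after_digs zs)} UNIV UNIV (\<rho>'(rG := of_bool s)) \<tau>)"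
    using h_zero[of "\<rho>'(rG := of_bool s, rS := v)" rS "{ip (after_digs zs)}" UNIV \<tau>] assms(5) ob vl by simp
  have "\<rho>'(rG := 0) = \<rho>'" using assms(7) by (simp add: fun_upd_idem)
  then have 6: "hoare (At {ip (after_digs zs)} UNIV UNIV (\<rho>'(rG := of_bool s)) \<tau>) (zero rG) []
     (At {ip (after_digs zs)} UNIV UNIV \<rho>' \<tau>)"
    using h_zero[of "\<rho>'(rG := of_bool s)" rG "{ip (after_digs zs)}" UNIV \<tau>] assms(5) ob by simp
  show ?thesis
    unfolding read_literal_def
    by (rule h_Seq[OF 1 h_Seq[OF h_wstart h_Seq[OF 2 h_Seq[OF 3 h_Seq[OF h_wstart h_Seq[OF 4
       h_Seq[OF c h_Seq[OF 5 6 refl] refl] refl] refl] refl] refl] refl]]) simp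
qed

text \<open>The registers form a family \<open>R\<close> indexed by an accumulator that each token
  updates. Writing the formula takes the trivial accumulator, evaluating it takes the pair of clause
  flags.\<close>

lemma h_token_loop:
  assumes R: "\<And>a. ok (R a) \<and> R a rS = 0 \<and> R a rG = 0"
    and c: "\<And>i a. hoare (At {i} UNIV UNIV (R a) \<tau>) c (w Cl) (At {i} UNIV UNIV (R (f a Cl)) \<tau>)"
    and d: "\<And>i a s v. v < 2 ^ L \<Longrightarrow> hoare (At {i} UNIV UNIV ((R a)(rG := of_bool s, rS := v)) \<tau>) d (w (Lit s v))
       (At {i} UNIV UNIV ((R (f a (Lit s v)))(rG := of_bool s, rS := v)) \<tau>)"
    and suf: "suffix xs x"
  shows "hoare (At {ip xs} UNIV UNIV (R a) \<tau>) (While (\<lambda>a s b. a \<noteq> REnd)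
       (read_token c d))
      (concat (map w (toks L xs))) (Any (R (foldl f a (toks L xs))) \<tau>)"
  using suf
\<comment> \<open>A literal consumes all its digits at once, so structural induction on the suffix
  would be too weak.\<close>
proof (induction "length xs" arbitrary: xs a rule: less_induct)
  case less
  let ?b = "(read_token c d)"
  have w: "hoare P (While (\<lambda>a s b. a \<noteq> REnd) ?b) ws (At I UNIV UNIV \<rho> \<tau>) \<Longrightarrow>
     hoare P (While (\<lambda>a s b. a \<noteq> REnd) ?b) ws (Any \<rho> \<tau>)" for P ws I \<rho>
    by (erule h_conseq) (auto simp: At_def)
  show ?case
  proof (cases xs)
    case Nil
    have "hoare (At {ip xs} UNIV UNIV (R a) \<tau>) (While (\<lambda>a s b. a \<noteq> REnd) ?b) [] (At {ip xs} UNIV UNIV (R a) \<tau>)"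
      by (rule h_While_false) (use Nil less.prems in \<open>auto simp: At_holds_in scan_ip\<close>)
    from w[OF this] show ?thesis using Nil by simp
  next
    case (Cons b ys)
    have ys: "suffix ys x" using suffix_tl_input[OF less.prems] Cons by simp
    have go: "At {ip xs} UNIV UNIV (R a) \<tau> s \<Longrightarrow> holds (\<lambda>a s b. a \<noteq> REnd) s" for s
      using less.prems Cons by (simp add: At_holds_in scan_ip)
    have bt: "At {ip xs} UNIV UNIV (R a) \<tau> s \<Longrightarrow> holds (\<lambda>a s b. a = Sym True) s = b" for s
      using less.prems Cons by (simp add: At_holds_in scan_ip)
    have mv: "hoare (At {ip xs} UNIV UNIV (R a) \<tau>) (move_in Go_Right) [] (At {ip ys} UNIV UNIV (R a) \<tau>)"
      using h_iright[OF less.prems] Cons by simp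
    show ?thesis
    proof (cases b)
      case False
      have "hoare (At {ip xs} UNIV UNIV (R a) \<tau>) ?b [] (At {ip ys} UNIV UNIV (R a) \<tau>)"
        by (rule h_Cond[OF bt]) (use False mv in auto)
      from h_While_true[OF go this less.hyps[OF _ ys] refl] show ?thesis using Cons False by simp
    next
      case True
      define b2 where "b2 = (ys \<noteq> [] \<and> hd ys)"
      have bt2: "At {ip ys} UNIV UNIV (R a) \<tau> s \<Longrightarrow> holds (\<lambda>a s b. a = Sym True) s = b2" for s
        using ys by (auto simp: At_holds_in scan_ip b2_def split: list.splits)
      have ys2: "suffix (tl ys) x" using suffix_tl_input[OF ys] .
      have mv2: "hoare (At {ip ys} UNIV UNIV (R a) \<tau>) (move_in Go_Right) [] (At {ip (tl ys)} UNIV UNIV (R a) \<tau>)"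
        using h_iright[OF ys] .
      show ?thesis
      proof (cases b2)
        case b2: True
        have "hoare (At {ip ys} UNIV UNIV (R a) \<tau>) (move_in Go_Right ;; c) (w Cl) (At {ip (tl ys)} UNIV UNIV (R (f a Cl)) \<tau>)"
          by (rule h_Seq[OF mv2 c]) simp
        then have "hoare (At {ip ys} UNIV UNIV (R a) \<tau>) (Cond (\<lambda>a s b. a = Sym True) (move_in Go_Right ;; c)
            (move_in Go_Right ;; read_literal d)) (w Cl) (At {ip (tl ys)} UNIV UNIV (R (f a Cl)) \<tau>)"
          by (intro h_Cond[OF bt2]) (use b2 in auto)
        from h_Seq[OF mv this refl] have "hoare (At {ip xs} UNIV UNIV (R a) \<tau>) ?b (w Cl) (At {ip (tl ys)} UNIV UNIV (R (f a Cl)) \<tau>)"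
          by (intro h_Cond[OF bt]) (use True in auto)
        from h_While_true[OF go this less.hyps[OF _ ys2] refl] show ?thesis
          using Cons True b2 by (simp add: b2_def)
      next
        case b2: False
        define s where "s = (tl (tl ys) \<noteq> [] \<and> hd (tl (tl ys)))"
        define zs where "zs = tl (tl (tl ys))"
        define v where "v = add_digits L 0 0 (digs zs)"
        have vl: "v < 2 ^ L" unfolding v_def by (rule add_digits_less) simp
        have "hoare (At {ip (tl ys)} UNIV UNIV (R a) \<tau>) (read_literal d) (w (Lit s v)) (At {ip (after_digs zs)} UNIV UNIV (R (f a (Lit s v))) \<tau>)"
          by (rule h_read_literal[OF ys2 _ _ _ _ _ _ s_def zs_def v_def d[OF vl]]) (use R in auto)
        from h_Seq[OF mv2 this refl] have "hoare (At {ip ys} UNIV UNIV (R a) \<tau>) (Cond (\<lambda>a s b. a = Sym True) (move_in Go_Right ;; c)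
            (move_in Go_Right ;; read_literal d)) (w (Lit s v)) (At {ip (after_digs zs)} UNIV UNIV (R (f a (Lit s v))) \<tau>)"
          by (intro h_Cond[OF bt2]) (use b2 in auto)
        from h_Seq[OF mv this refl] have b: "hoare (At {ip xs} UNIV UNIV (R a) \<tau>) ?b (w (Lit s v)) (At {ip (after_digs zs)} UNIV UNIV (R (f a (Lit s v))) \<tau>)"
          by (intro h_Cond[OF bt]) (use True in auto)
        have zx: "suffix zs x" unfolding zs_def using suffix_tl_input ys2 by blast
        have sz: "suffix (after_digs zs) x" using suffix_after_digs zx by (rule suffix_order.trans)
        have len: "length (after_digs zs) < length xs"
          using length_after_digs[of zs] Cons by (simp add: zs_def)
        have "toks L xs = Lit s v # toks L (after_digs zs)"
          using Cons True b2 by (simp add: b2_def s_def v_def zs_def)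
        with h_While_true[OF go b less.hyps[OF len sz] refl] show ?thesis by simp
      qed
    qed
  qed
qed

definition ts :: "tok list" where
  "ts = toks L body"

lemma h_for_tokens:
  assumes R: "\<And>a. ok (R a) \<and> R a rS = 0 \<and> R a rG = 0"
    and c: "\<And>i a. hoare (At {i} UNIV UNIV (R a) \<tau>) c (w Cl) (At {i} UNIV UNIV (R (f a Cl)) \<tau>)"
    and d: "\<And>i a s v. v < 2 ^ L \<Longrightarrow> hoare (At {i} UNIV UNIV ((R a)(rG := of_bool s, rS := v)) \<tau>) d (w (Lit s v))
       (At {i} UNIV UNIV ((R (f a (Lit s v)))(rG := of_bool s, rS := v)) \<tau>)"
  shows "hoare (Any (R a) \<tau>) (for_tokens c d)
      (concat (map w ts)) (Any (R (foldl f a ts)) \<tau>)"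
proof -
  have "suffix xs x \<Longrightarrow>
    hoare (At {ip xs} UNIV UNIV \<rho> \<tau>) (While (\<lambda>a s b. a = Sym True) (move_in Go_Right)) []
      (At {ip (dropWhile (\<lambda>b. b) xs)} UNIV UNIV \<rho> \<tau>)" for xs \<rho>
  proof (induction xs)
    case Nil
    show ?case by (simp, rule h_While_false) (use Nil in \<open>auto simp: At_holds_in scan_ip\<close>)
  next
    case (Cons b xs)
    show ?case
    proof (cases b)
      case True
      have m: "hoare (At {ip (b # xs)} UNIV UNIV \<rho> \<tau>) (move_in Go_Right) [] (At {ip xs} UNIV UNIV \<rho> \<tau>)"
        using h_iright[OF Cons.prems] by simp
      have l: "hoare (At {ip xs} UNIV UNIV \<rho> \<tau>) (While (\<lambda>a s b. a = Sym True) (move_in Go_Right)) []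
        (At {ip (dropWhile (\<lambda>b. b) (b # xs))} UNIV UNIV \<rho> \<tau>)"
        using Cons True suffix_tl_input[of "b # xs"] by simp
      show ?thesis
        by (rule h_While_true[OF _ m l]) (use True Cons.prems in \<open>auto simp: At_holds_in scan_ip\<close>)
    next
      case False
      then show ?thesis
        by (simp, intro h_While_false) (use False Cons.prems in \<open>auto simp: At_holds_in scan_ip\<close>)
    qed
  qed
  from this[of x "R a"] have 1: "hoare (At {1} UNIV UNIV (R a) \<tau>) (While (\<lambda>a s b. a = Sym True) (move_in Go_Right)) []
      (At {ip (dropWhile (\<lambda>b. b) x)} UNIV UNIV (R a) \<tau>)" by (simp add: ip_full)
  have 2: "hoare (At {ip (dropWhile (\<lambda>b. b) x)} UNIV UNIV (R a) \<tau>) (move_in Go_Right) [] (At {ip body} UNIV UNIV (R a) \<tau>)"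
    using h_iright[OF suffix_dropWhile] unfolding body_def .
  have sb: "suffix body x" unfolding body_def by (rule suffix_dropWhile_tl)
  show ?thesis
    unfolding for_tokens_def ts_def
    by (rule h_Seq[OF h_istart h_Seq[OF 1 h_Seq[OF 2 h_token_loop[OF R c d sb] refl] refl]]) auto
qed

section \<open>Writing queries and commands\<close>

abbreviation free :: "(nat \<Rightarrow> nat) \<Rightarrow> (nat \<Rightarrow> nat \<Rightarrow> nat) \<Rightarrow> state \<Rightarrow> bool" where
  "free \<rho> g \<equiv> Any \<rho> (T g)"

definition vstr :: "nat list \<Rightarrow> bool option list" where
  "vstr ms = map Some (codes ms)"

lemma vstr_append: "vstr (a @ b) = vstr a @ vstr b"
  by (simp add: vstr_def codes_append)

lemma vstr_Nil [simp]: "vstr [] = []"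
  by (simp add: vstr_def codes_def)

lemma vstr_concat: "vstr (concat (map f xs)) = concat (map (\<lambda>a. vstr (f a)) xs)"
  by (induction xs) (simp_all add: vstr_append)

lemma vstr_replicate: "concat (map (\<lambda>_. vstr [m]) [0..<k]) = vstr (replicate k m)"
  by (simp add: vstr_def codes_replicate map_concat_map)

lemma h_vts: "hoare P (vts ms) (vstr ms) P"
  unfolding vts_def vstr_def by (rule h_em)

lemma h_times_vts:
  assumes "ok \<rho>" "\<rho> rA = 0" "r < tracks" "r \<noteq> rA"
  shows "hoare (At I UNIV J \<rho> \<tau>) (times r (vts [m])) (vstr (replicate (\<rho> r) m)) (At I UNIV J \<rho> \<tau>)"
proof -
  have 1: "hoare (At I UNIV J \<rho> \<tau>) (copy r rA) [] (At I UNIV J (\<rho>(rA := \<rho> r)) \<tau>)"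
    by (rule h_copy) (use assms in auto)
  have 2: "hoare (At I UNIV J (\<rho>(rA := \<rho> r)) \<tau>) (repeat rA (vts [m])) (concat (map (\<lambda>_. vstr [m]) [0..<\<rho> r])) (At I UNIV J (\<rho>(rA := \<rho> r, rA := 0)) \<tau>)"
    by (rule h_repeat) (use assms okD[OF assms(1)] in \<open>auto intro: h_vts\<close>)
  have "\<rho>(rA := 0) = \<rho>" using assms by (simp add: fun_upd_idem)
  then show ?thesis unfolding times_def using h_Seq[OF 1 2 refl] by (simp add: vstr_replicate)
qed

end

lemma qstream_append: "qstream (a @ b) = qstream a @ qstream b"
  by (simp add: qstream_def)

lemma cstream_append: "cstream (a @ b) = cstream a @ cstream b"
  by (simp add: cstream_def qstream_append)

lemma cstream_Nil [simp]: "cstream [] = []"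
  by (simp add: cstream_def qstream_def)

lemma cstream_concat: "cstream (concat (map f xs)) = concat (map (\<lambda>a. cstream (f a)) xs)"
  by (induction xs) (simp_all add: cstream_append)

lemma cstream_one: "cstream [(m, q)] = qstream (replicate m false_query @ [[]]) @ map Some q @ [None]"
  by (simp add: cstream_def cmd_queries_def qstream_def)

lemma cstream_map: "cstream (map f xs) = concat (map (\<lambda>a. cstream [f a]) xs)"
  using cstream_concat[of "\<lambda>a. [f a]" xs] by (simp add: concat_map_singleton)

lemma cstream_replicate: "cstream (replicate k a) = concat (map (\<lambda>_. cstream [a]) [0..<k])"
  using cstream_map[of "\<lambda>_. a" "[0..<k]"] by (simp add: map_replicate_const)

context tape
begin

lemma h_op: "hoare P (op m) (qstream (replicate m false_query @ [[]])) P"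
  unfolding op_def by (rule h_em)

lemma h_known: "hoare P (known m) (cstream [(m, [])]) P"
  unfolding known_def by (rule h_Seq[OF h_op h_out]) (simp add: cstream_one)

lemma h_times:
  assumes "ok \<rho>" "\<rho> rA = 0" "r < tracks" "r \<noteq> rA"
    "\<And>k. k < \<rho> r \<Longrightarrow> hoare (At I UNIV J (\<rho>(rA := k)) \<tau>) c w (At I UNIV J (\<rho>(rA := k)) \<tau>)"
  shows "hoare (At I UNIV J \<rho> \<tau>) (times r c) (concat (map (\<lambda>_. w) [0..<\<rho> r])) (At I UNIV J \<rho> \<tau>)"
proof -
  have 1: "hoare (At I UNIV J \<rho> \<tau>) (copy r rA) [] (At I UNIV J (\<rho>(rA := \<rho> r)) \<tau>)"
    by (rule h_copy) (use assms in auto)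
  have 2: "hoare (At I UNIV J (\<rho>(rA := \<rho> r)) \<tau>) (repeat rA c) (concat (map (\<lambda>_. w) [0..<\<rho> r])) (At I UNIV J (\<rho>(rA := \<rho> r, rA := 0)) \<tau>)"
  proof (rule h_repeat)
    fix k assume "k < \<rho> r"
    then have "\<rho> r - Suc k < \<rho> r" by simp
    from assms(5)[OF this] show "hoare (At I UNIV J (\<rho>(rA := \<rho> r, rA := \<rho> r - Suc k)) \<tau>) c w (At I UNIV J (\<rho>(rA := \<rho> r, rA := \<rho> r - Suc k)) \<tau>)"
      by simp
  qed (use assms okD[OF assms(1)] in auto)
  have "\<rho>(rA := 0) = \<rho>" using assms by (simp add: fun_upd_idem)
  then show ?thesis unfolding times_def using h_Seq[OF 1 2 refl] by simp
qed

lemma cleanD: "clean \<rho> \<Longrightarrow> ok \<rho>" "clean \<rho> \<Longrightarrow> \<rho> rA = 0" "clean \<rho> \<Longrightarrow> \<rho> rB = 0"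
  "clean \<rho> \<Longrightarrow> \<rho> rS = 0" "clean \<rho> \<Longrightarrow> \<rho> rW = 0" "clean \<rho> \<Longrightarrow> \<rho> rG = 0"
  by (auto simp: clean_def)

lemma clean_upd: "clean \<rho> \<Longrightarrow> v < Bk \<Longrightarrow> r \<notin> {rA, rB, rS, rW, rG} \<Longrightarrow> clean (\<rho>(r := v))"
  by (auto simp: clean_def)

lemma h_formula:
  assumes "clean \<rho>"
  shows "hoare (free \<rho> g) formula (vstr (concat (map formula_vtoks ts) @ [5])) (free \<rho> g)"
proof -
  note cl = cleanD[OF assms]
  have L1: "(1::nat) < Bk" using one_less_power[of "2::nat" L] L_pos by simp
  have "hoare (free ((\<lambda>_::unit. \<rho>) ()) g) (for_tokens (vts [5, 0])
     emit_literal) (concat (map (\<lambda>t. vstr (formula_vtoks t)) ts)) (free ((\<lambda>_::unit. \<rho>) (foldl (\<lambda>_ _. ()) () ts)) g)"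
  proof (rule h_for_tokens)
    fix i a
    show "hoare (At {i} UNIV UNIV \<rho> (T g)) (vts [5, 0]) (vstr (formula_vtoks Cl)) (At {i} UNIV UNIV \<rho> (T g))"
      using h_vts[of _ "[5, 0]"] by simp
  next
    fix i a s v assume v: "v < Bk"
    let ?\<rho> = "\<rho>(rG := of_bool s, rS := v)"
    have okp: "ok ?\<rho>" using cl v L1 by (cases s) auto
    have 1: "hoare (At {i} UNIV UNIV ?\<rho> (T g)) (times rS (vts [m])) (vstr (replicate v m)) (At {i} UNIV UNIV ?\<rho> (T g))" for m
      using h_times_vts[of ?\<rho> rS "{i}" UNIV "T g" m] okp cl by simp
    have 2: "hoare (At {i} UNIV UNIV ?\<rho> (T g)) (scan_work (\<lambda>t. \<not> bit t rG) ;; Cond (\<lambda>a s b. s \<noteq> REnd) (vts [3]) (vts [4]))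
       (vstr [if s then 3 else 4]) (At {i} UNIV UNIV ?\<rho> (T g))"
    proof (rule h_Cond_Test)
      show "hoare (At {i} UNIV UNIV ?\<rho> (T g)) (scan_work (\<lambda>t. \<not> bit t rG)) []
         (\<lambda>st. At {i} UNIV UNIV ?\<rho> (T g) st \<and> holds (\<lambda>a s b. s \<noteq> REnd) st = s)"
        using test_zero[OF okp, of rG "{i}" UNIV "T g"] by (cases s) auto
    qed (use h_vts in auto)
    show "hoare (At {i} UNIV UNIV ?\<rho> (T g)) emit_literal (vstr (formula_vtoks (Lit s v))) (At {i} UNIV UNIV ?\<rho> (T g))"
      by (rule h_Seq[OF h_vts h_Seq[OF 1 h_Seq[OF 2 h_Seq[OF h_vts 1 refl] refl] refl]])
        (simp add: vstr_def codes_def)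
  qed (use cl in auto)
  then show ?thesis
    unfolding formula_def by (intro h_Seq[OF _ h_vts]) (auto simp: vstr_append vstr_concat)
qed

lemma h_thresholds:
  assumes "clean \<rho>"
  shows "hoare (free \<rho> g) thresholds (vstr (replicate (\<rho> rU * Bk + \<rho> rV) 0)) (free \<rho> g)"
proof -
  note cl = cleanD[OF assms]
  have 1: "hoare (free \<rho> g) (times rU (for_all rB (vts [0]))) (concat (map (\<lambda>_. vstr (replicate Bk 0)) [0..<\<rho> rU])) (free \<rho> g)"
  proof (rule h_times)
    fix k assume "k < \<rho> rU"
    then have k: "k < Bk" using okD[OF cl(1), of rU] by simp
    have "hoare (free (\<rho>(rA := k)) g) (for_all rB (vts [0])) (concat (map (\<lambda>_. vstr [0]) [0..<Bk])) (free (\<rho>(rA := k)) g)"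
      by (rule h_for_all) (use cl k h_vts in auto)
    then show "hoare (free (\<rho>(rA := k)) g) (for_all rB (vts [0])) (vstr (replicate Bk 0)) (free (\<rho>(rA := k)) g)"
      by (simp add: vstr_replicate)
  qed (use cl in auto)
  have "concat (map (\<lambda>_. vstr (replicate Bk 0)) [0..<u]) = vstr (replicate (u * Bk) 0)" for u
    by (induction u) (simp_all add: vstr_append[symmetric] replicate_add[symmetric] add.commute)
  with 1 h_times_vts[of \<rho> rV UNIV UNIV "T g" 0] cl show ?thesis
    unfolding thresholds_def by (intro h_Seq) (auto simp: vstr_append[symmetric] replicate_add[symmetric])
qed

definition slot_weight :: "(nat \<Rightarrow> nat) \<Rightarrow> (nat \<Rightarrow> nat \<Rightarrow> nat) \<Rightarrow> nat \<Rightarrow> nat" where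
  "slot_weight \<rho> g S = (if S = \<rho> rJ then \<rho> rC else g (\<rho> rI) S)"

lemma h_weights:
  assumes "clean \<rho>" "okg g"
  shows "hoare (free \<rho> g) weights
    (vstr (concat (map (\<lambda>k. 1 # replicate (slot_weight \<rho> g (Suc k)) 3) [0..<\<rho> rN]) @ [5] @ replicate (\<rho> rN) 2)) (free \<rho> g)"
proof -
  note cl = cleanD[OF assms(1)]
  let ?I = "\<rho> rI" and ?n = "\<rho> rN"
  have b: "?I < Bk" "?n < Bk" "\<rho> rC < Bk" using okD[OF cl(1)] by auto
  have 1: "hoare (free \<rho> g) (goto rI) [] (At UNIV UNIV {pos ?I 0} \<rho> (T g))"
    by (rule h_goto) (use cl in auto)
  have 2: "hoare (At UNIV UNIV {pos ?I 0} \<rho> (T g)) skip_slot [] (At UNIV UNIV {pos ?I (Suc 0)} \<rho> (T g))"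
    using h_skip[of "pos ?I 0" "T g" UNIV \<rho>] pos_le[of ?I "Suc 0"] b by (simp add: pos_Suc)
  have 3: "hoare (At UNIV UNIV {pos ?I (Suc 0)} \<rho> (T g)) (for_upto rS rN emit_weight) (concat (map (\<lambda>k. vstr (1 # replicate (slot_weight \<rho> g (Suc k)) 3)) [0..<?n])) (At UNIV UNIV {pos ?I (Suc ?n)} \<rho> (T g))"
  proof (rule h_for_upto)
    fix k assume k: "k < ?n"
    let ?\<rho> = "\<rho>(rS := Suc k)"
    let ?J = "{pos ?I (Suc (Suc k))}"
    let ?w = "slot_weight \<rho> g (Suc k)"
    have okp: "ok ?\<rho>" using cl k b by simp
    have gl: "g ?I (Suc k) < Bk" using assms(2) by (simp add: okg_def)
    have wl: "?w < Bk" using gl b by (simp add: slot_weight_def)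
    have a: "hoare (At UNIV UNIV {pos ?I (Suc k)} ?\<rho> (T g)) (load rW) [] (At UNIV UNIV ?J (?\<rho>(rW := g ?I (Suc k))) (T g))"
      by (rule h_load_slot) (use okp assms(2) b k in auto)
    have c: "hoare (At UNIV UNIV ?J (?\<rho>(rW := g ?I (Suc k))) (T g))
       (scan_work (\<lambda>t. bit t rS = bit t rJ) ;; Cond (\<lambda>a s b. s \<noteq> REnd) Skip (copy rC rW)) []
       (At UNIV UNIV ?J (?\<rho>(rW := ?w)) (T g))"
    proof (rule h_Cond_Test)
      show "hoare (At UNIV UNIV ?J (?\<rho>(rW := g ?I (Suc k))) (T g)) (scan_work (\<lambda>t. bit t rS = bit t rJ)) []
         (\<lambda>s. At UNIV UNIV ?J (?\<rho>(rW := g ?I (Suc k))) (T g) s \<and> holds (\<lambda>a s b. s \<noteq> REnd) s = (Suc k \<noteq> \<rho> rJ))"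
        using test_neq[of "?\<rho>(rW := g ?I (Suc k))" rS rJ UNIV ?J "T g"] okp gl by simp
    next
      assume "Suc k \<noteq> \<rho> rJ"
      then show "hoare (At UNIV UNIV ?J (?\<rho>(rW := g ?I (Suc k))) (T g)) Skip [] (At UNIV UNIV ?J (?\<rho>(rW := ?w)) (T g))"
        using h_Skip by (simp add: slot_weight_def)
    next
      assume "\<not> Suc k \<noteq> \<rho> rJ"
      then show "hoare (At UNIV UNIV ?J (?\<rho>(rW := g ?I (Suc k))) (T g)) (copy rC rW) [] (At UNIV UNIV ?J (?\<rho>(rW := ?w)) (T g))"
        using h_copy[of "?\<rho>(rW := g ?I (Suc k))" rC rW UNIV ?J "T g"] okp gl by (simp add: slot_weight_def)
    qed
    have d: "hoare (At UNIV UNIV ?J (?\<rho>(rW := ?w)) (T g)) (repeat rW (vts [3])) (concat (map (\<lambda>_. vstr [3]) [0..<?w])) (At UNIV UNIV ?J (?\<rho>(rW := ?w, rW := 0)) (T g))"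
      by (rule h_repeat) (use okp wl h_vts in auto)
    have "?\<rho>(rW := ?w, rW := 0) = ?\<rho>" using cl by (simp add: fun_upd_idem)
    with d have d': "hoare (At UNIV UNIV ?J (?\<rho>(rW := ?w)) (T g)) (repeat rW (vts [3])) (vstr (replicate ?w 3)) (At UNIV UNIV ?J ?\<rho> (T g))"
      by (simp add: vstr_replicate)
    show "hoare (At UNIV UNIV {pos ?I (Suc k)} ?\<rho> (T g)) emit_weight (vstr (1 # replicate ?w 3)) (At UNIV UNIV ?J ?\<rho> (T g))"
      by (rule h_Seq[OF h_vts h_Seq[OF a h_Seq[OF c d' refl] refl]]) (simp add: vstr_def codes_def)
  qed (use cl in auto)
  have w3: "hoare (At UNIV UNIV {pos ?I (Suc 0)} \<rho> (T g)) (for_upto rS rN emit_weight) (vstr (concat (map (\<lambda>k. 1 # replicate (slot_weight \<rho> g (Suc k)) 3) [0..<?n]))) (free \<rho> g)"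
    using 3 by (rule h_conseq) (auto simp: At_def vstr_concat)
  have 4: "hoare (free \<rho> g) (times rN (vts [2])) (vstr (replicate ?n 2)) (free \<rho> g)"
    by (rule h_times_vts) (use cl in auto)
  show ?thesis
    unfolding weights_def
    by (rule h_Seq[OF 1 h_Seq[OF 2 h_Seq[OF w3 h_Seq[OF h_vts 4 refl] refl] refl]])
      (simp add: vstr_def codes_def)
qed

definition qry :: "nat \<Rightarrow> (nat \<Rightarrow> nat) \<Rightarrow> nat \<Rightarrow> nat \<Rightarrow> bool \<Rightarrow> bool list" where
  "qry n w J v c = codes (vquery ts n w v J c)"

lemma h_query:
  assumes "clean \<rho>" "okg g"
  shows "hoare (free \<rho> g) (query c)
    (map Some (qry (\<rho> rN) (slot_weight \<rho> g) (\<rho> rJ) (\<rho> rU * Bk + \<rho> rV) c) @ [None]) (free \<rho> g)"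
proof -
  note cl = cleanD[OF assms(1)]
  have 1: "hoare (free \<rho> g) (times rJ (vts [1])) (vstr (replicate (\<rho> rJ) 1)) (free \<rho> g)"
    by (rule h_times_vts) (use cl in auto)
  have 2: "hoare (free \<rho> g) (constraint c) (vstr ([0] @ replicate (\<rho> rJ) 1 @ [if c then 3 else 4, 5])) (free \<rho> g)"
    unfolding constraint_def by (rule h_Seq[OF h_vts h_Seq[OF 1 h_vts refl]]) (simp only: vstr_append)
  show ?thesis
    unfolding query_def
    by (rule h_Seq[OF h_formula[OF assms(1)] h_Seq[OF h_thresholds[OF assms(1)] h_Seq[OF h_weights[OF assms] h_Seq[OF 2 h_out refl] refl] refl]])
      (simp add: qry_def vquery_def vstr_def codes_def)
qed

text \<open>Command 0 resets the comparison; then both values are asked for every threshold below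
  \<open>2 ^ L * 2 ^ L\<close>, which exceeds every total weight.\<close>

definition testc :: "nat \<Rightarrow> (nat \<Rightarrow> nat) \<Rightarrow> nat \<Rightarrow> cmd list" where
  "testc n w J = [(0, [])] @ concat (map (\<lambda>U. concat (map (\<lambda>V.
     [(1, qry n w J (U * Bk + V) False), (2, qry n w J (U * Bk + V) True)]) [0..<Bk])) [0..<Bk])"

lemma h_test:
  assumes "clean \<rho>" "okg g" "\<rho> rU = 0" "\<rho> rV = 0"
  shows "hoare (free \<rho> g) test (cstream (testc (\<rho> rN) (slot_weight \<rho> g) (\<rho> rJ))) (free \<rho> g)"
proof -
  note cl = cleanD[OF assms(1)]
  let ?q = "qry (\<rho> rN) (slot_weight \<rho> g) (\<rho> rJ)"
  have "hoare (free \<rho> g) (for_all rU (for_all rV (op 1 ;; query False ;; op 2 ;; query True)))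
    (concat (map (\<lambda>U. concat (map (\<lambda>V. cstream [(1, ?q (U * Bk + V) False), (2, ?q (U * Bk + V) True)]) [0..<Bk])) [0..<Bk])) (free \<rho> g)"
  proof (rule h_for_all)
    fix U assume U: "U < Bk"
    show "hoare (free (\<rho>(rU := U)) g) (for_all rV (op 1 ;; query False ;; op 2 ;; query True))
      (concat (map (\<lambda>V. cstream [(1, ?q (U * Bk + V) False), (2, ?q (U * Bk + V) True)]) [0..<Bk])) (free (\<rho>(rU := U)) g)"
    proof (rule h_for_all)
      fix V assume V: "V < Bk"
      let ?\<rho> = "\<rho>(rU := U, rV := V)"
      have cl': "clean ?\<rho>" using assms(1) U V by (intro clean_upd) auto
      have sw: "slot_weight ?\<rho> g = slot_weight \<rho> g" by (rule ext) (simp add: slot_weight_def)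
      have q: "hoare (free ?\<rho> g) (query c) (map Some (?q (U * Bk + V) c) @ [None]) (free ?\<rho> g)" for c
        using h_query[OF cl' assms(2), of c] sw by simp
      show "hoare (free ?\<rho> g) (op 1 ;; query False ;; op 2 ;; query True) (cstream [(1, ?q (U * Bk + V) False), (2, ?q (U * Bk + V) True)]) (free ?\<rho> g)"
        by (rule h_Seq[OF h_op h_Seq[OF q h_Seq[OF h_op q refl] refl]])
          (simp add: cstream_def cmd_queries_def qstream_def)
    qed (use cl assms U in auto)
  qed (use cl assms in auto)
  then show ?thesis
    unfolding test_def testc_def
    by (rule h_Seq[OF h_known]) (simp only: cstream_append cstream_concat)
qed

definition ins :: "nat \<Rightarrow> nat \<Rightarrow> nat \<Rightarrow> nat \<Rightarrow> nat \<Rightarrow> nat \<Rightarrow> nat \<Rightarrow> nat" where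
  "ins I J v v' X Y k = (if X \<noteq> I then 8 else if Y = 0 then (if bit v k then 10 else 9)
     else if Y \<noteq> J then 8 else if bit v' k then 10 else 9)"

definition ovrc :: "nat \<Rightarrow> nat \<Rightarrow> nat \<Rightarrow> nat \<Rightarrow> cmd list" where
  "ovrc I J v v' = replicate L (8, []) @
     concat (map (\<lambda>X. concat (map (\<lambda>Y. map (\<lambda>k. (ins I J v v' X Y k, [])) [0..<L]) [0..<Bk])) [0..<Bk]) @
     replicate (length \<tau>0 - Bk * Bk * L) (8, [])"

lemma h_slot_cells:
  assumes "j + L \<le> length \<tau> + 1" "\<And>k. k < L \<Longrightarrow> hoare (At I {k + 1} {j + k} \<rho> \<tau>) c (w k) (At I {k + 1} {j + k} \<rho> \<tau>)"
  shows "hoare (At I UNIV {j} \<rho> \<tau>) (for_cells (c ;; move_cat Go_Right)) (concat (map w [0..<L])) (At I UNIV {j + L} \<rho> \<tau>)"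
proof -
  have "hoare (At I UNIV {j + 0} \<rho> \<tau>) (for_cells (c ;; move_cat Go_Right)) (concat (map w [0..<L])) (At I UNIV {j + L} \<rho> \<tau>)"
  proof (rule h_for_cells)
    fix k assume k: "k < L"
    show "hoare (At I {k + 1} {j + k} \<rho> \<tau>) (c ;; move_cat Go_Right) (w k) (At I {k + 1} {j + Suc k} \<rho> \<tau>)"
      by (rule h_Seq[OF assms(2)[OF k]], rule h_weaken[OF h_move_cat]) (use k assms(1) in auto)
  qed
  then show ?thesis by simp
qed

lemma h_keep_slot:
  assumes "j + L \<le> length \<tau> + 1"
  shows "hoare (At I UNIV {j} \<rho> \<tau>) keep_slot (cstream (map (\<lambda>k. (8, [])) [0..<L])) (At I UNIV {j + L} \<rho> \<tau>)"
  unfolding keep_slot_def cstream_map by (rule h_slot_cells[OF assms h_known])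

lemma h_set_slot:
  assumes "j + L \<le> length \<tau> + 1" "r < tracks"
  shows "hoare (At I UNIV {j} \<rho> \<tau>) (set_slot r) (cstream (map (\<lambda>k. (if bit (\<rho> r) k then 10 else 9, [])) [0..<L])) (At I UNIV {j + L} \<rho> \<tau>)"
  unfolding set_slot_def cstream_map
proof (rule h_slot_cells[OF assms(1)])
  fix k assume k: "k < L"
  show "hoare (At I {k + 1} {j + k} \<rho> \<tau>) (Cond (\<lambda>a s b. on_sym (\<lambda>t. bit t r) s) (known 10) (known 9))
     (cstream [(if bit (\<rho> r) k then 10 else 9, [])]) (At I {k + 1} {j + k} \<rho> \<tau>)"
    by (rule h_Cond[where b = "bit (\<rho> r) k"])
      (use k assms(2) h_known in \<open>auto simp: At_holds_work scan_enc on_sym_def bit_symb\<close>)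
qed

lemma h_overwrite:
  assumes "clean \<rho>" "\<rho> rU = 0" "\<rho> rV = 0" "r < tracks" "r' < tracks" "r \<notin> {rU, rV}" "r' \<notin> {rU, rV}"
  shows "hoare (free \<rho> g) (overwrite r r') (cstream (ovrc (\<rho> rI) (\<rho> rJ) (\<rho> r) (\<rho> r'))) (free \<rho> g)"
proof -
  note cl = cleanD[OF assms(1)]
  let ?i = "ins (\<rho> rI) (\<rho> rJ) (\<rho> r) (\<rho> r')"
  have "hoare (At UNIV UNIV {pos 0 0} \<rho> (T g)) (for_cells (known 8)) (concat (map (\<lambda>k. cstream [(8, [])]) [0..<L])) (At UNIV UNIV {pos 0 0} \<rho> (T g))"
    by (rule h_for_cells) (rule h_known)
  then have 1: "hoare (At UNIV UNIV {1} \<rho> (T g)) (for_cells (known 8)) (cstream (replicate L (8, []))) (At UNIV UNIV {pos 0 0} \<rho> (T g))"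
    by (simp add: cstream_replicate pos_def)
  have 2: "hoare (At UNIV UNIV {pos 0 0} \<rho> (T g)) (for_all rU (for_all rV
      (overwrite_slot r r')))
     (concat (map (\<lambda>X. concat (map (\<lambda>Y. cstream (map (\<lambda>k. (?i X Y k, [])) [0..<L])) [0..<Bk])) [0..<Bk]))
     (At UNIV UNIV {pos Bk 0} \<rho> (T g))"
  proof (rule h_for_all)
    fix X :: nat assume X: "X < Bk"
    have "hoare (At UNIV UNIV {pos X 0} (\<rho>(rU := X)) (T g)) (for_all rV
      (overwrite_slot r r'))
      (concat (map (\<lambda>Y. cstream (map (\<lambda>k. (?i X Y k, [])) [0..<L])) [0..<Bk]))
      (At UNIV UNIV {pos X Bk} (\<rho>(rU := X)) (T g))"
    proof (rule h_for_all)
      fix Y :: nat assume Y: "Y < Bk"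
      let ?\<rho> = "\<rho>(rU := X, rV := Y)"
      have okp: "ok ?\<rho>" using cl X Y by simp
      have p: "pos X Y + L \<le> length (T g) + 1" using pos_le[of X "Suc Y"] X Y by (simp add: pos_Suc)
      let ?P = "At UNIV UNIV {pos X Y} ?\<rho> (T g)" and ?Q = "At UNIV UNIV {pos X (Suc Y)} ?\<rho> (T g)"
      let ?w = "cstream (map (\<lambda>k. (?i X Y k, [])) [0..<L])"
      have keep: "hoare ?P keep_slot (cstream (map (\<lambda>k. (8, [])) [0..<L])) ?Q"
        using h_keep_slot[OF p, of UNIV ?\<rho>] by (simp add: pos_Suc)
      have set: "hoare ?P (set_slot r'') (cstream (map (\<lambda>k. (if bit (\<rho> r'') k then 10 else 9, [])) [0..<L])) ?Q"
        if "r'' < tracks" "r'' \<notin> {rU, rV}" for r''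
        using h_set_slot[OF p that(1), of UNIV ?\<rho>] that by (simp add: pos_Suc)
      show "hoare ?P (overwrite_slot r r') ?w ?Q"
      proof (rule h_Cond_Test)
        show "hoare ?P (scan_work (\<lambda>t. bit t rU = bit t rI)) [] (\<lambda>s. ?P s \<and> holds (\<lambda>a s b. s \<noteq> REnd) s = (X \<noteq> \<rho> rI))"
          using test_neq[OF okp, of rU rI UNIV "{pos X Y}" "T g"] by simp
      next
        assume "X \<noteq> \<rho> rI"
        then show "hoare ?P keep_slot ?w ?Q" using keep by (simp add: ins_def)
      next
        assume XI: "\<not> X \<noteq> \<rho> rI"
        show "hoare ?P (scan_work (\<lambda>t. \<not> bit t rV) ;; Cond (\<lambda>a s b. s \<noteq> REnd)
          (scan_work (\<lambda>t. bit t rV = bit t rJ) ;; Cond (\<lambda>a s b. s \<noteq> REnd) keep_slot (set_slot r'))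
          (set_slot r)) ?w ?Q"
        proof (rule h_Cond_Test)
          show "hoare ?P (scan_work (\<lambda>t. \<not> bit t rV)) [] (\<lambda>s. ?P s \<and> holds (\<lambda>a s b. s \<noteq> REnd) s = (Y \<noteq> 0))"
            using test_zero[OF okp, of rV UNIV "{pos X Y}" "T g"] by simp
        next
          assume "\<not> Y \<noteq> 0"
          then show "hoare ?P (set_slot r) ?w ?Q" using set[of r] assms XI by (simp add: ins_def)
        next
          assume Y0: "Y \<noteq> 0"
          show "hoare ?P (scan_work (\<lambda>t. bit t rV = bit t rJ) ;; Cond (\<lambda>a s b. s \<noteq> REnd) keep_slot (set_slot r')) ?w ?Q"
          proof (rule h_Cond_Test)
            show "hoare ?P (scan_work (\<lambda>t. bit t rV = bit t rJ)) [] (\<lambda>s. ?P s \<and> holds (\<lambda>a s b. s \<noteq> REnd) s = (Y \<noteq> \<rho> rJ))"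
              using test_neq[OF okp, of rV rJ UNIV "{pos X Y}" "T g"] by simp
          next
            assume "Y \<noteq> \<rho> rJ"
            then show "hoare ?P keep_slot ?w ?Q" using keep XI Y0 by (simp add: ins_def)
          next
            assume "\<not> Y \<noteq> \<rho> rJ"
            then show "hoare ?P (set_slot r') ?w ?Q" using set[of r'] assms XI Y0 by (simp add: ins_def)
          qed
        qed
      qed
    qed (use cl assms X in auto)
    then show "hoare (At UNIV UNIV {pos X 0} (\<rho>(rU := X)) (T g)) (for_all rV
      (overwrite_slot r r'))
      (concat (map (\<lambda>Y. cstream (map (\<lambda>k. (?i X Y k, [])) [0..<L])) [0..<Bk]))
      (At UNIV UNIV {pos (Suc X) 0} (\<rho>(rU := X)) (T g))"
      by (simp add: pos_Bk)
  qed (use cl assms in auto)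
  let ?m = "length \<tau>0 - Bk * Bk * L"
  \<comment> \<open>The cells behind the last block belong to no slot, but they have to be rotated
    too for the ring to close.\<close>
  have "hoare (At UNIV UNIV {pos Bk 0 + 0} \<rho> (T g)) (While (\<lambda>a s b. b \<noteq> REnd) (known 8 ;; move_cat Go_Right))
     (concat (map (\<lambda>k. cstream [(8, [])]) [0..<?m])) (At UNIV UNIV {pos Bk 0 + ?m} \<rho> (T g))"
  proof (rule h_While)
    fix k assume k: "k < ?m"
    show "hoare (At UNIV UNIV {pos Bk 0 + k} \<rho> (T g)) (known 8 ;; move_cat Go_Right) (cstream [(8, [])]) (At UNIV UNIV {pos Bk 0 + Suc k} \<rho> (T g))"
      by (rule h_Seq[OF h_known], rule h_weaken[OF h_move_cat]) (use k in \<open>auto simp: pos_def\<close>)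
  qed (use long in \<open>auto simp: At_holds_cat scan_def pos_def\<close>)
  then have 3: "hoare (At UNIV UNIV {pos Bk 0} \<rho> (T g)) (While (\<lambda>a s b. b \<noteq> REnd) (known 8 ;; move_cat Go_Right))
     (cstream (replicate ?m (8, []))) (free \<rho> g)"
    by (rule h_conseq) (auto simp: At_def cstream_replicate)
  show ?thesis
    unfolding overwrite_def ovrc_def
    by (rule h_Seq[OF h_cstart h_Seq[OF 1 h_Seq[OF 2 3 refl] refl]])
      (simp add: cstream_append cstream_concat)
qed

abbreviation (input) search_block :: "(nat \<Rightarrow> nat \<Rightarrow> nat) \<Rightarrow> nat \<Rightarrow> cmd list" where
  "search_block g I \<equiv> concat (map (\<lambda>k. testc num_vars (g I) (Suc k) @ [(3, [])]) [0..<num_vars]) @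
       concat (map (\<lambda>k. testc num_vars (g I) (Suc k) @ [(4, [])]) [0..<num_vars]) @ [(5, [])]"

abbreviation (input) compress_block :: "(nat \<Rightarrow> nat \<Rightarrow> nat) \<Rightarrow> nat \<Rightarrow> cmd list" where
  "compress_block g I \<equiv> concat (map (\<lambda>k. testc num_vars (g I) (Suc k) @ [(7, [])] @ ovrc I (Suc k) (Suc k) (g I 0)) [0..<num_vars])"

text \<open>A function of the tape before the round, since no answer is known while it is written.
  Tests therefore always refer to the old weights, even after earlier commands have overwritten some
  of them.\<close>

definition cmds1 :: "(nat \<Rightarrow> nat \<Rightarrow> nat) \<Rightarrow> cmd list" where
  "cmds1 g = concat (map (\<lambda>I.
       (search_block g I)) [0..<Bk]) @
     concat (map (\<lambda>I. [(6, [])] @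
       (compress_block g I))
       [0..<Bk])"

abbreviation (input) restore_cmds :: "nat \<Rightarrow> nat \<Rightarrow> nat \<Rightarrow> (nat \<Rightarrow> nat) \<Rightarrow> nat \<Rightarrow> cmd list" where
  "restore_cmds I j v w C \<equiv> [(6, [])] @ testc num_vars (w(j := C)) j @ [(7, [])] @ ovrc I j v C"

definition cmds2 :: "(nat \<Rightarrow> nat \<Rightarrow> nat) \<Rightarrow> cmd list" where
  "cmds2 g = concat (map (\<lambda>I. let j = take_bit (L - 1) (g I 0) in
       concat (map (\<lambda>C. [(6, [])] @ testc num_vars ((g I)(j := C)) j @ [(7, [])] @ ovrc I j (g I j) C) [0..<Bk]))
     [0..<Bk])"

end

section \<open>The three programs\<close>

text \<open>Skipping the spare slot and stepping back once reaches its last cell. As numbers are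
  stored with the least significant bit first, this is the top bit.\<close>

definition goto_bit :: "nat \<Rightarrow> com" where
  "goto_bit r = goto r ;; skip_slot ;; move_cat Go_Left"

abbreviation (input) eval_end :: com where
  "eval_end \<equiv> scan_work (\<lambda>t. \<not> bit t rP) ;; Cond (\<lambda>a s b. s \<noteq> REnd) (set_one rF) Skip"

abbreviation (input) eval_clause :: com where
  "eval_clause \<equiv> eval_end ;; set_one rP"

abbreviation (input) eval_sign :: com where
  "eval_sign \<equiv> scan_work (\<lambda>t. \<not> bit t rG) ;; Cond (\<lambda>a s b. s \<noteq> REnd)
          (Cond (\<lambda>a s b. b = Sym True) (zero rP) Skip) (Cond (\<lambda>a s b. b = Sym True) Skip (zero rP))"

definition evaluate :: com where
  "evaluate = zero rP ;; zero rF ;;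
     for_tokens
       eval_clause
       (goto_bit rS ;; eval_sign) ;;
     eval_end"

text \<open>A binary increment with one bit per block; \<open>rS\<close> follows the carry through
  the blocks.\<close>

definition next_assignment :: com where
  "next_assignment = goto_bit rS ;;
     While (\<lambda>a s b. b = Sym True) (Cat_Write False ;; inc rS ;; goto_bit rS) ;; Cat_Write True ;; zero rS"

definition brute_force :: com where
  "brute_force = count_vars ;; evaluate ;;
     While_Test (scan_work (\<lambda>t. \<not> bit t rF)) (\<lambda>a s b. s \<noteq> REnd) (next_assignment ;; evaluate) ;;
     zero rP ;;
     for_upto rJ rN (copy rJ rS ;; dec rS ;; goto_bit rS ;;
       Cond (\<lambda>a s b. b = Sym True) (out (Some True)) (out (Some False)) ;; zero rS) ;;
     zero rN"

text \<open>The pair says whether the current clause still lacks a true literal and whether an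
  earlier clause has failed. A clause is judged only when the next one opens, so the last one has to
  be judged by the final state.\<close>

fun estep :: "(nat \<Rightarrow> bool) \<Rightarrow> bool \<times> bool \<Rightarrow> tok \<Rightarrow> bool \<times> bool" where
  "estep y (p, f) Cl = (True, f \<or> p)"
| "estep y (p, f) (Lit s v) = (p \<and> y v \<noteq> s, f)"

definition accepts :: "(nat \<Rightarrow> bool) \<Rightarrow> tok list \<Rightarrow> bool" where
  "accepts y ts = (foldl (estep y) (False, False) ts = (False, False))"

section \<open>Correctness of the two query programs\<close>

context tape
begin

lemma h_load_free:
  assumes "ok \<rho>" "r < tracks" "okg g" "I < Bk" "S < Bk"
  shows "hoare (At UNIV UNIV {pos I S} \<rho> (T g)) (load r) [] (free (\<rho>(r := g I S)) g)"
  by (rule h_weaken[OF h_load_slot]) (use assms in auto)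

lemma ok_zero [simp]: "ok (\<lambda>_. 0)"
  by (simp add: ok_def)

lemma clean_zero [simp]: "clean (\<lambda>_. 0)"
  by (simp add: clean_def)

lemma h_zero_restore:
  "ok \<rho> \<Longrightarrow> r < tracks \<Longrightarrow> \<rho> r = 0 \<Longrightarrow> v < Bk \<Longrightarrow> hoare (At I UNIV J (\<rho>(r := v)) \<tau>) (zero r) [] (At I UNIV J \<rho> \<tau>)"
  using h_zero[of "\<rho>(r := v)" r I J \<tau>] by (simp add: fun_upd_idem)

lemma h_test_variable:
  assumes "clean \<rho>" "okg g" "\<rho> rU = 0" "\<rho> rV = 0" "\<rho> rC = 0"
  shows "hoare (free \<rho> g) (test_variable m)
    (cstream (testc (\<rho> rN) (g (\<rho> rI)) (\<rho> rJ) @ [(m, [])])) (free \<rho> g)"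
proof -
  note cl = cleanD[OF assms(1)]
  let ?v = "g (\<rho> rI) (\<rho> rJ)"
  have b: "\<rho> rI < Bk" "\<rho> rJ < Bk" "?v < Bk" using okD[OF cl(1)] assms(2) by (auto simp: okg_def)
  have 1: "hoare (free \<rho> g) (goto_slot rI rJ) [] (At UNIV UNIV {pos (\<rho> rI) (\<rho> rJ)} \<rho> (T g))"
    by (rule h_goto_slot) (use cl in auto)
  have 2: "hoare (At UNIV UNIV {pos (\<rho> rI) (\<rho> rJ)} \<rho> (T g)) (load rC) [] (free (\<rho>(rC := ?v)) g)"
    by (rule h_load_free) (use cl assms b in auto)
  have cl': "clean (\<rho>(rC := ?v))" using assms(1) b by (intro clean_upd) auto
  have sw: "slot_weight (\<rho>(rC := ?v)) g = g (\<rho> rI)" by (rule ext) (simp add: slot_weight_def)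
  have 3: "hoare (free (\<rho>(rC := ?v)) g) test (cstream (testc (\<rho> rN) (g (\<rho> rI)) (\<rho> rJ))) (free (\<rho>(rC := ?v)) g)"
    using h_test[OF cl' assms(2)] sw assms by simp
  have 4: "hoare (free (\<rho>(rC := ?v)) g) (zero rC) [] (free \<rho> g)"
    by (rule h_zero_restore) (use cl assms b in auto)
  show ?thesis
    by (rule h_Seq[OF 1 h_Seq[OF 2 h_Seq[OF 3 h_Seq[OF h_known 4 refl] refl] refl]])
      (simp only: cstream_append append_Nil append_Nil2)
qed

lemma h_compress_variable:
  assumes "clean \<rho>" "okg g" "\<rho> rU = 0" "\<rho> rV = 0" "\<rho> rC = 0" "\<rho> rH = 0"
  shows "hoare (free \<rho> g) compress_variable
    (cstream (testc (\<rho> rN) (g (\<rho> rI)) (\<rho> rJ) @ [(7, [])] @ ovrc (\<rho> rI) (\<rho> rJ) (\<rho> rJ) (g (\<rho> rI) 0))) (free \<rho> g)"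
proof -
  note cl = cleanD[OF assms(1)]
  let ?v = "g (\<rho> rI) (\<rho> rJ)" and ?h = "g (\<rho> rI) 0"
  let ?\<rho> = "\<rho>(rH := ?h, rC := ?v)"
  have b: "\<rho> rI < Bk" "\<rho> rJ < Bk" "?v < Bk" "?h < Bk" using okD[OF cl(1)] assms(2) by (auto simp: okg_def)
  have 1: "hoare (free \<rho> g) (goto_slot rI rJ) [] (At UNIV UNIV {pos (\<rho> rI) (\<rho> rJ)} \<rho> (T g))"
    by (rule h_goto_slot) (use cl in auto)
  have 2: "hoare (At UNIV UNIV {pos (\<rho> rI) (\<rho> rJ)} \<rho> (T g)) (load rC) [] (free (\<rho>(rC := ?v)) g)"
    by (rule h_load_free) (use cl assms b in auto)
  have 3: "hoare (free (\<rho>(rC := ?v)) g) (goto rI) [] (At UNIV UNIV {pos (\<rho> rI) 0} (\<rho>(rC := ?v)) (T g))"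
    using h_goto[of "\<rho>(rC := ?v)" rI UNIV g] cl b by simp
  have tw: "\<rho>(rC := ?v, rH := ?h) = ?\<rho>" by (rule fun_upd_twist) simp
  have 4: "hoare (At UNIV UNIV {pos (\<rho> rI) 0} (\<rho>(rC := ?v)) (T g)) (load rH) [] (free ?\<rho> g)"
    using h_load_free[of "\<rho>(rC := ?v)" rH g "\<rho> rI" 0] cl assms b by (simp add: tw)
  have cl': "clean ?\<rho>" using assms(1) b by (intro clean_upd) auto
  have sw: "slot_weight ?\<rho> g = g (\<rho> rI)" by (rule ext) (simp add: slot_weight_def)
  have 5: "hoare (free ?\<rho> g) test (cstream (testc (\<rho> rN) (g (\<rho> rI)) (\<rho> rJ))) (free ?\<rho> g)"
    using h_test[OF cl' assms(2)] sw assms by simp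
  have 6: "hoare (free ?\<rho> g) (overwrite rJ rH) (cstream (ovrc (\<rho> rI) (\<rho> rJ) (\<rho> rJ) ?h)) (free ?\<rho> g)"
    using h_overwrite[OF cl', of rJ rH g] assms by simp
  have 7: "hoare (free ?\<rho> g) (zero rC) [] (free (\<rho>(rH := ?h)) g)"
    by (rule h_zero_restore) (use cl assms b in auto)
  have 8: "hoare (free (\<rho>(rH := ?h)) g) (zero rH) [] (free \<rho> g)"
    by (rule h_zero_restore) (use cl assms b in auto)
  show ?thesis
    by (rule h_Seq[OF 1 h_Seq[OF 2 h_Seq[OF 3 h_Seq[OF 4 h_Seq[OF 5 h_Seq[OF h_known h_Seq[OF 6
      h_Seq[OF 7 8 refl] refl] refl] refl] refl] refl] refl]])
      (simp only: cstream_append append_Nil append_Nil2)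
qed

lemma h_prog1:
  assumes "okg g"
  shows "hoare (free (\<lambda>_. 0) g) prog1 (cstream (cmds1 g)) (free (\<lambda>_. 0) g)"
proof -
  let ?n = "num_vars"
  let ?\<rho> = "(\<lambda>_. 0)(rN := ?n)"
  have n: "?n < Bk" by (rule num_vars_less)
  have cl: "clean ?\<rho>" using n by (intro clean_upd) auto
  have cl2: "clean (?\<rho>(rI := I))" if "I < Bk" for I using n that by (intro clean_upd) auto
  have cl3: "clean (?\<rho>(rI := I, rJ := J))" if "I < Bk" "J < Bk" for I J using n that by (intro clean_upd) auto
  have 0: "hoare (free (\<lambda>_. 0) g) count_vars [] (free ?\<rho> g)"
    using h_count_vars[of "\<lambda>_. 0"] by simp
  have a: "hoare (free (?\<rho>(rI := I)) g) (for_upto rJ rN (test_variable m))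
     (concat (map (\<lambda>k. cstream (testc ?n (g I) (Suc k) @ [(m, [])])) [0..<?n])) (free (?\<rho>(rI := I)) g)"
    if I: "I < Bk" for I m
  proof (rule h_for_upto)
    fix k assume k: "k < ?n"
    show "hoare (free (?\<rho>(rI := I, rJ := Suc k)) g) (test_variable m)
     (cstream (testc ?n (g I) (Suc k) @ [(m, [])])) (free (?\<rho>(rI := I, rJ := Suc k)) g)"
      using h_test_variable[OF cl3[OF I, of "Suc k"] assms, of m] k n by simp
  qed (use cleanD(1)[OF cl2[OF I]] in auto)
  have 1: "hoare (free ?\<rho> g) (for_all rI
      (for_upto rJ rN (test_variable 3) ;;
       for_upto rJ rN (test_variable 4) ;; known 5))
     (concat (map (\<lambda>I. cstream (concat (map (\<lambda>k. testc ?n (g I) (Suc k) @ [(3, [])]) [0..<?n]) @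
       concat (map (\<lambda>k. testc ?n (g I) (Suc k) @ [(4, [])]) [0..<?n]) @ [(5, [])])) [0..<Bk])) (free ?\<rho> g)"
  proof (rule h_for_all)
    fix I assume I: "I < Bk"
    show "hoare (free (?\<rho>(rI := I)) g) (for_upto rJ rN (test_variable 3) ;;
       for_upto rJ rN (test_variable 4) ;; known 5)
      (cstream (concat (map (\<lambda>k. testc ?n (g I) (Suc k) @ [(3, [])]) [0..<?n]) @
       concat (map (\<lambda>k. testc ?n (g I) (Suc k) @ [(4, [])]) [0..<?n]) @ [(5, [])])) (free (?\<rho>(rI := I)) g)"
      by (rule h_Seq[OF a[OF I] h_Seq[OF a[OF I] h_known refl]]) (simp only: cstream_append cstream_concat)
  qed (use cleanD(1)[OF cl] in auto)
  have 2: "hoare (free ?\<rho> g) (for_all rI (known 6 ;;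
       for_upto rJ rN compress_variable))
     (concat (map (\<lambda>I. cstream ([(6, [])] @
       concat (map (\<lambda>k. testc ?n (g I) (Suc k) @ [(7, [])] @ ovrc I (Suc k) (Suc k) (g I 0)) [0..<?n]))) [0..<Bk])) (free ?\<rho> g)"
  proof (rule h_for_all)
    fix I assume I: "I < Bk"
    have "hoare (free (?\<rho>(rI := I)) g) (for_upto rJ rN compress_variable)
      (concat (map (\<lambda>k. cstream (testc ?n (g I) (Suc k) @ [(7, [])] @ ovrc I (Suc k) (Suc k) (g I 0))) [0..<?n])) (free (?\<rho>(rI := I)) g)"
    proof (rule h_for_upto)
      fix k assume k: "k < ?n"
      show "hoare (free (?\<rho>(rI := I, rJ := Suc k)) g) compress_variable
       (cstream (testc ?n (g I) (Suc k) @ [(7, [])] @ ovrc I (Suc k) (Suc k) (g I 0))) (free (?\<rho>(rI := I, rJ := Suc k)) g)"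
        using h_compress_variable[OF cl3[OF I, of "Suc k"] assms] k n by simp
    qed (use cleanD(1)[OF cl2[OF I]] in auto)
    then show "hoare (free (?\<rho>(rI := I)) g) (known 6 ;;
       for_upto rJ rN compress_variable) (cstream ([(6, [])] @
       concat (map (\<lambda>k. testc ?n (g I) (Suc k) @ [(7, [])] @ ovrc I (Suc k) (Suc k) (g I 0)) [0..<?n]))) (free (?\<rho>(rI := I)) g)"
      by (rule h_Seq[OF h_known]) (simp only: cstream_append cstream_concat)
  qed (use cleanD(1)[OF cl] in auto)
  have 3: "hoare (free ?\<rho> g) (zero rN) [] (free (\<lambda>_. 0) g)"
    by (rule h_zero_restore) (use n in auto)
  show ?thesis
    unfolding prog1_def cmds1_def
    by (rule h_Seq[OF 0 h_Seq[OF 1 h_Seq[OF 2 3 refl] refl]])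
      (simp only: cstream_append cstream_concat append_Nil append_Nil2)
qed

lemma h_prog2:
  assumes "okg g"
  shows "hoare (free (\<lambda>_. 0) g) prog2 (cstream (cmds2 g)) (free (\<lambda>_. 0) g)"
proof -
  let ?n = "num_vars"
  let ?\<rho> = "(\<lambda>_. 0)(rN := ?n)"
  have n: "?n < Bk" by (rule num_vars_less)
  have cl: "clean ?\<rho>" using n by (intro clean_upd) auto
  have 0: "hoare (free (\<lambda>_. 0) g) count_vars [] (free ?\<rho> g)"
    using h_count_vars[of "\<lambda>_. 0"] by simp
  have 1: "hoare (free ?\<rho> g) (for_all rI
      restore_block)
     (concat (map (\<lambda>I. cstream (let j = take_bit (L - 1) (g I 0) in
       concat (map (\<lambda>C. [(6, [])] @ testc ?n ((g I)(j := C)) j @ [(7, [])] @ ovrc I j (g I j) C) [0..<Bk]))) [0..<Bk])) (free ?\<rho> g)"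
  proof (rule h_for_all)
    fix I assume I: "I < Bk"
    define j where "j = take_bit (L - 1) (g I 0)"
    let ?r = "?\<rho>(rI := I)"
    have c1: "clean ?r" using n I by (intro clean_upd) auto
    have gl: "g I S < Bk" for S using assms by (simp add: okg_def)
    have j: "j < Bk"
      unfolding j_def by (rule le_less_trans[OF take_bit_nat_less_eq_self gl])
    have a: "hoare (free ?r g) (goto rI) [] (At UNIV UNIV {pos I 0} ?r (T g))"
      using h_goto[of ?r rI UNIV g] cleanD[OF c1] by simp
    have b: "hoare (At UNIV UNIV {pos I 0} ?r (T g)) (load rJ) [] (free (?r(rJ := g I 0)) g)"
      by (rule h_load_free) (use cleanD[OF c1] assms I in auto)
    have c: "hoare (free (?r(rJ := g I 0)) g) (clear_top rJ) [] (free (?r(rJ := j)) g)"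
      using h_clear_top[of "?r(rJ := g I 0)" rJ UNIV UNIV "T g"] cleanD[OF c1] gl by (simp add: j_def)
    have d: "hoare (free (?r(rJ := j)) g) (goto_slot rI rJ) [] (At UNIV UNIV {pos I j} (?r(rJ := j)) (T g))"
      using h_goto_slot[of "?r(rJ := j)" rI rJ UNIV g] cleanD[OF c1] j by simp
    have tw: "?r(rJ := j, rH := g I j) = ?r(rH := g I j, rJ := j)" by (rule fun_upd_twist) simp
    let ?s = "?r(rH := g I j, rJ := j)"
    have e: "hoare (At UNIV UNIV {pos I j} (?r(rJ := j)) (T g)) (load rH) [] (free ?s g)"
      using h_load_free[of "?r(rJ := j)" rH g I j] cleanD[OF c1] assms I j by (simp add: tw)
    have cs: "clean ?s" using n I gl j by (intro clean_upd) auto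
    have f: "hoare (free ?s g) (for_all rC (known 6 ;; test ;; known 7 ;; overwrite rH rC))
      (concat (map (\<lambda>C. cstream ([(6, [])] @ testc ?n ((g I)(j := C)) j @ [(7, [])] @ ovrc I j (g I j) C)) [0..<Bk])) (free ?s g)"
    proof (rule h_for_all)
      fix C assume C: "C < Bk"
      let ?t = "?s(rC := C)"
      have ct: "clean ?t" using n I gl j C by (intro clean_upd) auto
      have sw: "slot_weight ?t g = (g I)(j := C)" by (rule ext) (simp add: slot_weight_def fun_upd_def)
      have t: "hoare (free ?t g) test (cstream (testc ?n ((g I)(j := C)) j)) (free ?t g)"
        using h_test[OF ct assms] by (simp add: sw)
      have o: "hoare (free ?t g) (overwrite rH rC) (cstream (ovrc I j (g I j) C)) (free ?t g)"
        using h_overwrite[OF ct, of rH rC g] by simp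
      show "hoare (free ?t g) (known 6 ;; test ;; known 7 ;; overwrite rH rC)
        (cstream ([(6, [])] @ testc ?n ((g I)(j := C)) j @ [(7, [])] @ ovrc I j (g I j) C)) (free ?t g)"
        by (rule h_Seq[OF h_known h_Seq[OF t h_Seq[OF h_known o refl] refl]])
          (simp only: cstream_append)
    qed (use cleanD[OF cs] in auto)
    have z1: "hoare (free ?s g) (zero rJ) [] (free (?r(rH := g I j)) g)"
      by (rule h_zero_restore) (use cleanD[OF c1] gl j in auto)
    have z2: "hoare (free (?r(rH := g I j)) g) (zero rH) [] (free ?r g)"
      by (rule h_zero_restore) (use cleanD[OF c1] gl in auto)
    show "hoare (free ?r g) restore_block
      (cstream (let j = take_bit (L - 1) (g I 0) in
       concat (map (\<lambda>C. [(6, [])] @ testc ?n ((g I)(j := C)) j @ [(7, [])] @ ovrc I j (g I j) C) [0..<Bk]))) (free ?r g)"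
      by (rule h_Seq[OF a h_Seq[OF b h_Seq[OF c h_Seq[OF d h_Seq[OF e h_Seq[OF f h_Seq[OF z1 z2 refl] refl] refl] refl] refl] refl]])
        (simp only: cstream_concat Let_def j_def[symmetric] append_Nil append_Nil2)
  qed (use cleanD(1)[OF cl] in auto)
  have 3: "hoare (free ?\<rho> g) (zero rN) [] (free (\<lambda>_. 0) g)"
    by (rule h_zero_restore) (use n in auto)
  show ?thesis
    unfolding prog2_def cmds2_def
    by (rule h_Seq[OF 0 h_Seq[OF 1 3 refl]])
      (simp only: cstream_concat append_Nil append_Nil2)
qed

end

section \<open>Correctness of the exhaustive search\<close>

context tape
begin

text \<open>The top bit of the spare slot of block \<open>k\<close> stores the value of variable \<open>k\<close> during the search.\<close>

definition G :: "(nat \<Rightarrow> nat \<Rightarrow> nat) \<Rightarrow> nat \<Rightarrow> nat \<Rightarrow> nat \<Rightarrow> nat" where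
  "G g Y I S = (if S = 0 then set_to (L - 1) (bit Y I) (g I 0) else g I S)"

lemma okg_G: "okg g \<Longrightarrow> okg (G g Y)"
proof -
  assume a: "okg g"
  have "set_to (L - 1) b m < 2 ^ L" if "m < 2 ^ L" for b m
    by (rule less_exp_if_bits) (use that L_pos in \<open>auto simp: bit_set_to dest: bit_less_exp split: if_splits\<close>)
  with a show ?thesis by (auto simp: okg_def G_def)
qed

lemma nth_T:
  "p < length \<tau>0 \<Longrightarrow> T g ! p = (if p < Bk * Bk * L then bit (g (p div L div Bk) (p div L mod Bk)) (p mod L) else \<tau>0 ! p)"
  by (simp add: T_def)

lemma T_eqI:
  assumes "\<And>I S k. I < Bk \<Longrightarrow> S < Bk \<Longrightarrow> k < L \<Longrightarrow> bit (g I S) k = bit (g' I S) k"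
  shows "T g = T g'"
proof (rule nth_equalityI)
  fix p assume p: "p < length (T g)"
  have "p div L div Bk < Bk" if "p < Bk * Bk * L"
    using that by (metis less_mult_imp_div_less mult.commute)
  moreover have "p div L mod Bk < Bk" "p mod L < L" using L_pos by auto
  ultimately show "T g ! p = T g' ! p" using p assms by (auto simp: nth_T)
qed simp

lemma put_T:
  assumes "I < Bk" "S < Bk" "k < L"
  shows "put (T g) (pos I S + k) b = T (\<lambda>I' S'. if I' = I \<and> S' = S then set_to k b (g I S) else g I' S')"
    (is "_ = T ?g")
proof (rule nth_equalityI)
  let ?p = "(I * Bk + S) * L + k"
  note s = slot_index[OF assms]
  fix p assume p: "p < length (put (T g) (pos I S + k) b)"
  have p': "p < length \<tau>0" using p by (simp add: put_def pos_def)
  have pp: "put (T g) (pos I S + k) b = (T g)[?p := b]" by (simp add: put_def pos_def)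
  show "put (T g) (pos I S + k) b ! p = T ?g ! p"
  proof (cases "p = ?p")
    case True
    have "?p div L div Bk = I" "?p div L mod Bk = S" using s assms by auto
    with True s p' show ?thesis unfolding pp by (simp add: nth_T bit_set_to)
  next
    case False
    have "\<not> (p div L div Bk = I \<and> p div L mod Bk = S \<and> p mod L = k)"
      using False by (metis div_mult_mod_eq)
    with False p' show ?thesis unfolding pp by (auto simp: nth_T bit_set_to)
  qed
qed (simp add: put_def)

lemma scan_bit:
  assumes "I < Bk"
  shows "scan (T (G g Y)) (pos I 0 + (L - 1)) = Sym (bit Y I)"
  using scan_T[OF assms, of 0 "L - 1" "G g Y"] L_pos by (simp add: G_def bit_set_to)

lemma put_bit:
  assumes "I < Bk"
  shows "put (T (G g Y)) (pos I 0 + (L - 1)) b = T (G g (set_to I b Y))"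
proof -
  have "put (T (G g Y)) (pos I 0 + (L - 1)) b = T (\<lambda>I' S'. if I' = I \<and> S' = 0 then set_to (L - 1) b (G g Y I 0) else G g Y I' S')"
    using put_T[OF assms, of 0 "L - 1"] L_pos by simp
  also have "\<dots> = T (G g (set_to I b Y))"
    by (rule T_eqI) (auto simp: G_def bit_set_to)
  finally show ?thesis .
qed

lemma h_goto_bit:
  assumes "ok \<rho>" "\<rho> rA = 0" "\<rho> rB = 0" "r < tracks" "r \<noteq> rA"
  shows "hoare (At I UNIV UNIV \<rho> (T g)) (goto_bit r) [] (At I UNIV {pos (\<rho> r) 0 + (L - 1)} \<rho> (T g))"
proof -
  have r: "\<rho> r < Bk" using okD[OF assms(1)] .
  have 1: "hoare (At I UNIV {pos (\<rho> r) 0} \<rho> (T g)) skip_slot [] (At I UNIV {pos (\<rho> r) 0 + L} \<rho> (T g))"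
    using h_skip[of "pos (\<rho> r) 0" "T g" I \<rho>] pos_le[of "\<rho> r" "Suc 0"] r by (simp add: pos_Suc)
  have 2: "hoare (At I UNIV {pos (\<rho> r) 0 + L} \<rho> (T g)) (move_cat Go_Left) [] (At I UNIV {pos (\<rho> r) 0 + (L - 1)} \<rho> (T g))"
    by (rule h_weaken[OF h_move_cat]) (use L_pos in auto)
  show ?thesis
    unfolding goto_bit_def by (rule h_Seq[OF h_goto[OF assms] h_Seq[OF 1 2 refl]]) simp
qed

lemma one_less_Bk: "1 < Bk"
  using one_less_power[of "2::nat" L] L_pos by simp

lemma of_bool_less_Bk: "of_bool b < Bk"
  using one_less_Bk by (cases b) auto

abbreviation PF :: "(nat \<Rightarrow> nat) \<Rightarrow> bool \<times> bool \<Rightarrow> nat \<Rightarrow> nat" where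
  "PF \<rho> a \<equiv> \<rho>(rF := of_bool (snd a), rP := of_bool (fst a))"

lemma h_flag:
  assumes "ok \<rho>" "\<rho> rA = 0" "\<rho> rB = 0"
  shows "hoare (At I UNIV J (PF \<rho> (p, f)) \<tau>) eval_end []
    (At I UNIV J (PF \<rho> (p, f \<or> p)) \<tau>)"
proof (rule h_Cond_Test)
  show "hoare (At I UNIV J (PF \<rho> (p, f)) \<tau>) (scan_work (\<lambda>t. \<not> bit t rP)) []
    (\<lambda>s. At I UNIV J (PF \<rho> (p, f)) \<tau> s \<and> holds (\<lambda>a s b. s \<noteq> REnd) s = p)"
  proof -
    have "ok (PF \<rho> (p, f))" using assms of_bool_less_Bk by simp
    from test_zero[OF this, of rP I J \<tau>] show ?thesis by (cases p) auto
  qed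
next
  assume p: p
  have tw: "(PF \<rho> (p, f))(rF := 1) = PF \<rho> (p, True)"
    by (auto simp: fun_upd_def)
  have "hoare (At I UNIV J (PF \<rho> (p, f)) \<tau>) (set_one rF) [] (At I UNIV J ((PF \<rho> (p, f))(rF := 1)) \<tau>)"
    by (rule h_set_one) auto
  then show "hoare (At I UNIV J (PF \<rho> (p, f)) \<tau>) (set_one rF) [] (At I UNIV J (PF \<rho> (p, f \<or> p)) \<tau>)"
    using p unfolding tw by simp
next
  assume "\<not> p"
  then show "hoare (At I UNIV J (PF \<rho> (p, f)) \<tau>) Skip [] (At I UNIV J (PF \<rho> (p, f \<or> p)) \<tau>)"
    using h_Skip by simp
qed

text \<open>\<open>pf0\<close> is arbitrary because the flags still hold the verdict on the previous
  assignment. The closing \<open>eval_end\<close> judges the last clause, so only \<open>rF\<close>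
  has to be inspected afterwards.\<close>

lemma h_evaluate:
  assumes "clean \<rho>" "a = foldl (estep (bit Y)) (False, False) ts"
  shows "hoare (Any (PF \<rho> pf0) (T (G g Y))) evaluate [] (Any (PF \<rho> (fst a, snd a \<or> fst a)) (T (G g Y)))"
proof -
  note cl = cleanD[OF assms(1)]
  let ?\<tau> = "T (G g Y)"
  have okp: "ok (PF \<rho> a)" for a using cl of_bool_less_Bk by simp
  have 1: "hoare (Any (PF \<rho> pf0) ?\<tau>) (zero rP) [] (Any (PF \<rho> (False, snd pf0)) ?\<tau>)"
    using h_zero[OF okp, of rP UNIV UNIV pf0 ?\<tau>] by simp
  have tw: "(PF \<rho> (False, snd pf0))(rF := 0) = PF \<rho> (False, False)"
    by (auto simp: fun_upd_def)
  have 2: "hoare (Any (PF \<rho> (False, snd pf0)) ?\<tau>) (zero rF) [] (Any (PF \<rho> (False, False)) ?\<tau>)"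
    using h_zero[OF okp, of rF UNIV UNIV "(False, snd pf0)" ?\<tau>] unfolding tw by simp
  have 3: "hoare (Any (PF \<rho> (False, False)) ?\<tau>) (for_tokens
       eval_clause
       (goto_bit rS ;; eval_sign))
      (concat (map (\<lambda>_. []) ts)) (Any (PF \<rho> (foldl (estep (bit Y)) (False, False) ts)) ?\<tau>)"
  proof (rule h_for_tokens)
    fix a show "ok (PF \<rho> a) \<and> PF \<rho> a rS = 0 \<and> PF \<rho> a rG = 0" using okp cl by simp
  next
    fix i and a :: "bool \<times> bool"
    obtain p f where a: "a = (p, f)" by (cases a)
    have "hoare (At {i} UNIV UNIV (PF \<rho> (p, f \<or> p)) ?\<tau>) (set_one rP) [] (At {i} UNIV UNIV ((PF \<rho> (p, f \<or> p))(rP := 1)) ?\<tau>)"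
      by (rule h_set_one) auto
    then have b: "hoare (At {i} UNIV UNIV (PF \<rho> (p, f \<or> p)) ?\<tau>) (set_one rP) [] (At {i} UNIV UNIV (PF \<rho> (True, f \<or> p)) ?\<tau>)"
      by simp
    show "hoare (At {i} UNIV UNIV (PF \<rho> a) ?\<tau>) eval_clause []
       (At {i} UNIV UNIV (PF \<rho> (estep (bit Y) a Cl)) ?\<tau>)"
      unfolding a estep.simps by (rule h_Seq[OF h_flag b]) (use cl in auto)
  next
    fix i s v and a :: "bool \<times> bool" assume v: "v < Bk"
    obtain p f where a: "a = (p, f)" by (cases a)
    let ?r = "\<lambda>p. (PF \<rho> (p, f))(rG := of_bool s, rS := v)"
    let ?J = "{pos v 0 + (L - 1)}"
    have okr: "ok (?r p)" for p by (intro ok_upd okp of_bool_less_Bk v)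
    have A: "hoare (At {i} UNIV UNIV (?r p) ?\<tau>) (goto_bit rS) [] (At {i} UNIV ?J (?r p) ?\<tau>)"
      using h_goto_bit[OF okr, of p rS "{i}" "G g Y"] cl by simp
    have tw: "(?r p)(rP := 0) = ?r False"
      by (auto simp: fun_upd_def)
    have Z: "hoare (At {i} UNIV ?J (?r p) ?\<tau>) (zero rP) [] (At {i} UNIV ?J (?r False) ?\<tau>)"
      using h_zero[OF okr, of rP "{i}" ?J p ?\<tau>] unfolding tw by simp
    have B: "hoare (At {i} UNIV ?J (?r p) ?\<tau>) eval_sign []
       (At {i} UNIV ?J (?r (p \<and> bit Y v \<noteq> s)) ?\<tau>)"
    proof (rule h_Cond_Test)
      show "hoare (At {i} UNIV ?J (?r p) ?\<tau>) (scan_work (\<lambda>t. \<not> bit t rG)) []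
        (\<lambda>st. At {i} UNIV ?J (?r p) ?\<tau> st \<and> holds (\<lambda>a s b. s \<noteq> REnd) st = s)"
        using test_zero[OF okr, of rG "{i}" ?J p ?\<tau>] by (cases s) auto
    next
      assume s: s
      show "hoare (At {i} UNIV ?J (?r p) ?\<tau>) (Cond (\<lambda>a s b. b = Sym True) (zero rP) Skip) [] (At {i} UNIV ?J (?r (p \<and> bit Y v \<noteq> s)) ?\<tau>)"
        by (rule h_Cond[where b = "bit Y v"])
          (use s Z h_Skip in \<open>auto simp: At_holds_cat scan_bit[OF v, unfolded One_nat_def]\<close>)
    next
      assume s: "\<not> s"
      show "hoare (At {i} UNIV ?J (?r p) ?\<tau>) (Cond (\<lambda>a s b. b = Sym True) Skip (zero rP)) [] (At {i} UNIV ?J (?r (p \<and> bit Y v \<noteq> s)) ?\<tau>)"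
        by (rule h_Cond[where b = "bit Y v"])
          (use s Z h_Skip in \<open>auto simp: At_holds_cat scan_bit[OF v, unfolded One_nat_def]\<close>)
    qed
    have "hoare (At {i} UNIV ?J (?r p) ?\<tau>) eval_sign []
       (At {i} UNIV UNIV (?r (p \<and> bit Y v \<noteq> s)) ?\<tau>)"
      using B by (rule h_weaken) auto
    from h_Seq[OF A this refl] show "hoare (At {i} UNIV UNIV ((PF \<rho> a)(rG := of_bool s, rS := v)) ?\<tau>)
       (goto_bit rS ;; eval_sign) []
       (At {i} UNIV UNIV ((PF \<rho> (estep (bit Y) a (Lit s v)))(rG := of_bool s, rS := v)) ?\<tau>)"
      unfolding a by simp
  qed
  have 4: "hoare (Any (PF \<rho> a) ?\<tau>) eval_end []
    (Any (PF \<rho> (fst a, snd a \<or> fst a)) ?\<tau>)"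
    using h_flag[of \<rho> UNIV UNIV "fst a" "snd a"] cl by simp
  show ?thesis
    unfolding evaluate_def
    by (rule h_Seq[OF 1 h_Seq[OF 2 h_Seq[OF 3[folded assms(2)] 4 refl] refl]]) simp
qed

lemma h_Cat_Write:
  "hoare (At I H {j} \<rho> \<tau>) (Cat_Write b) [] (At I H {j} \<rho> (put \<tau> j b))"
  using ex_Cat by (intro h_AtI) (simp, blast)

lemma h_next_assignment:
  assumes "ok \<rho>" "\<rho> rA = 0" "\<rho> rB = 0" "\<rho> rS = 0" "Y + 1 < 2 ^ Bk"
  shows "hoare (Any \<rho> (T (G g Y))) next_assignment [] (Any \<rho> (T (G g (Y + 1))))"
proof -
  \<comment> \<open>The first block whose bit is 0, where the carry stops. It exists because
    \<open>Y\<close> is not the all-ones assignment.\<close>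
  define n where "n = (LEAST k. \<not> bit Y k)"
  have "\<exists>k<Bk. \<not> bit Y k"
  proof (rule ccontr)
    assume a: "\<not> ?thesis"
    have "Y = mask Bk"
      by (rule bit_eqI) (use a assms(5) in \<open>auto simp: bit_simps dest: bit_less_exp[of Y _ Bk]\<close>)
    then show False using assms(5) by (simp add: mask_eq_exp_minus_1)
  qed
  then obtain k0 where k0: "k0 < Bk" "\<not> bit Y k0" by blast
  have n: "\<not> bit Y n" unfolding n_def by (rule LeastI[of _ k0]) (rule k0)
  have nL: "n < Bk" unfolding n_def using Least_le[of "\<lambda>k. \<not> bit Y k" k0] k0 by simp
  have lt: "bit Y k" if "k < n" for k
    using not_less_Least[OF that[unfolded n_def]] by simp
  have go: "hoare (Any (\<rho>(rS := k)) (T (G g Z))) (goto_bit rS) [] (At UNIV UNIV {pos k 0 + (L - 1)} (\<rho>(rS := k)) (T (G g Z)))"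
    if "k < Bk" for k Z
    using h_goto_bit[of "\<rho>(rS := k)" rS UNIV "G g Z"] assms that by simp
  let ?R = "\<lambda>k. At UNIV UNIV {pos k 0 + (L - 1)} (\<rho>(rS := k)) (T (G g (mix k 0 Y)))"
  have r0: "\<rho>(rS := 0) = \<rho>" using assms by (simp add: fun_upd_idem)
  have 1: "hoare (Any \<rho> (T (G g Y))) (goto_bit rS) [] (?R 0)"
    using go[of 0 Y] r0 by simp
  have 2: "hoare (?R 0) (While (\<lambda>a s b. b = Sym True) (Cat_Write False ;; inc rS ;; goto_bit rS)) (concat (map (\<lambda>_. []) [0..<n])) (?R n)"
  proof (rule h_While)
    fix k assume k: "k < n"
    then have kB: "k < Bk" "Suc k < Bk" using nL by auto
    have m: "set_to k False (mix k 0 Y) = mix (Suc k) 0 Y" using mix_Suc[of k 0 Y] by simp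
    have a: "hoare (?R k) (Cat_Write False) [] (Any (\<rho>(rS := k)) (T (G g (mix (Suc k) 0 Y))))"
      using h_Cat_Write[of UNIV UNIV "pos k 0 + (L - 1)" "\<rho>(rS := k)" "T (G g (mix k 0 Y))" False]
      unfolding put_bit[OF kB(1)] m by (rule h_weaken) auto
    have b: "hoare (Any (\<rho>(rS := k)) (T (G g (mix (Suc k) 0 Y)))) (inc rS) [] (Any (\<rho>(rS := Suc k)) (T (G g (mix (Suc k) 0 Y))))"
      using h_inc[of "\<rho>(rS := k)" rS UNIV UNIV] assms kB by simp
    show "hoare (?R k) (Cat_Write False ;; inc rS ;; goto_bit rS) [] (?R (Suc k))"
      by (rule h_Seq[OF a h_Seq[OF b go[OF kB(2)] refl]]) simp
  qed (use n nL lt in \<open>auto simp: At_holds_cat scan_bit[unfolded One_nat_def] bit_mix\<close>)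
  have m: "set_to n True (mix n 0 Y) = Y + 1" using inc_bits[OF lt n] .
  have 3: "hoare (?R n) (Cat_Write True) [] (Any (\<rho>(rS := n)) (T (G g (Y + 1))))"
    using h_Cat_Write[of UNIV UNIV "pos n 0 + (L - 1)" "\<rho>(rS := n)" "T (G g (mix n 0 Y))" True]
    unfolding put_bit[OF nL] m by (rule h_weaken) auto
  have 4: "hoare (Any (\<rho>(rS := n)) (T (G g (Y + 1)))) (zero rS) [] (Any \<rho> (T (G g (Y + 1))))"
    by (rule h_zero_restore) (use assms nL in auto)
  show ?thesis
    unfolding next_assignment_def by (rule h_Seq[OF 1 h_Seq[OF 2 h_Seq[OF 3 4 refl] refl]]) simp
qed

text \<open>The search starts at 0 and stops at the least accepted assignment, which is thus also
  the number of iterations. The witness \<open>Y0\<close> only guarantees that the search stops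
  before the bits overflow.\<close>

lemma h_brute_force:
  fixes Y0 :: nat
  assumes "Y0 < 2 ^ Bk" "accepts (bit Y0) ts"
  shows "\<exists>Y::nat. accepts (bit Y) ts \<and> hoare (Any (\<lambda>_. 0) (T (G g 0))) brute_force
    (map (\<lambda>k. Some (bit Y k)) [0..<num_vars]) (Any (\<lambda>_. 0) (T (G g Y)))"
proof -
  define m where "m = (LEAST Y::nat. accepts (bit Y) ts)"
  have m: "accepts (bit m) ts" unfolding m_def by (rule LeastI[of "\<lambda>Y. accepts (bit Y) ts" Y0]) (rule assms(2))
  have m0: "m \<le> Y0" unfolding m_def by (rule Least_le) (rule assms(2))
  have lt: "\<not> accepts (bit Y) ts" if "Y < m" for Y
    using not_less_Least[OF that[unfolded m_def]] .
  let ?n = num_vars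
  let ?\<rho> = "(\<lambda>_. 0)(rN := ?n)"
  have n: "?n < Bk" by (rule num_vars_less)
  have cl: "clean ?\<rho>" using n by (intro clean_upd) auto
  have okp: "ok (PF ?\<rho> a)" for a using cleanD(1)[OF cl] of_bool_less_Bk by simp
  define fin where "fin Y = (let a = foldl (estep (bit Y)) (False, False) ts in (fst a, snd a \<or> fst a))" for Y :: nat
  have fin: "snd (fin Y) \<longleftrightarrow> \<not> accepts (bit Y) ts" for Y
    by (auto simp: fin_def accepts_def Let_def prod_eq_iff)
  have ev: "hoare (Any (PF ?\<rho> pf0) (T (G g Y))) evaluate [] (Any (PF ?\<rho> (fin Y)) (T (G g Y)))" for pf0 Y
    unfolding fin_def Let_def by (rule h_evaluate[OF cl refl])
  have 0: "hoare (Any (\<lambda>_. 0) (T (G g 0))) count_vars [] (Any (PF ?\<rho> (False, False)) (T (G g 0)))"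
  proof -
    have "PF ?\<rho> (False, False) = ?\<rho>" by (simp add: fun_upd_idem)
    then show ?thesis using h_count_vars[of "\<lambda>_. 0"] by simp
  qed
  have 1: "hoare (Any (PF ?\<rho> (fin 0)) (T (G g 0)))
     (While_Test (scan_work (\<lambda>t. \<not> bit t rF)) (\<lambda>a s b. s \<noteq> REnd) (next_assignment ;; evaluate))
     (concat (map (\<lambda>_. []) [0..<m])) (Any (PF ?\<rho> (fin m)) (T (G g m)))"
  proof (rule h_While_Test)
    fix Y assume Y: "Y \<le> m"
    have "(of_bool (snd (fin Y)) \<noteq> (0::nat)) = (Y < m)"
      using fin[of Y] lt[of Y] m Y by (cases "Y = m") auto
    then show "hoare (Any (PF ?\<rho> (fin Y)) (T (G g Y))) (scan_work (\<lambda>t. \<not> bit t rF)) []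
      (\<lambda>s. Any (PF ?\<rho> (fin Y)) (T (G g Y)) s \<and> holds (\<lambda>a s b. s \<noteq> REnd) s = (Y < m))"
      using test_zero[OF okp, of rF UNIV UNIV "fin Y" "T (G g Y)"] by simp
  next
    fix Y assume Y: "Y < m"
    have "hoare (Any (PF ?\<rho> (fin Y)) (T (G g Y))) next_assignment [] (Any (PF ?\<rho> (fin Y)) (T (G g (Y + 1))))"
      by (rule h_next_assignment) (use okp Y m0 assms(1) in auto)
    from h_Seq[OF this ev refl] show "hoare (Any (PF ?\<rho> (fin Y)) (T (G g Y))) (next_assignment ;; evaluate) []
      (Any (PF ?\<rho> (fin (Suc Y))) (T (G g (Suc Y))))" by simp
  qed
  have "(PF ?\<rho> (fin m))(rP := 0) = ?\<rho>"
    using fin[of m] m by (simp add: fun_upd_idem)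
  then have 2: "hoare (Any (PF ?\<rho> (fin m)) (T (G g m))) (zero rP) [] (Any ?\<rho> (T (G g m)))"
    using h_zero[OF okp, of rP UNIV UNIV "fin m" "T (G g m)"] by simp
  have 3: "hoare (Any ?\<rho> (T (G g m))) (for_upto rJ rN (copy rJ rS ;; dec rS ;; goto_bit rS ;;
       Cond (\<lambda>a s b. b = Sym True) (out (Some True)) (out (Some False)) ;; zero rS))
     (concat (map (\<lambda>k. [Some (bit m k)]) [0..<?n])) (Any ?\<rho> (T (G g m)))"
  proof (rule h_for_upto)
    fix k assume k: "k < ?n"
    let ?r = "?\<rho>(rJ := Suc k)"
    have kB: "k < Bk" "Suc k < Bk" using k n by auto
    have okr: "ok ?r" "ok (?r(rS := k))" "ok (?r(rS := Suc k))" using n kB by auto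
    have a: "hoare (Any ?r (T (G g m))) (copy rJ rS) [] (Any (?r(rS := Suc k)) (T (G g m)))"
      using h_copy[OF okr(1), of rJ rS UNIV UNIV "T (G g m)"] by simp
    have b: "hoare (Any (?r(rS := Suc k)) (T (G g m))) (dec rS) [] (Any (?r(rS := k)) (T (G g m)))"
      using h_dec[OF okr(3), of rS UNIV UNIV "T (G g m)"] by simp
    have c: "hoare (Any (?r(rS := k)) (T (G g m))) (goto_bit rS) [] (At UNIV UNIV {pos k 0 + (L - 1)} (?r(rS := k)) (T (G g m)))"
      using h_goto_bit[OF okr(2), of rS UNIV "G g m"] by simp
    have d: "hoare (At UNIV UNIV {pos k 0 + (L - 1)} (?r(rS := k)) (T (G g m))) (Cond (\<lambda>a s b. b = Sym True) (out (Some True)) (out (Some False)))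
       [Some (bit m k)] (At UNIV UNIV {pos k 0 + (L - 1)} (?r(rS := k)) (T (G g m)))"
      by (rule h_Cond[where b = "bit m k"]) (use h_out in \<open>auto simp: At_holds_cat scan_bit[OF kB(1), unfolded One_nat_def]\<close>)
    have e: "hoare (At UNIV UNIV {pos k 0 + (L - 1)} (?r(rS := k)) (T (G g m))) (zero rS) [] (At UNIV UNIV {pos k 0 + (L - 1)} ?r (T (G g m)))"
      by (rule h_zero_restore) (use okr kB in auto)
    have e': "hoare (At UNIV UNIV {pos k 0 + (L - 1)} (?r(rS := k)) (T (G g m))) (zero rS) [] (Any ?r (T (G g m)))"
      using e by (rule h_weaken) auto
    show "hoare (Any ?r (T (G g m))) (copy rJ rS ;; dec rS ;; goto_bit rS ;;
       Cond (\<lambda>a s b. b = Sym True) (out (Some True)) (out (Some False)) ;; zero rS) [Some (bit m k)] (Any ?r (T (G g m)))"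
      by (rule h_Seq[OF a h_Seq[OF b h_Seq[OF c h_Seq[OF d e' refl] refl] refl]]) simp
  qed (use cleanD(1)[OF cl] in auto)
  have 4: "hoare (Any ?\<rho> (T (G g m))) (zero rN) [] (Any (\<lambda>_. 0) (T (G g m)))"
    by (rule h_zero_restore) (use n in auto)
  have "hoare (Any (\<lambda>_. 0) (T (G g 0))) brute_force
    (map (\<lambda>k. Some (bit m k)) [0..<num_vars]) (Any (\<lambda>_. 0) (T (G g m)))"
    unfolding brute_force_def
    by (rule h_Seq[OF 0 h_Seq[OF ev h_Seq[OF 1 h_Seq[OF 2 h_Seq[OF 3 4 refl] refl] refl] refl]])
      (simp add: concat_map_singleton)
  with m show ?thesis by blast
qed

end

section \<open>The NP verifier\<close>

text \<open>State 0 marks the first work cell by the symbol 1, and the states 1 to 6 are the six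
  modes. The counter is the position of the work head: a move to the left at the first cell stays
  there, which is exactly truncated decrement, and the marker is the test for 0. Running off the
  certificate rejects.\<close>

fun verifier_delta :: "nat \<Rightarrow> bool cell \<Rightarrow> bool cell \<Rightarrow> nat list \<Rightarrow> tm_action" where
  "verifier_delta q a b s =
    (if q = 0 then Tm_Step 1 [(1, Stay)] Go_Right Stay
     else if a = REnd then Accept
     else if b = REnd then Reject
     else if a \<noteq> Sym True then Tm_Step (if q = 6 then 1 else q + 1) [(hd s, Stay)] Go_Right Stay
     else if q = 1 then Tm_Step q [(hd s, Go_Right)] Go_Right Stay
     else if q = 2 then Tm_Step q [(hd s, Stay)] Go_Right Go_Right
     else if q = 3 then Tm_Step q [(hd s, Stay)] Go_Right Go_Left
     else if q = 4 then Tm_Step q [(hd s, if b = Sym True then Go_Left else Stay)] Go_Right Stay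
     else if q = 5 then Tm_Step q [(hd s, if b = Sym True then Stay else Go_Left)] Go_Right Stay
     else if hd s = 1 then Tm_Step q [(hd s, Stay)] Go_Right Stay
     else Reject)"

definition verifier :: tm where
  "verifier = \<lparr>tm_states = 7, tm_syms = 2, tm_tapes = 1, tm_delta = verifier_delta\<rparr>"

lemma wf_verifier: "wf_tm verifier"
  unfolding wf_tm_def
proof (intro conjI allI impI)
  fix q a b s q' ws m m'
  assume q: "q < tm_states verifier"
    and h: "length s = tm_tapes verifier \<and> set s \<subseteq> {..<tm_syms verifier} \<and>
      tm_delta verifier q a b s = Tm_Step q' ws m m'"
  then have "hd s < 2" by (cases s) (auto simp: verifier_def)
  with q h show "q' < tm_states verifier" "length ws = tm_tapes verifier" "fst ` set ws \<subseteq> {..<tm_syms verifier}"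
    by (auto simp: verifier_def split: if_splits)
qed (auto simp: verifier_def)

fun bit_sem :: "bool list \<Rightarrow> bool list \<Rightarrow> nat \<Rightarrow> nat \<Rightarrow> nat \<Rightarrow> bool" where
  "bit_sem w [] m p c = True"
| "bit_sem w (b # bs) m p c =
    (p \<le> length w \<and>
     (if \<not> b then bit_sem w bs (if m = 5 then 0 else m + 1) p c
      else if m = 0 then bit_sem w bs m p (c + 1)
      else if m = 1 then bit_sem w bs m (p + 1) c
      else if m = 2 then bit_sem w bs m (p - 1) c
      else if m = 3 then bit_sem w bs m p (if scan w p = Sym True then c - 1 else c)
      else if m = 4 then bit_sem w bs m p (if scan w p = Sym True then c else c - 1)
      else c = 0 \<and> bit_sem w bs m p c))"

lemma verdict_bit_sem:
  assumes "length bs < f" "i = length x + 1 - length bs" "suffix bs x" "m < 6" "p \<le> length w + 1"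
    "t = (\<lambda>_. 0)(0 := 1)"
  shows "tm_verdict verifier x w f (m + 1) i p [(t, c)] = Some (bit_sem w bs m p c)"
  using assms
proof (induction bs arbitrary: f i m p c)
  case Nil
  then obtain f' where f: "f = Suc f'" by (cases f) auto
  have "scan x i = REnd" using Nil by (simp add: scan_def)
  then show ?case by (simp add: f verifier_def)
next
  case (Cons b bs)
  then obtain f' where f: "f = Suc f'" "length bs < f'" by (cases f) auto
  have sf: "suffix bs x" using Cons.prems(3) by (metis suffix_ConsD)
  have li: "length bs < length x" using Cons.prems(3) suffix_length_le by fastforce
  have sc: "scan x i = Sym b" and sh: "shift x Go_Right i = length x + 1 - length bs"
    using Cons.prems(2,3) li by (auto simp: scan_def suffix_def nth_append)
  have R: "scan w p = REnd \<longleftrightarrow> \<not> p \<le> length w" using Cons.prems(5) by (auto simp: scan_def)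
  have th: "t(c := t c) = t" by simp
  have tc: "t c = 1 \<longleftrightarrow> c = 0" using Cons.prems(6) by (simp add: fun_upd_apply)
  note IH = Cons.IH[OF f(2) refl sf _ _ Cons.prems(6)]
  show ?case
  proof (cases "p \<le> length w")
    case False
    then show ?thesis using R sc by (simp add: f verifier_def)
  next
    case True
    then have p: "p \<le> length w + 1" "p + 1 \<le> length w + 1" "p - 1 \<le> length w + 1" by auto
    have shr: "shift w Go_Right p = p + 1" using True by simp
    have nR: "scan w p \<noteq> REnd" using R True by simp
    consider "\<not> b" "m = 5" | "\<not> b" "m < 5" | b "m = 0" | b "m = 1" | b "m = 2" | b "m = 3" | b "m = 4" | b "m = 5"
      using Cons.prems(4) by linarith
    then show ?thesis
    proof cases
      case 1
      then show ?thesis using sc nR True sh IH[of 0 p c] p by (simp add: f verifier_def del: shift.simps(3))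
    next
      case 2
      then show ?thesis using sc nR True sh IH[of "m + 1" p c] p by (simp add: f verifier_def del: shift.simps(3))
    next
      case 3
      then show ?thesis using sc nR True sh IH[of m p "c + 1"] p by (simp add: f verifier_def del: shift.simps(3))
    next
      case 4
      then show ?thesis using sc nR True sh IH[of m "p + 1" c] p shr by (simp add: f verifier_def del: shift.simps(3))
    next
      case 5
      then show ?thesis using sc nR True sh IH[of m "p - 1" c] p by (simp add: f verifier_def del: shift.simps(3))
    next
      case 6
      then show ?thesis using sc nR True sh IH[of m p "c - 1"] IH[of m p c] p
        by (cases "scan w p = Sym True") (simp_all add: f verifier_def del: shift.simps(3))
    next
      case 7
      then show ?thesis using sc nR True sh IH[of m p "c - 1"] IH[of m p c] p
        by (cases "scan w p = Sym True") (simp_all add: f verifier_def del: shift.simps(3))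
    next
      case 8
      then show ?thesis using sc nR True sh IH[of m p c] p tc
        by (cases "c = 0") (simp_all add: f verifier_def fun_upd_idem del: shift.simps(3))
    qed
  qed
qed

definition sat_lang :: "bool list set" where
  "sat_lang = {x. \<exists>w. length w \<le> poly_bound 2 (length x) \<and> bit_sem w x 0 0 0}"

text \<open>One step sets the marker, each input bit takes one step, and a last step accepts;
  \<open>n + 2 \<le> n ^ 2 + 2\<close> provides enough time.\<close>

lemma tm_run_verifier: "tm_run verifier x w (poly_bound 2 (length x)) = Some (bit_sem w x 0 0 0)"
proof -
  have "length x * 1 \<le> length x * length x" by (cases "length x") auto
  then obtain f where f: "poly_bound 2 (length x) = Suc f" "length x < f"
    by (simp add: poly_bound_def power2_eq_square)
  have "tm_verdict verifier x w f (0 + 1) 1 0 [((\<lambda>_. 0)(0 := 1), 0)] = Some (bit_sem w x 0 0 0)"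
    by (rule verdict_bit_sem) (use f in auto)
  then show ?thesis
    unfolding tm_run_def f by (simp add: verifier_def)
qed

lemma sat_lang_NP: "sat_lang \<in> NP"
  unfolding NP_def sat_lang_def
  using wf_verifier tm_run_verifier by (auto intro!: exI[of _ verifier] exI[of _ 2])

section \<open>Queries as demands on an assignment\<close>

fun vsem :: "(nat \<Rightarrow> bool) \<Rightarrow> nat list \<Rightarrow> nat \<Rightarrow> nat \<Rightarrow> bool" where
  "vsem y [] p c = True"
| "vsem y (m # ms) p c =
    (if m = 0 then vsem y ms p (c + 1)
     else if m = 1 then vsem y ms (p + 1) c
     else if m = 2 then vsem y ms (p - 1) c
     else if m = 3 then vsem y ms p (if y p then c - 1 else c)
     else if m = 4 then vsem y ms p (if y p then c else c - 1)
     else c = 0 \<and> vsem y ms p c)"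

lemma bit_sem_code:
  assumes "m < 6" "p \<le> length w"
  shows "bit_sem w (code m @ bs) 0 p c \<longleftrightarrow>
    (if m = 0 then bit_sem w bs 0 p (c + 1)
     else if m = 1 then p + 1 \<le> length w \<and> bit_sem w bs 0 (p + 1) c
     else if m = 2 then bit_sem w bs 0 (p - 1) c
     else if m = 3 then bit_sem w bs 0 p (if scan w p = Sym True then c - 1 else c)
     else if m = 4 then bit_sem w bs 0 p (if scan w p = Sym True then c else c - 1)
     else c = 0 \<and> bit_sem w bs 0 p c)"
proof -
  consider "m = 0" | "m = 1" | "m = 2" | "m = 3" | "m = 4" | "m = 5" using assms(1) by linarith
  then show ?thesis by cases (use assms(2) in \<open>auto simp: code_def numeral_eq_Suc\<close>)
qed

lemma codes_Cons: "codes (m # ms) = code m @ codes ms"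
  by (simp add: codes_def)

lemma bit_sem_imp_vsem:
  "set ms \<subseteq> {..<6} \<Longrightarrow> p \<le> length w \<Longrightarrow> bit_sem w (codes ms) 0 p c \<Longrightarrow> vsem (\<lambda>p. scan w p = Sym True) ms p c"
  by (induction ms arbitrary: p c) (auto simp: codes_Cons bit_sem_code split: if_splits)

text \<open>A token moves the head right by at most one cell, so a certificate with as many cells
  ahead as there are tokens left is never run off.\<close>

lemma vsem_imp_bit_sem:
  "set ms \<subseteq> {..<6} \<Longrightarrow> p + length ms \<le> length w \<Longrightarrow> (\<And>p. p \<le> length w \<Longrightarrow> (scan w p = Sym True) = y p) \<Longrightarrow>
   vsem y ms p c \<Longrightarrow> bit_sem w (codes ms) 0 p c"
  by (induction ms arbitrary: p c) (auto simp: codes_Cons bit_sem_code codes_def split: if_splits)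

lemma length_codes: "set ms \<subseteq> {..<6} \<Longrightarrow> length (codes ms) = 7 * length ms"
  by (induction ms) (auto simp: codes_Cons code_def codes_def)

text \<open>Position 0 of the certificate is the left end marker, which never reads as 1; hence the
  condition on \<open>y 0\<close>. A certificate as long as the token list suffices.\<close>

lemma codes_in_sat_lang:
  assumes "set ms \<subseteq> {..<6}"
  shows "codes ms \<in> sat_lang \<longleftrightarrow> (\<exists>y. \<not> y 0 \<and> vsem y ms 0 0)"
proof
  assume "codes ms \<in> sat_lang"
  then obtain w where "bit_sem w (codes ms) 0 0 0" by (auto simp: sat_lang_def)
  then have "vsem (\<lambda>p. scan w p = Sym True) ms 0 0" by (intro bit_sem_imp_vsem[OF assms]) auto
  then show "\<exists>y. \<not> y 0 \<and> vsem y ms 0 0"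
    by (intro exI[of _ "\<lambda>p. scan w p = Sym True"]) (simp add: scan_def)
next
  assume "\<exists>y. \<not> y 0 \<and> vsem y ms 0 0"
  then obtain y where y: "\<not> y 0" "vsem y ms 0 0" by blast
  define w where "w = map (\<lambda>k. y (Suc k)) [0..<length ms]"
  have "(scan w p = Sym True) = y p" if "p \<le> length w" for p
    using that y(1) by (cases p) (auto simp: scan_def w_def)
  then have "bit_sem w (codes ms) 0 0 0"
    by (intro vsem_imp_bit_sem[OF assms _ _ y(2)]) (auto simp: w_def)
  moreover have "length w \<le> poly_bound 2 (length (codes ms))"
  proof -
    have "length ms \<le> length (codes ms)" using length_codes[OF assms] by simp
    also have "\<dots> \<le> length (codes ms) * length (codes ms)" by (rule le_square)
    finally show ?thesis by (simp add: w_def poly_bound_def power2_eq_square)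
  qed
  ultimately show "codes ms \<in> sat_lang" by (auto simp: sat_lang_def)
qed

lemma vsem_0: "vsem y (replicate k 0 @ r) p c = vsem y r p (c + k)"
  by (induction k arbitrary: c) auto

lemma vsem_1: "vsem y (replicate k 1 @ r) p c = vsem y r (p + k) c"
  by (induction k arbitrary: p) auto

lemma vsem_2: "vsem y (replicate k 2 @ r) p c = vsem y r (p - k) c"
  by (induction k arbitrary: p) auto

lemma vsem_3: "vsem y (replicate k 3 @ r) p c = vsem y r p (if y p then c - k else c)"
  by (induction k arbitrary: c) auto

lemma estep_fail: "snd (foldl (estep y) (p, True) ts)"
  by (induction ts arbitrary: p) (simp, case_tac a, auto)

text \<open>The counter equals the first flag of \<open>estep\<close>: opening a clause requires it
  to be 0 and sets it to 1, and a true literal lowers it to 0, where truncation keeps it. An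
  unsatisfied clause is met by the next \<open>5\<close>, just as the failure flag is never
  reset.\<close>

lemma vsem_formula:
  "vsem y (concat (map formula_vtoks ts) @ r) 0 (of_bool p) \<longleftrightarrow>
    (case foldl (estep (\<lambda>k. y (Suc k))) (p, False) ts of (p', f') \<Rightarrow> \<not> f' \<and> vsem y r 0 (of_bool p'))"
proof (induction ts arbitrary: p)
  case (Cons t ts)
  show ?case
  proof (cases t)
    case Cl
    show ?thesis
    proof (cases p)
      case True
      then show ?thesis using Cl estep_fail[of "\<lambda>k. y (Suc k)" True ts] by (auto split: prod.splits)
    next
      case False
      then show ?thesis using Cl Cons.IH[of True] by simp
    qed
  next
    case (Lit s v)
    let ?R = "concat (map formula_vtoks ts) @ r"
    have "vsem y (concat (map formula_vtoks (t # ts)) @ r) 0 (of_bool p) =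
      vsem y ([if s then 3 else 4] @ replicate (v + 1) 2 @ ?R) (0 + (v + 1)) (of_bool p)"
      unfolding Lit by (simp only: formula_vtoks.simps list.map concat.simps append_assoc vsem_1)
    also have "\<dots> = vsem y (replicate (v + 1) 2 @ ?R) (v + 1) (of_bool (p \<and> y (Suc v) \<noteq> s))"
      by (cases s; cases p) (auto simp del: replicate.simps)
    also have "\<dots> = vsem y ?R 0 (of_bool (p \<and> y (Suc v) \<noteq> s))"
      by (simp only: vsem_2 diff_self_eq_0)
    finally have "vsem y (concat (map formula_vtoks (t # ts)) @ r) 0 (of_bool p) =
      vsem y ?R 0 (of_bool (p \<and> y (Suc v) \<noteq> s))" .
    then show ?thesis using Cons.IH[of "p \<and> y (Suc v) \<noteq> s"] Lit by simp
  qed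
qed simp

text \<open>Successive truncated subtractions amount to one truncated subtraction of the sum. The
  start \<open>a\<close> is kept general since it is also the head position.\<close>

lemma vsem_weights:
  "vsem y (concat (map (\<lambda>k. 1 # replicate (w (Suc k)) 3) [a..<a + n]) @ r) a c =
    vsem y r (a + n) (c - (\<Sum>k\<in>{a..<a + n}. if y (Suc k) then w (Suc k) else 0))"
proof (induction n arbitrary: a c)
  case (Suc n)
  have u: "[a..<a + Suc n] = a # [Suc a..<Suc a + n]" by (simp add: upt_conv_Cons)
  have s: "{a..<a + Suc n} = insert a {Suc a..<Suc a + n}" by auto
  let ?f = "\<lambda>k. 1 # replicate (w (Suc k)) 3"
  let ?c = "if y (Suc a) then c - w (Suc a) else c"
  have "vsem y (concat (map ?f [a..<a + Suc n]) @ r) a c =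
      vsem y (replicate (w (Suc a)) 3 @ concat (map ?f [Suc a..<Suc a + n]) @ r) (Suc a) c"
    unfolding u by simp
  also have "\<dots> = vsem y (concat (map ?f [Suc a..<Suc a + n]) @ r) (Suc a) ?c" by (rule vsem_3)
  also have "\<dots> = vsem y r (Suc a + n) (?c - (\<Sum>k\<in>{Suc a..<Suc a + n}. if y (Suc k) then w (Suc k) else 0))"
    by (rule Suc.IH)
  finally show ?case unfolding s by simp
qed simp

lemma qry_in_sat_lang:
  assumes "0 < J"
  shows "codes (vquery ts n w v J c) \<in> sat_lang \<longleftrightarrow>
    (\<exists>y. accepts y ts \<and> v \<le> (\<Sum>k<n. if y k then w (Suc k) else 0) \<and> y (J - 1) = c)"
proof -
  let ?s = "\<lambda>y. \<Sum>k<n. if y (Suc k) then w (Suc k) else 0"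
  have six: "set (vquery ts n w v J c) \<subseteq> {..<6}"
  proof -
    have "set (formula_vtoks t) \<subseteq> {..<6}" for t by (cases t) auto
    then show ?thesis unfolding vquery_def by auto
  qed
  have 1: "vsem y (vquery ts n w v J c) 0 0 \<longleftrightarrow>
     accepts (\<lambda>k. y (Suc k)) ts \<and> v \<le> ?s y \<and> y J = c" for y
  proof -
    let ?r2 = "[0] @ replicate J 1 @ [if c then 3 else 4, 5]"
    have r2: "vsem y ?r2 0 0 \<longleftrightarrow> y J = c"
      using vsem_1[of y J "[if c then 3 else 4, 5]" 0 1] by auto
    let ?r1 = "[5] @ replicate n 2 @ ?r2"
    have r1: "vsem y (concat (map (\<lambda>k. 1 # replicate (w (Suc k)) 3) [0..<n]) @ ?r1) 0 v \<longleftrightarrow> v \<le> ?s y \<and> y J = c"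
      using vsem_weights[of y w 0 n ?r1 v] vsem_2[of y n ?r2 n 0] r2 by (auto simp: atLeast0LessThan)
    have "vsem y (vquery ts n w v J c) 0 0 \<longleftrightarrow> vsem y (concat (map formula_vtoks ts) @ [5] @
     replicate v 0 @ concat (map (\<lambda>k. 1 # replicate (w (Suc k)) 3) [0..<n]) @ ?r1) 0 (of_bool False)"
      unfolding vquery_def by simp
    also have "\<dots> \<longleftrightarrow> accepts (\<lambda>k. y (Suc k)) ts \<and> v \<le> ?s y \<and> y J = c"
      unfolding vsem_formula using vsem_0[of y v "concat (map (\<lambda>k. 1 # replicate (w (Suc k)) 3) [0..<n]) @ ?r1" 0 0] r1
      by (auto simp: accepts_def split: prod.splits)
    finally show ?thesis .
  qed
  show ?thesis
    unfolding codes_in_sat_lang[OF six] 1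
  proof
    assume "\<exists>y. \<not> y 0 \<and> accepts (\<lambda>k. y (Suc k)) ts \<and> v \<le> ?s y \<and> y J = c"
    then obtain y where "accepts (\<lambda>k. y (Suc k)) ts" "v \<le> ?s y" "y J = c" by blast
    then show "\<exists>y. accepts y ts \<and> v \<le> (\<Sum>k<n. if y k then w (Suc k) else 0) \<and> y (J - 1) = c"
      using assms by (intro exI[of _ "\<lambda>k. y (Suc k)"]) simp
  next
    assume "\<exists>y. accepts y ts \<and> v \<le> (\<Sum>k<n. if y k then w (Suc k) else 0) \<and> y (J - 1) = c"
    then obtain y where "accepts y ts" "v \<le> (\<Sum>k<n. if y k then w (Suc k) else 0)" "y (J - 1) = c" by blast
    then show "\<exists>y. \<not> y 0 \<and> accepts (\<lambda>k. y (Suc k)) ts \<and> v \<le> ?s y \<and> y J = c"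
      using assms by (intro exI[of _ "\<lambda>k. 0 < k \<and> y (k - 1)"]) (simp cong: if_cong)
  qed
qed

lemma Nil_in_sat_lang: "[] \<in> sat_lang"
  by (auto simp: sat_lang_def intro!: exI[of _ "[]"])

lemma false_query_notin: "false_query \<notin> sat_lang"
  unfolding false_query_def by (subst codes_in_sat_lang) auto

section \<open>The answer phase\<close>

text \<open>\<open>z\<close> is the whole configuration, seen as a ring of bits. A command rotates
  and outputs with the flags from before its operand is read, because the in-place phase precedes
  the answer.\<close>

fun run_cmds :: "bool list set \<Rightarrow> cmd list \<Rightarrow> flags \<Rightarrow> bool list \<Rightarrow> flags \<times> bool list \<times> bool list" where
  "run_cmds A [] f z = (f, z, [])"
| "run_cmds A ((m, q) # cs) f z =
    (case run_cmds A cs (exec_flags m f (q \<in> A))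
        (if 8 \<le> m \<and> m \<le> 10 then tl z @ [new_bit m f (hd z)] else z) of
       (f', z', w) \<Rightarrow> (f', z', emit (exec_out m f) @ w))"

lemma run_cmds_append:
  "run_cmds A (cs @ ds) f z = (case run_cmds A cs f z of (f', z', w) \<Rightarrow>
     case run_cmds A ds f' z' of (f'', z'', w') \<Rightarrow> (f'', z'', w @ w'))"
  by (induction A cs f z rule: run_cmds.induct) (auto split: prod.splits)

lemma parse_queries_Some: "parse_queries acc (map Some q @ None # t) = (acc @ q) # parse_queries [] t"
  by (induction q arbitrary: acc) auto

lemma parse_qstream: "parse_queries [] (qstream qs) = qs"
  by (induction qs) (auto simp: qstream_def parse_queries_Some)

section \<open>In-place rotation and reading of answers\<close>

context machine
begin

text \<open>The write head stays one cell behind the read head, as the one-way rule requires. The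
  cell under the write head is stale: its bit has been copied one cell to the left or, at the start,
  taken into the control state. At the end \<open>c\<close> fills the last cell.\<close>

lemma inplace_rotate_loop:
  assumes "r \<in> {1, 2}" "m \<le> 10" "k \<le> length zs"
  shows "inplace_phase M (en (Rot r m f c)) (k + 2) (k + 1) 0 v
     (map of_bool (take k zs @ drop k (b # zs))) (en (Ans r m True f)) (map of_bool (zs @ [c]))"
  using assms(3)
proof (induction "length zs - k" arbitrary: k)
  case 0
  let ?z = "map of_bool (take k zs @ drop k (b # zs)) :: nat list"
  have k: "k = length zs" using 0 by simp
  have s: "scan ?z (k + 2) = REnd" using k by (simp add: scan_def)
  have d: "inplace_delta M (en (Rot r m f c)) (scan ?z (k + 2)) (scan v 0) =
      Ip_Step (en (Fin r m f)) 0 Stay (Some (of_bool c)) False Stay"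
    unfolding s using assms by (simp add: M_def)
  have "length (drop (length zs) (b # zs)) = Suc 0" by simp
  then obtain a where a: "drop (length zs) (b # zs) = [a]" by (auto simp: length_Suc_conv simp del: length_drop)
  have z': "put ?z (k + 1) (of_bool c) = map of_bool (zs @ [c])"
    using k a by (simp add: put_def list_update_append)
  have fin: "inplace_phase M (en (Fin r m f)) (k + 2) (k + 1) 0 v (map of_bool (zs @ [c])) (en (Ans r m True f)) (map of_bool (zs @ [c]))"
    by (rule inplace_await) (use assms in \<open>simp add: M_def\<close>)
  show ?case
    by (rule inplace_step[OF d refl refl]) (use z' fin in \<open>auto simp: put_def\<close>)
next
  case (Suc n)
  let ?z = "map of_bool (take k zs @ drop k (b # zs)) :: nat list"
  have k: "k < length zs" using Suc(2) by simp
  have dr: "drop k (b # zs) = (b # zs) ! k # drop k zs" using k by (metis Cons_nth_drop_Suc drop_Suc_Cons length_Cons less_SucI)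
  have s: "scan ?z (k + 2) = Sym (of_bool (zs ! k))"
    using k dr by (simp add: scan_def nth_append)
  have d: "inplace_delta M (en (Rot r m f c)) (scan ?z (k + 2)) (scan v 0) =
      Ip_Step (en (Rot r m f c)) 0 Stay (Some (of_bool (zs ! k))) True Go_Right"
    unfolding s using assms by (simp add: M_def)
  have z': "put ?z (k + 1) (of_bool (zs ! k)) = map of_bool (take (Suc k) zs @ drop (Suc k) (b # zs))"
    using k dr by (simp add: put_def list_update_append take_Suc_conv_app_nth)
  have IH: "inplace_phase M (en (Rot r m f c)) (Suc k + 2) (Suc k + 1) 0 v
     (map of_bool (take (Suc k) zs @ drop (Suc k) (b # zs))) (en (Ans r m True f)) (map of_bool (zs @ [c]))"
    by (rule Suc(1)) (use Suc(2) k in auto)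
  have sh: "shift ?z Go_Right (k + 2) = Suc k + 2" using k by simp
  show ?case
    by (rule inplace_step[OF d refl refl]) (use z' IH sh in \<open>auto simp: put_def simp del: shift.simps(3)\<close>)
qed

lemma inplace_rotate:
  assumes "r \<in> {1, 2}" "8 \<le> m" "m \<le> 10"
  shows "inplace_phase M (en (Ans r m True f)) 1 1 0 v (map of_bool (b # zs)) (en (Ans r m True f))
    (map of_bool (zs @ [new_bit m f b]))"
proof -
  have s: "scan (map of_bool (b # zs) :: nat list) 1 = Sym (of_bool b)" by (simp add: scan_def)
  have d: "inplace_delta M (en (Ans r m True f)) (scan (map of_bool (b # zs)) 1) (scan v 0) =
     Ip_Step (en (Rot r m f (new_bit m f b))) 0 Stay None False Go_Right"
    unfolding s using assms by (simp add: M_def)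
  show ?thesis
    by (rule inplace_step[OF d refl refl])
      (use inplace_rotate_loop[of r m 0 zs f "new_bit m f b" v b] assms in \<open>auto simp: put_def\<close>)
qed

lemma inplace_noop:
  assumes "r \<in> {1, 2}" "m \<le> 11" "\<not> (e \<and> 8 \<le> m \<and> m \<le> 10)"
  shows "inplace_on_conf M (en (Ans r m e f)) u \<tau> (en (Ans r m e f)) u \<tau>"
  unfolding inplace_on_conf_def
proof (intro conjI refl inplace_await)
  fix z v
  show "inplace_delta M (en (Ans r m e f)) (scan z 1) (scan v 0) = Await (en (Ans r m e f))"
    using assms by (cases "scan z 1") (auto simp: M_def)
qed

text \<open>During a pass the first \<open>l\<close> bits of the ring lie on the work tape,
  whichever tape they come from.\<close>

abbreviation uz :: "nat \<Rightarrow> bool list \<Rightarrow> nat list" where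
  "uz l z \<equiv> map of_bool (take l z)"

lemma conf_uz: "conf_string (uz l z) (drop l z) = map of_bool z"
  by (metis append_take_drop_id conf_string_def map_append)

lemma inplace_rotate_conf:
  assumes "r \<in> {1, 2}" "8 \<le> m" "m \<le> 10" "z \<noteq> []" "l \<le> length z" "z' = tl z @ [new_bit m f (hd z)]"
  shows "inplace_on_conf M (en (Ans r m True f)) (uz l z) (drop l z) (en (Ans r m True f)) (uz l z') (drop l z')"
proof -
  obtain b zs where z: "z = b # zs" using assms(4) by (cases z) auto
  show ?thesis
    unfolding inplace_on_conf_def conf_uz using inplace_rotate[OF assms(1-3)] assms(5,6) z by (simp; arith)
qed

lemma answer_false_prefix:
  assumes "r \<in> {1, 2}" "m + k \<le> 10" "answer_phase M as (en (Ans r (m + k) False f)) u \<tau> w q' u' \<tau>'"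
  shows "answer_phase M (replicate k False @ as) (en (Ans r m False f)) u \<tau> w q' u' \<tau>'"
  using assms(2,3)
proof (induction k arbitrary: m)
  case (Suc k)
  have "answer_phase M (replicate k False @ as) (en (Ans r (Suc m) False f)) u \<tau> w q' u' \<tau>'"
    using Suc.IH[of "Suc m"] Suc.prems by simp
  moreover have "answer_delta M (en (Ans r m False f)) False = (en (Ans r (Suc m) False f), None)"
    using assms(1) Suc.prems by (simp add: M_def)
  moreover have "inplace_on_conf M (en (Ans r m False f)) u \<tau> (en (Ans r m False f)) u \<tau>"
    using assms(1) Suc.prems by (intro inplace_noop) auto
  ultimately show ?case
    using answer_read[of M "en (Ans r m False f)" u \<tau> _ u \<tau> False _ None] by (fastforce simp: emit_def)
qed simp

text \<open>Negative answers count the opcode, the empty query completes it, and the operand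
  executes it. Only the in-place phase before the operand can change the configuration.\<close>

lemma answer_run_cmds:
  assumes "r \<in> {1, 2}" "[] \<in> A" "false_query \<notin> A" "\<forall>c\<in>set cs. fst c \<le> 10" "z \<noteq> []" "l \<le> length z"
    "run_cmds A cs f z = (f', z', w)"
  shows "answer_phase M (map (\<lambda>q. q \<in> A) (concat (map cmd_queries cs))) (en (Ans r 0 False f)) (uz l z) (drop l z) w
     (en (Ans r 0 False f')) (uz l z') (drop l z')"
  using assms(4-)
proof (induction cs arbitrary: f z w)
  case Nil
  then show ?case by (simp add: answer_done)
next
  case (Cons c cs)
  obtain m q where c: "c = (m, q)" by (cases c)
  let ?z = "if 8 \<le> m \<and> m \<le> 10 then tl z @ [new_bit m f (hd z)] else z"
  let ?f = "exec_flags m f (q \<in> A)"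
  obtain w2 where w2: "run_cmds A cs ?f ?z = (f', z', w2)" "w = emit (exec_out m f) @ w2"
    using Cons.prems(4) unfolding c by (auto split: prod.splits simp del: exec_flags.simps exec_out.simps)
  have m: "m \<le> 10" using Cons.prems(1) c by simp
  have zz: "?z \<noteq> []" "l \<le> length ?z" using Cons.prems by auto
  have IH: "answer_phase M (map (\<lambda>q. q \<in> A) (concat (map cmd_queries cs))) (en (Ans r 0 False ?f)) (uz l ?z) (drop l ?z) w2
     (en (Ans r 0 False f')) (uz l z') (drop l z')"
    by (rule Cons.IH[OF _ zz w2(1)]) (use Cons.prems in auto)
  have ip: "inplace_on_conf M (en (Ans r m True f)) (uz l z) (drop l z) (en (Ans r m True f)) (uz l ?z) (drop l ?z)"
    using inplace_rotate_conf[OF assms(1), of m z l] inplace_noop[OF assms(1), of m True] Cons.prems m by auto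
  have d: "answer_delta M (en (Ans r m True f)) (q \<in> A) = (en (Ans r 0 False ?f), exec_out m f)"
    using assms(1) m by (simp add: M_def)
  have 1: "answer_phase M ((q \<in> A) # map (\<lambda>q. q \<in> A) (concat (map cmd_queries cs))) (en (Ans r m True f)) (uz l z) (drop l z) w
     (en (Ans r 0 False f')) (uz l z') (drop l z')"
    unfolding w2(2) by (rule answer_read[OF ip d IH])
  have dT: "answer_delta M (en (Ans r m False f)) True = (en (Ans r m True f), None)"
    using assms(1) m by (simp add: M_def)
  have ipT: "inplace_on_conf M (en (Ans r m False f)) (uz l z) (drop l z) (en (Ans r m False f)) (uz l z) (drop l z)"
    using assms(1) m by (intro inplace_noop) auto
  have 2: "answer_phase M (True # (q \<in> A) # map (\<lambda>q. q \<in> A) (concat (map cmd_queries cs))) (en (Ans r (0 + m) False f)) (uz l z) (drop l z) w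
     (en (Ans r 0 False f')) (uz l z') (drop l z')"
    using answer_read[OF ipT dT 1] by (simp add: emit_def)
  from answer_false_prefix[OF assms(1) _ 2] m show ?case
    using assms(2,3) by (simp add: c cmd_queries_def)
qed

end

section \<open>Isolation and compression\<close>

lemma concat_upt_mult: "concat (map (\<lambda>a. map (\<lambda>b. a * m + b) [0..<m]) [0..<k]) = [0..<k * m]" for k m :: nat
proof (induction k)
  case (Suc k)
  have "[0..<Suc k * m] = [0..<k * m] @ [k * m..<k * m + m]"
    using upt_add_eq_append[of 0 "k * m" m] by (simp add: add.commute)
  moreover have "[k * m..<k * m + m] = map (\<lambda>b. k * m + b) [0..<m]"
    using map_add_upt[of "k * m" m] by (simp add: add.commute)
  ultimately show ?case using Suc by simp
qed simp

text \<open>Two nested counters enumerate the numbers \<open>a * m + b\<close> in increasing order.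
  This joins the two registers of a threshold, and likewise the block and slot numbers on the
  tape.\<close>

lemma concat_nested_upt:
  "concat (map (\<lambda>a. concat (map (\<lambda>b. f (a * m + b)) [0..<m])) [0..<k]) = concat (map f [0..<k * m])" for k m :: nat
  unfolding concat_upt_mult[symmetric] by (induction k) (simp_all add: o_def)

section \<open>Weights, ambiguity and isolation\<close>

context tape
begin

abbreviation "run_A \<equiv> run_cmds sat_lang"

definition wt :: "(nat \<Rightarrow> nat) \<Rightarrow> (nat \<Rightarrow> bool) \<Rightarrow> nat" where
  "wt w y = (\<Sum>k<num_vars. if y k then w (Suc k) else 0)"

definition sat :: bool where
  "sat \<longleftrightarrow> (\<exists>y. accepts y ts)"

definition heavy :: "(nat \<Rightarrow> nat) \<Rightarrow> nat \<Rightarrow> nat \<Rightarrow> bool \<Rightarrow> bool" where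
  "heavy w J v c \<longleftrightarrow> (\<exists>y. accepts y ts \<and> v \<le> wt w y \<and> y (J - 1) = c)"

text \<open>The thresholds that a value meets form an initial segment, so once there are solutions,
  equal answers mean equal maxima. Without any solution every variable is ambiguous, which is why
  overwriting also waits for a positive answer.\<close>

definition ambiguous :: "(nat \<Rightarrow> nat) \<Rightarrow> nat \<Rightarrow> bool" where
  "ambiguous w J \<longleftrightarrow> (\<forall>v<Bk * Bk. heavy w J v False = heavy w J v True)"

definition prefers_true :: "(nat \<Rightarrow> nat) \<Rightarrow> nat \<Rightarrow> bool" where
  "prefers_true w J \<longleftrightarrow> (\<exists>v<Bk * Bk. heavy w J v True \<and> \<not> heavy w J v False)"

lemma qry_sat: "0 < J \<Longrightarrow> qry num_vars w J v c \<in> sat_lang \<longleftrightarrow> heavy w J v c"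
  unfolding qry_def heavy_def wt_def by (rule qry_in_sat_lang)

text \<open>Threshold 0 is met by every solution, so the test of any single variable already reveals
  satisfiability.\<close>

lemma sat_heavy: "sat \<longleftrightarrow> (\<exists>v<Bk * Bk. heavy w J v False \<or> heavy w J v True)"
proof
  assume sat
  then obtain y where "accepts y ts" by (auto simp: sat_def)
  then have "heavy w J 0 (y (J - 1))" by (auto simp: heavy_def)
  then have "heavy w J 0 False \<or> heavy w J 0 True" by (cases "y (J - 1)") auto
  moreover have "0 < Bk * Bk" by simp
  ultimately show "\<exists>v<Bk * Bk. heavy w J v False \<or> heavy w J v True" by blast
qed (auto simp: sat_def heavy_def)

text \<open>There are fewer than \<open>2 ^ L\<close> variables, each of weight below
  \<open>2 ^ L\<close>. Hence the thresholds that are asked reach up to every maximum.\<close>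

lemma wt_less:
  assumes "\<And>S. w S < Bk"
  shows "wt w y < Bk * Bk"
proof -
  have "wt w y \<le> (\<Sum>k<num_vars. Bk)"
    unfolding wt_def by (rule sum_mono) (use assms in \<open>auto intro: less_imp_le\<close>)
  also have "\<dots> = num_vars * Bk" by simp
  also have "\<dots> < Bk * Bk" using num_vars_less by simp
  finally show ?thesis .
qed

lemma ex_max_wt:
  assumes "\<And>S. w S < Bk" "P y0"
  shows "\<exists>y. P y \<and> (\<forall>y'. P y' \<longrightarrow> wt w y' \<le> wt w y)"
proof -
  have "\<exists>y. P y \<and> (\<forall>y'. P y' \<longrightarrow> wt w y' \<le> wt w y)"
    using ex_has_greatest_nat[of P y0 "wt w" "Bk * Bk"] assms(2) wt_less[of w, OF assms(1)] by (auto intro: less_imp_le)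
  then show ?thesis .
qed

text \<open>Let \<open>y\<close> be a heaviest solution. If variable \<open>k\<close> could take the
  other value at the same total weight, both values would meet exactly the thresholds up to the
  maximum, and \<open>k\<close> would be ambiguous. So the maximum is met by the value in
  \<open>y\<close> alone, and every other threshold that is met at all is met by that value.\<close>

lemma isolated_solution:
  assumes "\<And>S. w S < Bk" sat "\<forall>k<num_vars. \<not> ambiguous w (Suc k)"
  shows "\<exists>y. accepts y ts \<and> (\<forall>k<num_vars. prefers_true w (Suc k) = y k)"
proof -
  obtain y0 where "accepts y0 ts" using assms(2) by (auto simp: sat_def)
  with ex_max_wt[of w "\<lambda>y. accepts y ts" y0, OF assms(1)]
  obtain y where y: "accepts y ts" "\<And>y'. accepts y' ts \<Longrightarrow> wt w y' \<le> wt w y" by blast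
  have "prefers_true w (Suc k) = y k" if k: "k < num_vars" for k
  proof -
    have self: "heavy w (Suc k) v (y k)" if "v \<le> wt w y" for v
      using y(1) that by (auto simp: heavy_def)
    have le: "v \<le> wt w y" if "heavy w (Suc k) v c" for v c
    proof -
      from that obtain y' where y': "accepts y' ts" "v \<le> wt w y'" by (auto simp: heavy_def)
      from y'(2) y(2)[OF y'(1)] show ?thesis by (rule order_trans)
    qed
    have other: "\<not> heavy w (Suc k) (wt w y) (\<not> y k)"
    proof
      assume h: "heavy w (Suc k) (wt w y) (\<not> y k)"
      have "heavy w (Suc k) v c" if "v \<le> wt w y" for v c
      proof (cases "c = y k")
        case True
        then show ?thesis using self[OF that] by simp
      next
        case False
        then have "c = (\<not> y k)" by auto
        with h that show ?thesis unfolding heavy_def by (meson order_trans)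
      qed
      then have "ambiguous w (Suc k)" using le unfolding ambiguous_def by blast
      then show False using assms(3) k by simp
    qed
    show ?thesis
    proof (cases "y k")
      case True
      then have "heavy w (Suc k) (wt w y) True" "\<not> heavy w (Suc k) (wt w y) False"
        using self[of "wt w y"] other by auto
      then show ?thesis using True wt_less[of w y, OF assms(1)] by (auto simp: prefers_true_def)
    next
      case False
      then have "heavy w (Suc k) v False" if "heavy w (Suc k) v True" for v
        using self[of v] le[OF that] by simp
      then show ?thesis using False by (auto simp: prefers_true_def)
    qed
  qed
  with y(1) show ?thesis by blast
qed

lemma wt_upd:
  assumes "k < num_vars"
  shows "wt (w(Suc k := C)) y = (\<Sum>i\<in>{..<num_vars} - {k}. if y i then w (Suc i) else 0) + (if y k then C else 0)"
proof -
  have "wt (w(Suc k := C)) y = (\<Sum>i\<in>{..<num_vars} - {k}. if y i then (w(Suc k := C)) (Suc i) else 0) + (if y k then C else 0)"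
    unfolding wt_def using assms by (subst sum.remove[of _ k]) auto
  also have "(\<Sum>i\<in>{..<num_vars} - {k}. if y i then (w(Suc k := C)) (Suc i) else 0) =
    (\<Sum>i\<in>{..<num_vars} - {k}. if y i then w (Suc i) else 0)"
    by (rule sum.cong) auto
  finally show ?thesis .
qed

text \<open>If both values of variable \<open>k\<close> attain the same maximal weight, the weight of \<open>k\<close> is the
  difference of two maxima that do not involve it.\<close>

lemma ambiguous_unique:
  assumes w: "\<And>S. w S < Bk" and C: "C < Bk" and sat and k: "k < num_vars" and amb: "ambiguous w (Suc k)"
  shows "ambiguous (w(Suc k := C)) (Suc k) \<longleftrightarrow> C = w (Suc k)"
proof
  assume "C = w (Suc k)"
  then show "ambiguous (w(Suc k := C)) (Suc k)" using amb by (simp add: fun_upd_idem)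
next
  assume amb': "ambiguous (w(Suc k := C)) (Suc k)"
  define r where "r y = (\<Sum>i\<in>{..<num_vars} - {k}. if y i then w (Suc i) else 0)" for y :: "nat \<Rightarrow> bool"
  have wtr: "wt (w(Suc k := D)) y = r y + (if y k then D else 0)" for D y
    unfolding r_def by (rule wt_upd[OF k])
  have w0: "w(Suc k := w (Suc k)) = w" by simp
  \<comment> \<open>At threshold 0 ambiguity says that both values of the variable occur among the
    solutions or neither does; as there is a solution, both maxima exist.\<close>
  have "heavy w (Suc k) 0 False = heavy w (Suc k) 0 True"
    using amb by (simp add: ambiguous_def)
  moreover have "heavy w (Suc k) 0 False \<or> heavy w (Suc k) 0 True"
  proof -
    obtain y where "accepts y ts" using \<open>sat\<close> by (auto simp: sat_def)
    then have "heavy w (Suc k) 0 (y k)" by (auto simp: heavy_def)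
    then show ?thesis by (cases "y k") auto
  qed
  ultimately obtain y0 y1 where y: "accepts y0 ts" "\<not> y0 k" "accepts y1 ts" "y1 k"
    by (auto simp: heavy_def)
  obtain m0 where m0: "accepts m0 ts" "\<not> m0 k" "\<And>y. accepts y ts \<Longrightarrow> \<not> y k \<Longrightarrow> wt w y \<le> wt w m0"
    using ex_max_wt[of w "\<lambda>y. accepts y ts \<and> \<not> y k" y0, OF w] y by blast
  obtain m1 where m1: "accepts m1 ts" "m1 k" "\<And>y. accepts y ts \<Longrightarrow> y k \<Longrightarrow> wt w y \<le> wt w m1"
    using ex_max_wt[of w "\<lambda>y. accepts y ts \<and> y k" y1, OF w] y by blast
  \<comment> \<open>Changing the weight of the variable to \<open>D\<close> shifts the totals of all
    solutions on one side equally, so \<open>m0\<close> and \<open>m1\<close> stay maximal for every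
    \<open>D\<close>. Equality of the two maxima then fixes \<open>D\<close> as
    \<open>r m0 - r m1\<close>.\<close>
  have key: "r m0 = r m1 + D" if D: "D < Bk" and a: "ambiguous (w(Suc k := D)) (Suc k)" for D
  proof -
    let ?w = "w(Suc k := D)"
    have wl: "?w S < Bk" for S using w D by (cases "S = Suc k") auto
    have mx0: "wt ?w y \<le> wt ?w m0" if "accepts y ts" "\<not> y k" for y
      using m0(3)[OF that] that(2) m0(2) wtr[of "w (Suc k)"] unfolding w0 by (simp add: wtr)
    have mx1: "wt ?w y \<le> wt ?w m1" if "accepts y ts" "y k" for y
      using m1(3)[OF that] that(2) m1(2) wtr[of "w (Suc k)"] unfolding w0 by (simp add: wtr)
    have h0: "heavy ?w (Suc k) v False \<longleftrightarrow> v \<le> wt ?w m0" for v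
    proof
      assume "heavy ?w (Suc k) v False"
      then obtain y where y: "accepts y ts" "v \<le> wt ?w y" "\<not> y k" by (auto simp: heavy_def)
      from y(2) mx0[OF y(1,3)] show "v \<le> wt ?w m0" by (rule order_trans)
    qed (use m0(1,2) in \<open>auto simp: heavy_def\<close>)
    have h1: "heavy ?w (Suc k) v True \<longleftrightarrow> v \<le> wt ?w m1" for v
    proof
      assume "heavy ?w (Suc k) v True"
      then obtain y where y: "accepts y ts" "v \<le> wt ?w y" "y k" by (auto simp: heavy_def)
      from y(2) mx1[OF y(1,3)] show "v \<le> wt ?w m1" by (rule order_trans)
    qed (use m1(1,2) in \<open>auto simp: heavy_def\<close>)
    have "wt ?w m0 \<le> wt ?w m1" "wt ?w m1 \<le> wt ?w m0"
    proof -
      have e: "v < Bk * Bk \<Longrightarrow> (v \<le> wt ?w m0) = (v \<le> wt ?w m1)" for v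
        using a h0 h1 by (simp add: ambiguous_def)
      show "wt ?w m0 \<le> wt ?w m1" using e[OF wt_less[of ?w m0, OF wl]] by simp
      show "wt ?w m1 \<le> wt ?w m0" using e[OF wt_less[of ?w m1, OF wl]] by simp
    qed
    then show ?thesis using wtr m0(2) m1(2) by simp
  qed
  from key[OF C amb'] key[OF w, of "Suc k"] amb show "C = w (Suc k)" by (simp add: w0)
qed

section \<open>Effect of command lists on flags and tape\<close>

abbreviation (input) test_pairs :: "(nat \<Rightarrow> nat) \<Rightarrow> nat \<Rightarrow> nat list \<Rightarrow> cmd list" where
  "test_pairs w J vs \<equiv> concat (map (\<lambda>v. [(1, qry num_vars w J v False), (2, qry num_vars w J v True)]) vs)"

lemma run_pairs:
  assumes "0 < J"
  shows "\<exists>p'. run_A (test_pairs w J vs)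
     (eq, gt, p, s, uq, fo, dn, ac) z =
    ((eq \<and> (\<forall>v\<in>set vs. heavy w J v False = heavy w J v True),
      gt \<or> (\<exists>v\<in>set vs. heavy w J v True \<and> \<not> heavy w J v False), p',
      s \<or> (\<exists>v\<in>set vs. heavy w J v False \<or> heavy w J v True), uq, fo, dn, ac), z, [])"
proof (induction vs arbitrary: eq gt p s)
  case (Cons v vs)
  obtain p' where "run_A (test_pairs w J vs)
     (eq \<and> heavy w J v False = heavy w J v True, gt \<or> heavy w J v True \<and> \<not> heavy w J v False, heavy w J v False,
      s \<or> heavy w J v False \<or> heavy w J v True, uq, fo, dn, ac) z =
    (((eq \<and> heavy w J v False = heavy w J v True) \<and> (\<forall>v\<in>set vs. heavy w J v False = heavy w J v True),
      (gt \<or> heavy w J v True \<and> \<not> heavy w J v False) \<or> (\<exists>v\<in>set vs. heavy w J v True \<and> \<not> heavy w J v False), p',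
      (s \<or> heavy w J v False \<or> heavy w J v True) \<or> (\<exists>v\<in>set vs. heavy w J v False \<or> heavy w J v True), uq, fo, dn, ac), z, [])"
    using Cons.IH by blast
  then show ?case
    by (intro exI[of _ p']) (auto simp: qry_sat[OF assms] emit_def)
qed simp

lemma run_test:
  assumes "0 < J"
  shows "\<exists>p'. run_A (testc num_vars w J) (eq, gt, p, s, uq, fo, dn, ac) z =
    ((ambiguous w J, prefers_true w J, p', s \<or> sat, uq, fo, dn, ac), z, [])"
proof -
  have "testc num_vars w J = (0, []) # test_pairs w J [0..<Bk * Bk]"
    unfolding testc_def using concat_nested_upt[where f = "\<lambda>v. [(1::nat, qry num_vars w J v False), (2, qry num_vars w J v True)]" and m = Bk and k = Bk] by simp
  then have r: "run_A (testc num_vars w J) (eq, gt, p, s, uq, fo, dn, ac) z =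
     run_A (test_pairs w J [0..<Bk * Bk])
       (True, False, p, s, uq, fo, dn, ac) z"
    by (simp add: emit_def split: prod.splits)
  have e: "(True \<and> (\<forall>v\<in>set [0..<Bk * Bk]. heavy w J v False = heavy w J v True)) = ambiguous w J"
    "(False \<or> (\<exists>v\<in>set [0..<Bk * Bk]. heavy w J v True \<and> \<not> heavy w J v False)) = prefers_true w J"
    "(\<exists>v\<in>set [0..<Bk * Bk]. heavy w J v False \<or> heavy w J v True) = sat"
    unfolding ambiguous_def prefers_true_def sat_heavy[of w J] set_upt atLeastLessThan_iff by auto
  from run_pairs[OF assms, of w "[0..<Bk * Bk]" True False p s uq fo dn ac z] show ?thesis
    unfolding r e .
qed

lemma run_mark:
  "\<exists>e' g' p'. run_A (concat (map (\<lambda>k. testc num_vars w (Suc k) @ [(3, [])]) ks)) (eq, gt, p, s, uq, fo, dn, ac) z =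
    ((e', g', p', s \<or> ks \<noteq> [] \<and> sat, uq \<and> (\<forall>k\<in>set ks. \<not> ambiguous w (Suc k)), fo, dn, ac), z, [])"
proof (induction ks arbitrary: eq gt p s uq)
  case (Cons k ks)
  obtain p1 where 1: "run_A (testc num_vars w (Suc k)) (eq, gt, p, s, uq, fo, dn, ac) z =
    ((ambiguous w (Suc k), prefers_true w (Suc k), p1, s \<or> sat, uq, fo, dn, ac), z, [])"
    using run_test by blast
  obtain e' g' p' where "run_A (concat (map (\<lambda>k. testc num_vars w (Suc k) @ [(3, [])]) ks))
      (ambiguous w (Suc k), prefers_true w (Suc k), p1, s \<or> sat, uq \<and> \<not> ambiguous w (Suc k), fo, dn, ac) z =
    ((e', g', p', (s \<or> sat) \<or> ks \<noteq> [] \<and> sat, (uq \<and> \<not> ambiguous w (Suc k)) \<and> (\<forall>k\<in>set ks. \<not> ambiguous w (Suc k)), fo, dn, ac), z, [])"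
    using Cons.IH by blast
  then show ?case
    by (intro exI[of _ e'] exI[of _ g'] exI[of _ p']) (auto simp: run_cmds_append 1 emit_def)
qed auto

lemma run_emit:
  "\<exists>e' g' p'. run_A (concat (map (\<lambda>k. testc num_vars w (Suc k) @ [(4, [])]) ks)) (eq, gt, p, s, uq, fo, dn, ac) z =
    ((e', g', p', s \<or> ks \<noteq> [] \<and> sat, uq, fo, dn, ac), z, if uq \<and> \<not> fo then map (\<lambda>k. prefers_true w (Suc k)) ks else [])"
proof (induction ks arbitrary: eq gt p s uq)
  case (Cons k ks)
  obtain p1 where 1: "run_A (testc num_vars w (Suc k)) (eq, gt, p, s, uq, fo, dn, ac) z =
    ((ambiguous w (Suc k), prefers_true w (Suc k), p1, s \<or> sat, uq, fo, dn, ac), z, [])"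
    using run_test by blast
  obtain e' g' p' where "run_A (concat (map (\<lambda>k. testc num_vars w (Suc k) @ [(4, [])]) ks))
      (ambiguous w (Suc k), prefers_true w (Suc k), p1, s \<or> sat, uq, fo, dn, ac) z =
    ((e', g', p', (s \<or> sat) \<or> ks \<noteq> [] \<and> sat, uq, fo, dn, ac), z, if uq \<and> \<not> fo then map (\<lambda>k. prefers_true w (Suc k)) ks else [])"
    using Cons.IH by blast
  then show ?case
    by (intro exI[of _ e'] exI[of _ g'] exI[of _ p']) (auto simp: run_cmds_append 1 emit_def)
qed auto

definition isolates :: "(nat \<Rightarrow> nat) \<Rightarrow> bool" where
  "isolates w \<longleftrightarrow> (\<forall>k<num_vars. \<not> ambiguous w (Suc k))"

definition solution :: "(nat \<Rightarrow> nat) \<Rightarrow> bool list" where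
  "solution w = map (\<lambda>k. prefers_true w (Suc k)) [0..<num_vars]"

text \<open>Once a solution has been found, command 4 is silent, so the output is the solution of
  the first isolating block alone. Command 5 prepares the flag \<open>uq\<close> for the next
  block.\<close>

lemma run_search:
  "\<exists>e' g' p'. run_A (concat (map (\<lambda>I.
       (search_block g I)) Is))
      (eq, gt, p, s, True, fo, dn, ac) z =
    ((e', g', p', s \<or> Is \<noteq> [] \<and> num_vars \<noteq> 0 \<and> sat, True, fo \<or> (\<exists>I\<in>set Is. isolates (g I)), dn, ac), z,
      if fo then [] else case find (\<lambda>I. isolates (g I)) Is of None \<Rightarrow> [] | Some I \<Rightarrow> solution (g I))"
proof (induction Is arbitrary: eq gt p s fo)
  case (Cons I Is)
  let ?n = "[0..<num_vars]"
  obtain e1 g1 p1 where 1: "run_A (concat (map (\<lambda>k. testc num_vars (g I) (Suc k) @ [(3, [])]) ?n)) (eq, gt, p, s, True, fo, dn, ac) z =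
    ((e1, g1, p1, s \<or> ?n \<noteq> [] \<and> sat, True \<and> (\<forall>k\<in>set ?n. \<not> ambiguous (g I) (Suc k)), fo, dn, ac), z, [])"
    using run_mark by blast
  have iso: "(True \<and> (\<forall>k\<in>set ?n. \<not> ambiguous (g I) (Suc k))) = isolates (g I)" by (auto simp: isolates_def)
  let ?s = "s \<or> ?n \<noteq> [] \<and> sat"
  obtain e2 g2 p2 where 2: "run_A (concat (map (\<lambda>k. testc num_vars (g I) (Suc k) @ [(4, [])]) ?n)) (e1, g1, p1, ?s, isolates (g I), fo, dn, ac) z =
    ((e2, g2, p2, ?s \<or> ?n \<noteq> [] \<and> sat, isolates (g I), fo, dn, ac), z, if isolates (g I) \<and> \<not> fo then solution (g I) else [])"
    using run_emit unfolding solution_def by blast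
  obtain e3 g3 p3 where 3: "run_A (concat (map (\<lambda>I.
       concat (map (\<lambda>k. testc num_vars (g I) (Suc k) @ [(3, [])]) ?n) @
       concat (map (\<lambda>k. testc num_vars (g I) (Suc k) @ [(4, [])]) ?n) @ [(5, [])]) Is))
      (e2, g2, p2, ?s \<or> ?n \<noteq> [] \<and> sat, True, fo \<or> isolates (g I), dn, ac) z =
    ((e3, g3, p3, (?s \<or> ?n \<noteq> [] \<and> sat) \<or> Is \<noteq> [] \<and> num_vars \<noteq> 0 \<and> sat, True, (fo \<or> isolates (g I)) \<or> (\<exists>I\<in>set Is. isolates (g I)), dn, ac), z,
      if fo \<or> isolates (g I) then [] else case find (\<lambda>I. isolates (g I)) Is of None \<Rightarrow> [] | Some I \<Rightarrow> solution (g I))"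
    using Cons.IH by blast
  have 5: "run_A [(5, [])] (e2, g2, p2, s', u, fo, dn, ac) z = ((e2, g2, p2, s', True, fo \<or> u, dn, ac), z, [])" for s' u
    by (simp add: emit_def)
  show ?case
    by (intro exI[of _ e3] exI[of _ g3] exI[of _ p3],
        simp only: list.map concat.simps run_cmds_append 1[unfolded iso] 2 3 5 prod.case)
      (auto simp: emit_def)
qed auto

text \<open>The ring at the start of an answer phase, with the cleared work tape in front.\<close>

definition with_tape :: "(nat \<Rightarrow> nat \<Rightarrow> nat) \<Rightarrow> bool list" where
  "with_tape g = replicate L False @ T g"

definition put2 :: "(nat \<Rightarrow> nat \<Rightarrow> nat) \<Rightarrow> nat \<Rightarrow> nat \<Rightarrow> nat \<Rightarrow> nat \<Rightarrow> nat \<Rightarrow> nat \<Rightarrow> nat" where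
  "put2 g I J v v' = g(I := (g I)(J := v', 0 := v))"

lemma new_bit_inactive: "\<not> f_ac f \<Longrightarrow> new_bit m f b = b"
  by (simp add: new_bit_def)

lemma exec_flags_rotate: "8 \<le> m \<Longrightarrow> exec_flags m f d = f"
  by (cases f) auto

lemma exec_out_rotate: "8 \<le> m \<Longrightarrow> exec_out m f = None"
  by (cases f) auto

text \<open>Each treated bit goes behind the cells not yet reached, so as long as the ring is not
  exhausted, every command meets an untouched cell.\<close>

lemma run_rotate:
  assumes "\<forall>m\<in>set ms. 8 \<le> m \<and> m \<le> 10" "length ms \<le> length z"
  shows "run_cmds A (map (\<lambda>m. (m, [])) ms) f z = (f, drop (length ms) z @ map2 (\<lambda>m b. new_bit m f b) ms z, [])"
  using assms
proof (induction ms arbitrary: z)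
  case (Cons m ms)
  then obtain b zs where z: "z = b # zs" by (cases z) auto
  have m: "8 \<le> m" "m \<le> 10" using Cons.prems by auto
  have "run_cmds A (map (\<lambda>m. (m, [])) ms) f (zs @ [new_bit m f b]) =
    (f, drop (length ms) (zs @ [new_bit m f b]) @ map2 (\<lambda>m b. new_bit m f b) ms (zs @ [new_bit m f b]), [])"
    by (rule Cons.IH) (use Cons.prems z in auto)
  moreover have "drop (length ms) (zs @ [new_bit m f b]) = drop (length ms) zs @ [new_bit m f b]"
    using Cons.prems z by simp
  moreover have "map2 (\<lambda>m b. new_bit m f b) ms (zs @ [new_bit m f b]) = map2 (\<lambda>m b. new_bit m f b) ms zs"
    using Cons.prems(2) z by (simp add: zip_append1 zip_append2)
  ultimately show ?case
    using m by (simp add: z exec_flags_rotate exec_out_rotate emit_def del: exec_flags.simps exec_out.simps)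
qed simp

definition tape_ins :: "nat \<Rightarrow> nat \<Rightarrow> nat \<Rightarrow> nat \<Rightarrow> nat \<Rightarrow> nat" where
  "tape_ins I J v v' p = (if p < Bk * Bk * L then ins I J v v' (p div L div Bk) (p div L mod Bk) (p mod L) else 8)"

lemma concat_map_slots:
  "concat (map (\<lambda>X. concat (map (\<lambda>Y. map (\<lambda>k. f X Y k) [0..<L]) [0..<Bk])) [0..<Bk]) =
   map (\<lambda>p. f (p div L div Bk) (p div L mod Bk) (p mod L)) [0..<Bk * Bk * L]"
proof -
  have a: "map (\<lambda>k. f X Y k) [0..<L] = map (\<lambda>p. f (p div L div Bk) (p div L mod Bk) (p mod L)) (map (\<lambda>k. (X * Bk + Y) * L + k) [0..<L])"
    if "Y < Bk" for X Y
    using that L_pos by auto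
  let ?h = "\<lambda>p. f (p div L div Bk) (p div L mod Bk) (p mod L)"
  have "concat (map (\<lambda>X. concat (map (\<lambda>Y. map (\<lambda>k. f X Y k) [0..<L]) [0..<Bk])) [0..<Bk]) =
    concat (map (\<lambda>X. concat (map (\<lambda>Y. map ?h (map (\<lambda>k. (X * Bk + Y) * L + k) [0..<L])) [0..<Bk])) [0..<Bk])"
    by (rule arg_cong[where f = concat], rule map_cong[OF refl], rule arg_cong[where f = concat],
        rule map_cong[OF refl], rule a, simp)
  also have "\<dots> = concat (map (\<lambda>q. map ?h (map (\<lambda>k. q * L + k) [0..<L])) [0..<Bk * Bk])"
    by (rule concat_nested_upt)
  also have "\<dots> = map ?h (concat (map (\<lambda>q. map (\<lambda>k. q * L + k) [0..<L]) [0..<Bk * Bk]))"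
    by (simp add: map_concat o_def)
  also have "\<dots> = map ?h [0..<Bk * Bk * L]"
    unfolding concat_upt_mult ..
  finally show ?thesis .
qed

lemma ovrc_eq: "ovrc I J v v' = map (\<lambda>m. (m, [])) (replicate L 8 @ map (tape_ins I J v v') [0..<length \<tau>0])"
proof -
  have s: "[0..<length \<tau>0] = [0..<Bk * Bk * L] @ [Bk * Bk * L..<length \<tau>0]"
    using upt_add_eq_append[of 0 "Bk * Bk * L" "length \<tau>0 - Bk * Bk * L"] long by simp
  have 1: "map (tape_ins I J v v') [0..<Bk * Bk * L] = map (\<lambda>p. ins I J v v' (p div L div Bk) (p div L mod Bk) (p mod L)) [0..<Bk * Bk * L]"
    by (auto simp: tape_ins_def)
  have 2: "map (tape_ins I J v v') [Bk * Bk * L..<length \<tau>0] = replicate (length \<tau>0 - Bk * Bk * L) 8"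
    by (rule nth_equalityI) (auto simp: tape_ins_def)
  show ?thesis
    unfolding ovrc_def s map_append 1 2
    using concat_map_slots[of "\<lambda>X Y k. (ins I J v v' X Y k, [])"] by (simp add: o_def)
qed

text \<open>A pass has exactly as many commands as the ring has cells. Hence nothing is left in
  front, and the treated cells stand in their original order.\<close>

lemma run_overwrite:
  assumes "I < Bk" "J < Bk" "0 < J"
  shows "run_A (ovrc I J v v') f (with_tape g) = (f, with_tape (if f_ac f then put2 g I J v v' else g), [])"
proof -
  let ?ms = "replicate L 8 @ map (tape_ins I J v v') [0..<length \<tau>0]"
  have r: "\<forall>m\<in>set ?ms. 8 \<le> m \<and> m \<le> 10" by (auto simp: tape_ins_def ins_def)
  have len: "length ?ms = length (with_tape g)" by (simp add: with_tape_def)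
  have "map2 (\<lambda>m b. new_bit m f b) ?ms (with_tape g) = with_tape (if f_ac f then put2 g I J v v' else g)"
  proof (cases "f_ac f")
    case False
    then have "map2 (\<lambda>m b. new_bit m f b) ?ms (with_tape g) = with_tape g"
      by (auto simp: new_bit_inactive with_tape_def intro!: nth_equalityI simp: nth_append)
    with False show ?thesis by simp
  next
    case True
    have a: "map2 (\<lambda>m b. new_bit m f b) (map (tape_ins I J v v') [0..<length \<tau>0]) (T g) = T (put2 g I J v v')"
    proof (rule nth_equalityI)
      fix p assume "p < length (map2 (\<lambda>m b. new_bit m f b) (map (tape_ins I J v v') [0..<length \<tau>0]) (T g))"
      then have p: "p < length \<tau>0" by simp
      then show "map2 (\<lambda>m b. new_bit m f b) (map (tape_ins I J v v') [0..<length \<tau>0]) (T g) ! p = T (put2 g I J v v') ! p"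
        using True assms(3) by (auto simp: nth_T new_bit_def tape_ins_def ins_def put2_def fun_upd_def)
    qed simp
    have b: "map2 (\<lambda>m b. new_bit m f b) (replicate L 8) (replicate L False) = replicate L False"
      by (rule nth_equalityI) (auto simp: new_bit_def)
    show ?thesis
      using True a b by (simp add: with_tape_def zip_append)
  qed
  then show ?thesis
    unfolding ovrc_eq using run_rotate[OF r, of "with_tape g" sat_lang f] len by simp
qed

end

section \<open>Compressing and restoring all blocks\<close>

lemma foldl_upd_distinct:
  "distinct Is \<Longrightarrow> foldl (\<lambda>h I. h(I := F I (h I))) h Is = (\<lambda>I. if I \<in> set Is then F I (h I) else h I)"
proof (induction Is arbitrary: h)
  case (Cons I Is)
  then show ?case by (auto simp: fun_eq_iff fun_upd_apply)
qed simp

text \<open>Meant for the candidates of an erased weight, exactly one of which passes the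
  test.\<close>

lemma foldl_select:
  "distinct Cs \<Longrightarrow> foldl (\<lambda>r C. if C = c then F r else r) r Cs = (if c \<in> set Cs then F r else r)"
proof (induction Cs arbitrary: r)
  case (Cons C Cs)
  then show ?case by (cases "C = c") auto
qed simp

context tape
begin

text \<open>Serves both rounds: compressing a variable and trying a candidate weight are the same
  commands, with different \<open>w\<close>, \<open>v\<close> and \<open>v'\<close>.\<close>

lemma run_compress_unit:
  assumes "I < Bk" "k < num_vars" "a = (ambiguous w (Suc k) \<and> \<not> dn \<and> \<not> fo \<and> (s \<or> sat))"
  shows "\<exists>e' g' p'. run_A (testc num_vars w (Suc k) @ [(7, [])] @ ovrc I (Suc k) v v')
      (eq, gt, p, s, uq, fo, dn, ac) (with_tape h) =
    ((e', g', p', s \<or> sat, uq, fo, dn \<or> a, a), with_tape (if a then put2 h I (Suc k) v v' else h), [])"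
proof -
  have k: "Suc k < Bk" using assms(2) num_vars_less
    by (metis Suc_lessI le_less_trans less_imp_le_nat linorder_not_le not_less_eq)
  obtain p1 where 1: "run_A (testc num_vars w (Suc k)) (eq, gt, p, s, uq, fo, dn, ac) (with_tape h) =
    ((ambiguous w (Suc k), prefers_true w (Suc k), p1, s \<or> sat, uq, fo, dn, ac), with_tape h, [])"
    using run_test by blast
  let ?f = "(ambiguous w (Suc k), prefers_true w (Suc k), p1, s \<or> sat, uq, fo, dn \<or> a, a)"
  have 2: "run_A [(7, [])] (ambiguous w (Suc k), prefers_true w (Suc k), p1, s \<or> sat, uq, fo, dn, ac) (with_tape h) =
    (?f, with_tape h, [])"
    unfolding assms(3) by (simp add: emit_def Let_def)
  have 3: "run_A (ovrc I (Suc k) v v') ?f (with_tape h) =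
    (?f, with_tape (if a then put2 h I (Suc k) v v' else h), [])"
    using run_overwrite[OF assms(1) k, of v v' ?f h] by (simp add: f_ac_def)
  show ?thesis
    by (intro exI[of _ "ambiguous w (Suc k)"] exI[of _ "prefers_true w (Suc k)"] exI[of _ p1])
      (simp only: run_cmds_append 1 2 3 prod.case append_Nil)
qed

definition first_ambiguous :: "(nat \<Rightarrow> nat) \<Rightarrow> nat list \<Rightarrow> nat option" where
  "first_ambiguous w ks = find (\<lambda>k. ambiguous w (Suc k)) ks"

text \<open>The flag \<open>dn\<close> bars every overwrite after the first one, so of the ambiguous
  variables of a block only the first is compressed.\<close>

lemma run_compress_block:
  assumes "I < Bk" "\<forall>k\<in>set ks. k < num_vars"
  shows "\<exists>e' g' p' dn' ac'. run_A (concat (map (\<lambda>k. testc num_vars w (Suc k) @ [(7, [])] @ ovrc I (Suc k) (Suc k) v) ks))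
      (eq, gt, p, s, uq, fo, dn, ac) (with_tape h) =
    ((e', g', p', s \<or> ks \<noteq> [] \<and> sat, uq, fo, dn', ac'),
     with_tape (if dn \<or> fo \<or> \<not> (s \<or> sat) then h else case first_ambiguous w ks of None \<Rightarrow> h
       | Some k \<Rightarrow> put2 h I (Suc k) (Suc k) v), [])"
  using assms(2)
proof (induction ks arbitrary: eq gt p s dn ac h)
  case Nil
  then show ?case by (auto simp: first_ambiguous_def)
next
  case (Cons k ks)
  define a where "a = (ambiguous w (Suc k) \<and> \<not> dn \<and> \<not> fo \<and> (s \<or> sat))"
  let ?h = "if a then put2 h I (Suc k) (Suc k) v else h"
  have k: "k < num_vars" using Cons.prems by simp
  have prem: "\<forall>k\<in>set ks. k < num_vars" using Cons.prems by simp
  obtain e1 g1 p1 where 1: "run_A (testc num_vars w (Suc k) @ [(7, [])] @ ovrc I (Suc k) (Suc k) v)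
      (eq, gt, p, s, uq, fo, dn, ac) (with_tape h) =
    ((e1, g1, p1, s \<or> sat, uq, fo, dn \<or> a, a), with_tape ?h, [])"
    using run_compress_unit[OF assms(1) k a_def] by blast
  obtain e2 g2 p2 d2 a2 where 2: "run_A (concat (map (\<lambda>k. testc num_vars w (Suc k) @ [(7, [])] @ ovrc I (Suc k) (Suc k) v) ks))
      (e1, g1, p1, s \<or> sat, uq, fo, dn \<or> a, a) (with_tape ?h) =
    ((e2, g2, p2, (s \<or> sat) \<or> ks \<noteq> [] \<and> sat, uq, fo, d2, a2),
     with_tape (if (dn \<or> a) \<or> fo \<or> \<not> ((s \<or> sat) \<or> sat) then ?h else case first_ambiguous w ks of None \<Rightarrow> ?h
       | Some k \<Rightarrow> put2 ?h I (Suc k) (Suc k) v), [])"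
    using Cons.IH[OF prem] by blast
  have t: "(if (dn \<or> a) \<or> fo \<or> \<not> ((s \<or> sat) \<or> sat) then ?h else case first_ambiguous w ks of None \<Rightarrow> ?h
       | Some k \<Rightarrow> put2 ?h I (Suc k) (Suc k) v) =
     (if dn \<or> fo \<or> \<not> (s \<or> sat) then h else case first_ambiguous w (k # ks) of None \<Rightarrow> h
       | Some k \<Rightarrow> put2 h I (Suc k) (Suc k) v)"
    by (auto simp: a_def first_ambiguous_def)
  have s: "((s \<or> sat) \<or> ks \<noteq> [] \<and> sat) = (s \<or> k # ks \<noteq> [] \<and> sat)" by auto
  show ?case
    by (intro exI[of _ e2] exI[of _ g2] exI[of _ p2] exI[of _ d2] exI[of _ a2])
      (unfold list.map concat.simps, subst run_cmds_append, simp only: 1 2 t s prod.case append_Nil)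
qed

definition compressed :: "(nat \<Rightarrow> nat \<Rightarrow> nat) \<Rightarrow> bool \<Rightarrow> nat \<Rightarrow> (nat \<Rightarrow> nat) \<Rightarrow> nat \<Rightarrow> nat" where
  "compressed g b I r = (if b then case first_ambiguous (g I) [0..<num_vars] of None \<Rightarrow> r
     | Some k \<Rightarrow> r(Suc k := g I 0, 0 := Suc k) else r)"

lemma run_compress:
  assumes "\<forall>I\<in>set Is. I < Bk" "b = (\<not> fo \<and> (s \<or> sat))"
  shows "\<exists>e' g' p' dn' ac'. run_A (concat (map (\<lambda>I. [(6, [])] @
       (compress_block g I)) Is))
      (eq, gt, p, s, uq, fo, dn, ac) (with_tape h) =
    ((e', g', p', s \<or> Is \<noteq> [] \<and> num_vars \<noteq> 0 \<and> sat, uq, fo, dn', ac'),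
     with_tape (foldl (\<lambda>h I. h(I := compressed g b I (h I))) h Is), [])"
  using assms
proof (induction Is arbitrary: eq gt p s dn ac h)
  case (Cons I Is)
  let ?u = "(compress_block g I)"
  have I: "I < Bk" using Cons.prems by simp
  have ks: "\<forall>k\<in>set [0..<num_vars]. k < num_vars" by simp
  have 0: "run_A [(6, [])] (eq, gt, p, s, uq, fo, dn, ac) (with_tape h) = ((eq, gt, p, s, uq, fo, False, ac), with_tape h, [])"
    by (simp add: emit_def)
  obtain e1 g1 p1 d1 a1 where 1: "run_A ?u (eq, gt, p, s, uq, fo, False, ac) (with_tape h) =
    ((e1, g1, p1, s \<or> [0..<num_vars] \<noteq> [] \<and> sat, uq, fo, d1, a1),
     with_tape (if False \<or> fo \<or> \<not> (s \<or> sat) then h else case first_ambiguous (g I) [0..<num_vars] of None \<Rightarrow> h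
       | Some k \<Rightarrow> put2 h I (Suc k) (Suc k) (g I 0)), [])"
    using run_compress_block[OF I ks, where w = "g I" and v = "g I 0" and eq = eq and gt = gt and p = p and s = s
      and uq = uq and fo = fo and dn = False and ac = ac and h = h] by blast
  have h: "(if False \<or> fo \<or> \<not> (s \<or> sat) then h else case first_ambiguous (g I) [0..<num_vars] of None \<Rightarrow> h
       | Some k \<Rightarrow> put2 h I (Suc k) (Suc k) (g I 0)) = h(I := compressed g b I (h I))"
    using Cons.prems(2) by (auto simp: compressed_def put2_def fun_upd_idem split: option.splits)
  let ?s = "s \<or> [0..<num_vars] \<noteq> [] \<and> sat"
  have b: "b = (\<not> fo \<and> (?s \<or> sat))" using Cons.prems(2) by auto
  have prem: "\<forall>I\<in>set Is. I < Bk" using Cons.prems(1) by simp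
  obtain e2 g2 p2 d2 a2 where 2: "run_A (concat (map (\<lambda>I. [(6, [])] @
       (compress_block g I)) Is))
      (e1, g1, p1, ?s, uq, fo, d1, a1) (with_tape (h(I := compressed g b I (h I)))) =
    ((e2, g2, p2, ?s \<or> Is \<noteq> [] \<and> num_vars \<noteq> 0 \<and> sat, uq, fo, d2, a2),
     with_tape (foldl (\<lambda>h I. h(I := compressed g b I (h I))) (h(I := compressed g b I (h I))) Is), [])"
    using Cons.IH[OF prem b] by blast
  have s: "(?s \<or> Is \<noteq> [] \<and> num_vars \<noteq> 0 \<and> sat) = (s \<or> I # Is \<noteq> [] \<and> num_vars \<noteq> 0 \<and> sat)" by auto
  have u: "run_A ([(6, [])] @ ?u) (eq, gt, p, s, uq, fo, dn, ac) (with_tape h) =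
     ((e1, g1, p1, ?s, uq, fo, d1, a1), with_tape (h(I := compressed g b I (h I))), [])"
    by (simp only: run_cmds_append[of _ "[(6, [])]"] 0 1 h prod.case append_Nil)
  show ?case
    by (intro exI[of _ e2] exI[of _ g2] exI[of _ p2] exI[of _ d2] exI[of _ a2])
      (unfold list.map concat.simps foldl_Cons, subst run_cmds_append, simp only: u 2 s prod.case append_Nil)
qed auto

lemma run_round1:
  assumes "b = (\<not> (\<exists>I<Bk. isolates (g I)) \<and> num_vars \<noteq> 0 \<and> sat)"
  shows "\<exists>f'. f_sat f' = (num_vars \<noteq> 0 \<and> sat) \<and> f_found f' = (\<exists>I<Bk. isolates (g I)) \<and>
    run_A (cmds1 g) flags0 (with_tape g) = (f', with_tape (\<lambda>I. if I < Bk then compressed g b I (g I) else g I),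
      case find (\<lambda>I. isolates (g I)) [0..<Bk] of None \<Rightarrow> [] | Some I \<Rightarrow> solution (g I))"
proof -
  let ?fo = "\<exists>I<Bk. isolates (g I)"
  let ?w = "case find (\<lambda>I. isolates (g I)) [0..<Bk] of None \<Rightarrow> [] | Some I \<Rightarrow> solution (g I)"
  have e: "(False \<or> (\<exists>I\<in>set [0..<Bk]. isolates (g I))) = ?fo" by auto
  have B: "[0..<Bk] \<noteq> []" by simp
  obtain e1 g1 p1 where 1: "run_A (concat (map (\<lambda>I.
       (search_block g I)) [0..<Bk]))
      (True, False, False, False, True, False, False, False) (with_tape g) =
    ((e1, g1, p1, False \<or> [0..<Bk] \<noteq> [] \<and> num_vars \<noteq> 0 \<and> sat, True, False \<or> (\<exists>I\<in>set [0..<Bk]. isolates (g I)), False, False), with_tape g,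
      if False then [] else ?w)"
    using run_search[of g "[0..<Bk]" True False False False False False False "with_tape g"] by blast
  let ?s = "False \<or> [0..<Bk] \<noteq> [] \<and> num_vars \<noteq> 0 \<and> sat"
  \<comment> \<open>Without variables every block isolates vacuously. This removes the case in which
    no test ever reveals \<open>sat\<close>.\<close>
  have z: "isolates (g I)" if "num_vars = 0" for I using that by (simp add: isolates_def)
  have "\<exists>I<Bk. isolates (g I)" if "num_vars = 0"
    using z[OF that] by (intro exI[of _ 0]) simp
  then have b: "b = (\<not> ?fo \<and> (?s \<or> sat))" unfolding assms by auto
  have Is: "\<forall>I\<in>set [0..<Bk]. I < Bk" by simp
  obtain e2 g2 p2 d2 a2 where 2: "run_A (concat (map (\<lambda>I. [(6, [])] @
       (compress_block g I)) [0..<Bk]))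
      (e1, g1, p1, ?s, True, ?fo, False, False) (with_tape g) =
    ((e2, g2, p2, ?s \<or> [0..<Bk] \<noteq> [] \<and> num_vars \<noteq> 0 \<and> sat, True, ?fo, d2, a2),
     with_tape (foldl (\<lambda>h I. h(I := compressed g b I (h I))) g [0..<Bk]), [])"
    using run_compress[OF Is b] by blast
  have fl: "foldl (\<lambda>h I. h(I := compressed g b I (h I))) g [0..<Bk] = (\<lambda>I. if I < Bk then compressed g b I (g I) else g I)"
    by (subst foldl_upd_distinct) auto
  show ?thesis
    by (rule exI[of _ "(e2, g2, p2, ?s \<or> [0..<Bk] \<noteq> [] \<and> num_vars \<noteq> 0 \<and> sat, True, ?fo, d2, a2)"],
        intro conjI, simp add: f_sat_def, simp add: f_found_def,
        unfold cmds1_def flags0_def run_cmds_append 1 e 2 fl prod.case, simp)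
qed

definition restored :: "(nat \<Rightarrow> nat \<Rightarrow> nat) \<Rightarrow> nat \<Rightarrow> (nat \<Rightarrow> nat) \<Rightarrow> nat \<Rightarrow> nat" where
  "restored g I r = (let j = take_bit (L - 1) (g I 0) in
     foldl (\<lambda>r C. if ambiguous ((g I)(j := C)) j then r(j := C, 0 := g I j) else r) r [0..<Bk])"

text \<open>Command 6 clears the flag \<open>dn\<close> before each candidate. The tests refer to
  the fixed \<open>w\<close>, so a candidate that has already been written to \<open>h\<close> does
  not influence the later ones.\<close>

lemma run_restore_block:
  assumes "I < Bk" "j = Suc k" "k < num_vars" sat
  shows "\<exists>e' g' p' s' dn' ac'. run_A (concat (map (\<lambda>C. (restore_cmds I j v w C)) Cs))
      (eq, gt, p, s, uq, False, dn, ac) (with_tape h) =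
    ((e', g', p', s', uq, False, dn', ac'),
     with_tape (h(I := foldl (\<lambda>r C. if ambiguous (w(j := C)) j then r(j := C, 0 := v) else r) (h I) Cs)), [])"
proof (induction Cs arbitrary: eq gt p s dn ac h)
  case Nil
  then show ?case by simp
next
  case (Cons C Cs)
  let ?a = "ambiguous (w(j := C)) j"
  let ?r = "if ?a then (h I)(j := C, 0 := v) else h I"
  have 0: "run_A [(6, [])] (eq, gt, p, s, uq, False, dn, ac) (with_tape h) = ((eq, gt, p, s, uq, False, False, ac), with_tape h, [])"
    by (simp add: emit_def)
  have a: "?a = (ambiguous (w(j := C)) (Suc k) \<and> \<not> False \<and> \<not> False \<and> (s \<or> sat))"
    using assms by simp
  obtain e1 g1 p1 where 1: "run_A (testc num_vars (w(j := C)) (Suc k) @ [(7, [])] @ ovrc I (Suc k) v C)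
      (eq, gt, p, s, uq, False, False, ac) (with_tape h) =
    ((e1, g1, p1, s \<or> sat, uq, False, False \<or> ?a, ?a), with_tape (if ?a then put2 h I (Suc k) v C else h), [])"
    using run_compress_unit[OF assms(1,3) a] by blast
  have h: "(if ?a then put2 h I (Suc k) v C else h) = h(I := ?r)"
    using assms(2) by (simp add: put2_def fun_upd_idem)
  obtain e2 g2 p2 s2 d2 a2 where 2: "run_A (concat (map (\<lambda>C. (restore_cmds I j v w C)) Cs))
      (e1, g1, p1, s \<or> sat, uq, False, False \<or> ?a, ?a) (with_tape (h(I := ?r))) =
    ((e2, g2, p2, s2, uq, False, d2, a2),
     with_tape ((h(I := ?r))(I := foldl (\<lambda>r C. if ambiguous (w(j := C)) j then r(j := C, 0 := v) else r) ((h(I := ?r)) I) Cs)), [])"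
    using Cons.IH by blast
  have u: "run_A (restore_cmds I j v w C) (eq, gt, p, s, uq, False, dn, ac) (with_tape h) =
     ((e1, g1, p1, s \<or> sat, uq, False, False \<or> ?a, ?a), with_tape (h(I := ?r)), [])"
    by (simp only: run_cmds_append[of _ "[(6, [])]"] 0 1[folded assms(2)] h[folded assms(2)] prod.case append_Nil)
  have r: "foldl (\<lambda>r C. if ambiguous (w(j := C)) j then r(j := C, 0 := v) else r) (h I) (C # Cs) =
     foldl (\<lambda>r C. if ambiguous (w(j := C)) j then r(j := C, 0 := v) else r) ((h(I := ?r)) I) Cs"
    by simp
  show ?case
    by (intro exI[of _ e2] exI[of _ g2] exI[of _ p2] exI[of _ s2] exI[of _ d2] exI[of _ a2])
      (unfold list.map concat.simps r, subst run_cmds_append, simp only: u 2 prod.case append_Nil fun_upd_upd)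
qed

lemma run_restore:
  assumes "\<forall>I\<in>set Is. I < Bk \<and> (\<exists>k<num_vars. take_bit (L - 1) (g I 0) = Suc k)" sat
  shows "\<exists>e' g' p' s' dn' ac'. run_A (concat (map (\<lambda>I. let j = take_bit (L - 1) (g I 0) in
       concat (map (\<lambda>C. [(6, [])] @ testc num_vars ((g I)(j := C)) j @ [(7, [])] @ ovrc I j (g I j) C) [0..<Bk])) Is))
      (eq, gt, p, s, uq, False, dn, ac) (with_tape h) =
    ((e', g', p', s', uq, False, dn', ac'), with_tape (foldl (\<lambda>h I. h(I := restored g I (h I))) h Is), [])"
  using assms(1)
proof (induction Is arbitrary: eq gt p s dn ac h)
  case Nil
  then show ?case by simp
next
  case (Cons I Is)
  define j where "j = take_bit (L - 1) (g I 0)"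
  have prem: "\<forall>I\<in>set Is. I < Bk \<and> (\<exists>k<num_vars. take_bit (L - 1) (g I 0) = Suc k)" using Cons.prems by simp
  obtain k where k: "k < num_vars" "j = Suc k" and I: "I < Bk" using Cons.prems by (auto simp: j_def)
  have r: "restored g I r = foldl (\<lambda>r C. if ambiguous ((g I)(j := C)) j then r(j := C, 0 := g I j) else r) r [0..<Bk]" for r
    unfolding restored_def Let_def j_def ..
  obtain e1 g1 p1 s1 d1 a1 where 1: "run_A (concat (map (\<lambda>C. [(6, [])] @ testc num_vars ((g I)(j := C)) j @ [(7, [])] @ ovrc I j (g I j) C) [0..<Bk]))
      (eq, gt, p, s, uq, False, dn, ac) (with_tape h) =
    ((e1, g1, p1, s1, uq, False, d1, a1), with_tape (h(I := restored g I (h I))), [])"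
    using run_restore_block[OF I k(2,1) assms(2), where w = "g I" and v = "g I j" and Cs = "[0..<Bk]" and eq = eq
      and gt = gt and p = p and s = s and uq = uq and dn = dn and ac = ac and h = h] unfolding r by blast
  obtain e2 g2 p2 s2 d2 a2 where 2: "run_A (concat (map (\<lambda>I. let j = take_bit (L - 1) (g I 0) in
       concat (map (\<lambda>C. [(6, [])] @ testc num_vars ((g I)(j := C)) j @ [(7, [])] @ ovrc I j (g I j) C) [0..<Bk])) Is))
      (e1, g1, p1, s1, uq, False, d1, a1) (with_tape (h(I := restored g I (h I)))) =
    ((e2, g2, p2, s2, uq, False, d2, a2), with_tape (foldl (\<lambda>h I. h(I := restored g I (h I))) (h(I := restored g I (h I))) Is), [])"
    using Cons.IH[OF prem] by blast
  show ?case
    by (intro exI[of _ e2] exI[of _ g2] exI[of _ p2] exI[of _ s2] exI[of _ d2] exI[of _ a2])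
      (unfold list.map concat.simps foldl_Cons, subst run_cmds_append, simp only: Let_def j_def[symmetric] 1 2[unfolded Let_def] prod.case append_Nil)
qed

text \<open>By \<open>ambiguous_unique\<close> the erased weight is the only candidate that passes.
  Of all the passes for a block exactly one takes effect, and it undoes the compression together
  with the bit left by the search.\<close>

lemma run_round2:
  assumes "okg g" sat "\<not> (\<exists>I<Bk. isolates (g I))"
    and g1: "g1 = (\<lambda>I. if I < Bk then compressed g True I (g I) else g I)"
  shows "\<exists>f'. run_A (cmds2 (G g1 Y)) flags0 (with_tape (G g1 Y)) = (f', with_tape g, [])"
proof -
  let ?g = "G g1 Y"
  have gl: "g I S < Bk" for I S using assms(1) by (simp add: okg_def)
  have ex: "\<exists>k<num_vars. ambiguous (g I) (Suc k) \<and> first_ambiguous (g I) [0..<num_vars] = Some k" if I: "I < Bk" for I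
  proof (cases "first_ambiguous (g I) [0..<num_vars]")
    case None
    then have "isolates (g I)" by (auto simp: first_ambiguous_def find_None_iff isolates_def)
    then show ?thesis using assms(3) I by blast
  next
    case (Some k)
    then have "k < num_vars \<and> ambiguous (g I) (Suc k)" by (auto simp: first_ambiguous_def find_Some_iff)
    with Some show ?thesis by blast
  qed
  then obtain K where K: "\<And>I. I < Bk \<Longrightarrow> K I < num_vars" "\<And>I. I < Bk \<Longrightarrow> ambiguous (g I) (Suc (K I))"
    "\<And>I. I < Bk \<Longrightarrow> first_ambiguous (g I) [0..<num_vars] = Some (K I)" by metis
  have g1I: "g1 I = (g I)(Suc (K I) := g I 0, 0 := Suc (K I))" if "I < Bk" for I
    using K(3)[OF that] that by (simp add: g1 compressed_def)
  \<comment> \<open>The search has changed only the top bit, which is cut off here; the name of the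
    variable fits below it.\<close>
  have j: "take_bit (L - 1) (?g I 0) = Suc (K I)" if I: "I < Bk" for I
  proof -
    have "Suc (K I) < 2 ^ (L - 1)" using K(1)[OF I] num_vars_less(1) by linarith
    then have t: "take_bit (L - 1) (Suc (K I)) = Suc (K I)" by (simp add: take_bit_nat_eq_self)
    have "take_bit (L - 1) (?g I 0) = take_bit (L - 1) (Suc (K I))"
      by (rule bit_eqI) (auto simp: G_def g1I[OF I] bit_simps bit_set_to)
    with t show ?thesis by simp
  qed
  have pre: "\<forall>I\<in>set [0..<Bk]. I < Bk \<and> (\<exists>k<num_vars. take_bit (L - 1) (?g I 0) = Suc k)"
    using j K(1) by auto
  have res: "restored ?g I (?g I) = g I" if I: "I < Bk" for I
  proof -
    let ?j = "Suc (K I)"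
    have gj: "?g I ?j = g I 0" by (simp add: G_def g1I[OF I])
    have am: "ambiguous ((?g I)(?j := C)) ?j \<longleftrightarrow> C = g I ?j" if C: "C < Bk" for C
    proof -
      \<comment> \<open>The block differs from its original only in the slots 0 and
        \<open>?j\<close>: slot 0 is not a weight, and slot \<open>?j\<close> is replaced by
        \<open>C\<close> on both sides.\<close>
      have "wt ((?g I)(?j := C)) y = wt ((g I)(?j := C)) y" for y
        unfolding wt_def by (rule sum.cong) (auto simp: G_def g1I[OF I] fun_upd_apply)
      then have "ambiguous ((?g I)(?j := C)) ?j = ambiguous ((g I)(?j := C)) ?j"
        by (simp add: ambiguous_def heavy_def)
      also have "\<dots> \<longleftrightarrow> C = g I ?j"
        by (rule ambiguous_unique[OF gl C assms(2) K(1,2)[OF I]])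
      finally show ?thesis .
    qed
    have "restored ?g I (?g I) = foldl (\<lambda>r C. if ambiguous ((?g I)(?j := C)) ?j then r(?j := C, 0 := ?g I ?j) else r) (?g I) [0..<Bk]"
      unfolding restored_def j[OF I] Let_def ..
    also have "\<dots> = foldl (\<lambda>r C. if C = g I ?j then r(?j := g I ?j, 0 := g I 0) else r) (?g I) [0..<Bk]"
      by (rule foldl_cong) (auto simp: am gj)
    also have "\<dots> = (?g I)(?j := g I ?j, 0 := g I 0)"
      by (subst foldl_select) (use gl in auto)
    also have "\<dots> = g I"
      by (rule ext) (auto simp: G_def g1I[OF I] fun_upd_apply)
    finally show ?thesis .
  qed
  obtain e' g' p' s' dn' ac' where r: "run_A (cmds2 ?g) (True, False, False, False, True, False, False, False) (with_tape ?g) =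
    ((e', g', p', s', True, False, dn', ac'), with_tape (foldl (\<lambda>h I. h(I := restored ?g I (h I))) ?g [0..<Bk]), [])"
    using run_restore[of "[0..<Bk]" ?g True False False False True False False ?g, OF pre assms(2)] unfolding cmds2_def by blast
  have "T (foldl (\<lambda>h I. h(I := restored ?g I (h I))) ?g [0..<Bk]) = T g"
    by (subst foldl_upd_distinct) (auto intro!: T_eqI simp: res)
  then show ?thesis using r by (auto simp: flags0_def with_tape_def)
qed

end

section \<open>Encodings and bounds\<close>

lemma read_only_em [simp]: "read_only (em ws)"
  by (induction ws) (auto simp: out_def)

lemmas com_defs = While_Test_def move_work_def move_in_def move_cat_def out_def wset_def wstart_def istart_def
  cstart_def scan_work_def inc_def dec_def for_cells_def zero_def copy_def load_def clear_top_def
  repeat_def for_all_def for_upto_def times_def skip_slot_def goto_def goto_slot_def count_vars_def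
  read_literal_def for_tokens_def vts_def thresholds_def weights_def formula_def constraint_def
  query_def op_def known_def test_def keep_slot_def set_slot_def overwrite_def

lemma read_only_prog1: "read_only prog1"
  by (simp add: prog1_def com_defs)

lemma read_only_prog2: "read_only prog2"
  by (simp add: prog2_def com_defs)

text \<open>The summand \<open>a * 3 ^ b\<close> of the exponent covers \<open>N < 2\<close> through
  the additive part of \<open>poly_bound\<close>. For larger \<open>N\<close>, the estimates
  \<open>N + 2 \<le> N ^ 2\<close> and \<open>a \<le> N ^ a\<close> turn everything into a power of
  \<open>N\<close>.\<close>

lemma poly_bound_dominates: "\<exists>k. \<forall>N. a * (N + 2) ^ b \<le> poly_bound k N"
proof (intro exI allI)
  fix N :: nat
  let ?k = "a + 2 * b + a * 3 ^ b"
  show "a * (N + 2) ^ b \<le> poly_bound ?k N"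
  proof (cases "N < 2")
    case True
    have "(N + 2) ^ b \<le> 3 ^ b" using True by (intro power_mono) auto
    then have "a * (N + 2) ^ b \<le> a * 3 ^ b" by (rule mult_le_mono2)
    also have "\<dots> \<le> poly_bound ?k N" by (simp add: poly_bound_def)
    finally show ?thesis .
  next
    case False
    then have "2 * N \<le> N * N" by (intro mult_le_mono1) simp
    with False have "N + 2 \<le> N * N" by linarith
    then have "(N + 2) ^ b \<le> (N ^ 2) ^ b" by (intro power_mono) (auto simp: power2_eq_square)
    moreover have "a \<le> N ^ a"
      using False power_mono[of 2 N a] less_exp[of a] by linarith
    ultimately have "a * (N + 2) ^ b \<le> N ^ a * (N ^ 2) ^ b" by (rule mult_le_mono[rotated])
    also have "\<dots> = N ^ (a + 2 * b)" by (simp add: power_add power_mult)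
    also have "\<dots> \<le> N ^ ?k" using False by (intro power_increasing) auto
    finally show ?thesis by (simp add: poly_bound_def)
  qed
qed

lemma exp_log_cells: "2 ^ log_cells 2 N \<le> 4 * (N + 2) ^ 2"
proof -
  have "2 ^ floor_log N \<le> N + 2"
  proof (cases "N = 0")
    case False
    then have "2 ^ floor_log N \<le> N" by (intro floor_log_exp2_le) simp
    then show ?thesis by simp
  qed (simp add: floor_log.simps)
  then have "(2 ^ floor_log N) ^ 2 \<le> (N + 2) ^ 2" by (intro power_mono) auto
  moreover have "(2::nat) ^ log_cells 2 N = 4 * (2 ^ floor_log N) ^ 2"
    by (simp add: log_cells_def power_add power_mult[symmetric] mult.commute)
  ultimately show ?thesis by simp
qed

text \<open>The factor 2 buys the spare bit: half of the cells already suffice for \<open>N\<close>,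
  so at least the top one stays free.\<close>

lemma less_exp_log_cells: "N < 2 ^ (log_cells 2 N - 1)"
proof -
  have "N < 2 * 2 ^ floor_log N"
    by (cases "N = 0") (auto simp: floor_log_exp2_gt)
  also have "\<dots> = 2 ^ (floor_log N + 1)" by simp
  also have "\<dots> \<le> (2::nat) ^ (log_cells 2 N - 1)"
    by (intro power_increasing) (auto simp: log_cells_def)
  finally show ?thesis .
qed

section \<open>The token list of an encoded formula\<close>

lemma accepts_cong:
  assumes "\<And>s v. Lit s v \<in> set ts \<Longrightarrow> y v = y' v"
  shows "accepts y ts = accepts y' ts"
proof -
  have "foldl (estep y) a ts = foldl (estep y') a ts" for a
    using assms
  proof (induction ts arbitrary: a)
    case (Cons t ts)
    have "estep y a t = estep y' a t" using Cons.prems by (cases a; cases t) auto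
    moreover have "foldl (estep y) (estep y' a t) ts = foldl (estep y') (estep y' a t) ts"
      by (rule Cons.IH) (use Cons.prems in \<open>meson list.set_intros(2)\<close>)
    ultimately show ?case by simp
  qed simp
  then show ?thesis by (simp add: accepts_def)
qed

lemma toks_less: "Lit s v \<in> set (toks l xs) \<Longrightarrow> v < 2 ^ l"
  by (induction l xs rule: toks.induct) (auto simp: add_digits_less split: if_splits)

definition flat_tokens :: "(nat \<times> bool) list list \<Rightarrow> tok list" where
  "flat_tokens cs = concat (map (\<lambda>c. Cl # map (\<lambda>(v, s). Lit s v) c) cs)"

lemma estep_literals:
  "foldl (estep y) (p, f) (map (\<lambda>(v, s). Lit s v) c) = (p \<and> \<not> (\<exists>(v, s)\<in>set c. y v = s), f)"
  by (induction c arbitrary: p) auto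

lemma foldl_flat_tokens:
  "foldl (estep y) (p, f) (flat_tokens cs) = (False, False) \<longleftrightarrow>
    \<not> p \<and> \<not> f \<and> (\<forall>c\<in>set cs. \<exists>(v, s)\<in>set c. y v = s)"
proof (induction cs arbitrary: p f)
  case (Cons c cs)
  have "foldl (estep y) (p, f) (flat_tokens (c # cs)) =
    foldl (estep y) (\<not> (\<exists>(v, s)\<in>set c. y v = s), f \<or> p) (flat_tokens cs)"
    by (simp add: flat_tokens_def estep_literals)
  then show ?case using Cons.IH by auto
qed (auto simp: flat_tokens_def)

lemma accepts_flat: "accepts y (flat_tokens cs) \<longleftrightarrow> (\<forall>c\<in>set cs. \<exists>(v, s)\<in>set c. y v = s)"
  by (simp add: accepts_def foldl_flat_tokens)

text \<open>Tokens that open a clause or a literal begin with 1 and digits begin with 0, so the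
  digits end exactly where the next token opens.\<close>

lemma digs_digits: "rest = [] \<or> hd rest \<Longrightarrow> digs (concat (map digit ds) @ rest) = ds"
  by (induction ds) (cases rest; auto simp: digit_def)+

lemma after_digs_digits: "rest = [] \<or> hd rest \<Longrightarrow> after_digs (concat (map digit ds) @ rest) = rest"
  by (induction ds) (cases rest; auto simp: digit_def)+

text \<open>Generalised to a number read in part: \<open>u\<close> is the value of the
  \<open>k\<close> digits already read, and \<open>v\<close> is what the remaining digits
  encode.\<close>

lemma add_digits_nat_bits:
  "v < 2 ^ (l - k) \<Longrightarrow> k \<le> l \<Longrightarrow> u < 2 ^ k \<Longrightarrow> add_digits l k u (nat_bits v) = u + 2 ^ k * v"
proof (induction v arbitrary: k u rule: nat_bits.induct)
  case (1 v)
  show ?case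
  proof (cases "v = 0")
    case True
    then show ?thesis by (simp add: nat_bits.simps)
  next
    case False
    then have kl: "k < l" using 1(2,3) by (cases "k = l") auto
    have nb: "\<not> bit u k" using bit_less_exp[OF _ 1(4)] by blast
    have st: "set_to k (odd v) u = u + 2 ^ k * (v mod 2)"
    proof (cases "odd v")
      case True
      then show ?thesis using nb by (simp add: set_to_def set_bit_eq odd_iff_mod_2_eq_one)
    next
      case False
      have "unset_bit k u = u" by (rule bit_eqI) (use nb in \<open>auto simp: bit_simps\<close>)
      with False show ?thesis by (simp add: set_to_def)
    qed
    have "v div 2 < 2 ^ (l - Suc k)"
      using 1(2) kl by (metis Suc_diff_Suc less_mult_imp_div_less mult.commute power_Suc)
    moreover have "u + 2 ^ k * (v mod 2) < 2 ^ Suc k"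
      using 1(4) by (cases "even v") (auto simp: odd_iff_mod_2_eq_one)
    ultimately have "add_digits l (Suc k) (u + 2 ^ k * (v mod 2)) (nat_bits (v div 2)) =
      u + 2 ^ k * (v mod 2) + 2 ^ Suc k * (v div 2)"
      using kl by (intro 1(1)[OF False]) auto
    also have "\<dots> = u + 2 ^ k * (v mod 2 + 2 * (v div 2))"
      by (simp only: distrib_left power_Suc mult.assoc mult.left_commute add.assoc)
    also have "\<dots> = u + 2 ^ k * v" by (simp only: mod_mult_div_eq)
    finally show ?thesis
      using False kl st by (subst nat_bits.simps) simp
  qed
qed

lemma toks_literal:
  assumes "rest = [] \<or> hd rest" "v < 2 ^ l"
  shows "toks l (encode_literal (v, s) @ rest) = Lit s v # toks l rest"
proof -
  have "encode_literal (v, s) @ rest = True # False # False # s # concat (map digit (nat_bits v)) @ rest"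
    by (simp add: encode_literal_def digit_def)
  then show ?thesis
    using digs_digits[OF assms(1), of "nat_bits v"] after_digs_digits[OF assms(1), of "nat_bits v"]
      add_digits_nat_bits[of v l 0 0] assms(2) by simp
qed

lemma toks_literals:
  assumes "rest = [] \<or> hd rest" "\<forall>(v, s)\<in>set c. v < 2 ^ l"
  shows "toks l (concat (map encode_literal c) @ rest) = map (\<lambda>(v, s). Lit s v) c @ toks l rest"
  using assms(2)
proof (induction c)
  case (Cons a c)
  obtain v s where a: "a = (v, s)" by (cases a)
  let ?r = "concat (map encode_literal c) @ rest"
  have "?r = [] \<or> hd ?r" using assms(1) by (cases c) (auto simp: encode_literal_def)
  from toks_literal[OF this, of v l s] Cons a show ?case by simp
qed simp

lemma toks_clauses:
  assumes "\<forall>c\<in>set cs. \<forall>(v, s)\<in>set c. v < 2 ^ l"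
  shows "toks l (concat (map encode_clause cs)) = flat_tokens cs"
  using assms
proof (induction cs)
  case (Cons c cs)
  let ?r = "concat (map encode_clause cs)"
  have "?r = [] \<or> hd ?r" by (cases cs) (auto simp: encode_clause_def)
  from toks_literals[OF this, of c l] Cons
  have "toks l (concat (map encode_literal c) @ ?r) = map (\<lambda>(v, s). Lit s v) c @ flat_tokens cs" by simp
  then show ?case by (simp add: encode_clause_def[of c] flat_tokens_def)
qed (simp add: flat_tokens_def)

lemma horner_sum_bool_less: "horner_sum of_bool 2 bs < (2::nat) ^ length bs"
  by (rule less_exp_if_bits) (simp add: bit_horner_sum_bit_iff)

context tape
begin

lemma tokens_of_encode_cnf:
  assumes "wf_cnf \<phi>" "x = encode_cnf \<phi>"
  shows "num_vars = fst \<phi>" "ts = flat_tokens (snd \<phi>)"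
proof -
  have tw: "takeWhile (\<lambda>b. b) (replicate n True @ False # zs) = replicate n True"
    "dropWhile (\<lambda>b. b) (replicate n True @ False # zs) = False # zs" for n zs
    by (induction n) auto
  show n: "num_vars = fst \<phi>"
    unfolding num_vars_def by (subst assms(2)) (simp add: encode_cnf_def tw)
  have b: "body = concat (map encode_clause (snd \<phi>))"
    unfolding body_def by (subst assms(2)) (simp add: encode_cnf_def tw)
  have "\<forall>c\<in>set (snd \<phi>). \<forall>(v, s)\<in>set c. v < 2 ^ L"
  proof (intro ballI, clarify)
    fix c v s assume "c \<in> set (snd \<phi>)" "(v, s) \<in> set c"
    then have "v < fst \<phi>" using assms(1) by (auto simp: wf_cnf_def)
    then show "v < 2 ^ L" using num_vars_less(2) n by simp
  qed
  from toks_clauses[OF this] show "ts = flat_tokens (snd \<phi>)"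
    by (simp add: ts_def b)
qed

lemma satisfies_if_accepts:
  assumes "wf_cnf \<phi>" "x = encode_cnf \<phi>" "accepts y ts" "w = map y [0..<num_vars]"
  shows "satisfies w \<phi>"
  unfolding satisfies_def
proof (intro conjI ballI)
  note s = tokens_of_encode_cnf[OF assms(1,2)]
  show "length w = fst \<phi>" using assms(4) s by simp
  fix c assume c: "c \<in> set (snd \<phi>)"
  then obtain v b where vb: "(v, b) \<in> set c" "y v = b"
    using assms(3) unfolding s(2) accepts_flat by blast
  have "v < fst \<phi>" using assms(1) c vb(1) unfolding wf_cnf_def by blast
  then have "v < num_vars" using s(1) by simp
  then have "w ! v = b" using assms(4) vb(2) by simp
  with vb(1) show "\<exists>(v, s)\<in>set c. w ! v = s" by blast
qed

lemma sat_if_satisfies: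
  assumes "wf_cnf \<phi>" "x = encode_cnf \<phi>" "satisfies \<alpha> \<phi>"
  shows sat
  using assms(3) unfolding sat_def tokens_of_encode_cnf(2)[OF assms(1,2)] accepts_flat satisfies_def by auto

text \<open>Tokens mention only variables below \<open>2 ^ L\<close>, so the bits of one number, one
  per block, determine acceptance even for malformed inputs.\<close>

lemma sat_nat:
  assumes sat
  shows "\<exists>Y::nat. Y < 2 ^ Bk \<and> accepts (bit Y) ts"
proof -
  obtain y where y: "accepts y ts" using assms by (auto simp: sat_def)
  let ?Y = "horner_sum of_bool 2 (map y [0..<Bk]) :: nat"
  have "accepts (bit ?Y) ts = accepts y ts"
    by (rule accepts_cong) (auto simp: bit_horner_sum_bit_iff ts_def dest!: toks_less)
  moreover have "?Y < 2 ^ Bk" using horner_sum_bool_less[of "map y [0..<Bk]"] by simp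
  ultimately show ?thesis using y by blast
qed

text \<open>An arbitrary initial content can thus be taken as a table of weights.\<close>

lemma tape_as_fields: "\<exists>g. okg g \<and> T g = \<tau>0"
proof -
  define g where "g I S = (horner_sum of_bool 2 (map (\<lambda>k. \<tau>0 ! ((I * Bk + S) * L + k)) [0..<L]) :: nat)" for I S
  have "okg g"
    unfolding okg_def g_def
  proof (intro allI)
    fix I S
    show "horner_sum of_bool 2 (map (\<lambda>k. \<tau>0 ! ((I * Bk + S) * L + k)) [0..<L]) < Bk"
      using horner_sum_bool_less[of "map (\<lambda>k. \<tau>0 ! ((I * Bk + S) * L + k)) [0..<L]"] by simp
  qed
  moreover have "T g = \<tau>0"
  proof (rule nth_equalityI)
    fix p assume "p < length (T g)"
    then have p: "p < length \<tau>0" by simp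
    have m: "p mod L < L" using L_pos by simp
    have "p div L div Bk * Bk + p div L mod Bk = p div L" by (rule div_mult_mod_eq)
    then have "(p div L div Bk * Bk + p div L mod Bk) * L + p mod L = p" by (simp only: div_mult_mod_eq)
    then show "T g ! p = \<tau>0 ! p" using m by (simp add: nth_T[OF p] g_def bit_horner_sum_bit_iff)
  qed simp
  ultimately show ?thesis by blast
qed

lemma enc_zero: "enc (\<lambda>_. 0) = replicate L 0"
proof -
  have "symb (\<lambda>_. 0) k = 0" for k by (rule bit_eqI) (simp add: bit_symb)
  then show ?thesis by (auto simp: enc_def intro: nth_equalityI)
qed

lemma hoare_steps:
  assumes "hoare (Any (\<lambda>_. 0) (T g)) c w (Any (\<lambda>_. 0) (T g'))"
  shows "\<exists>i h j. steps x c (0, 0, 0, replicate L 0, T g) w Skip (i, h, j, replicate L 0, T g')"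
  using assms unfolding hoare_def ex_def At_def enc_zero[symmetric] by fastforce

section \<open>Counting commands and queries\<close>

lemma length_testc: "length (testc n w J) = 1 + 2 * (Bk * Bk)"
proof -
  have "length (concat (map (\<lambda>V. [(1::nat, qry n w J (U * Bk + V) False), (2, qry n w J (U * Bk + V) True)]) [0..<m])) = 2 * m" for U m
    by (induction m) auto
  then have "length (concat (map (\<lambda>U. concat (map (\<lambda>V. [(1::nat, qry n w J (U * Bk + V) False), (2, qry n w J (U * Bk + V) True)]) [0..<Bk])) [0..<k])) = k * (2 * Bk)" for k
    by (induction k) auto
  then show ?thesis by (simp add: testc_def)
qed

lemma length_ovrc: "length (ovrc I J v v') = L + length \<tau>0"
  unfolding ovrc_eq by simp

lemma length_concat_bound:
  "(\<And>k. k < n \<Longrightarrow> length (f k) \<le> b) \<Longrightarrow> length (concat (map f [0..<n])) \<le> n * b"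
  by (induction n) (auto simp: add.commute intro: add_mono)

text \<open>Blocks, variables and \<open>2 ^ L * 2 ^ L\<close> thresholds give degree 4, whereas a
  rotation pass is only linear. The coefficients add up to 16, so the factor 40 is generous.\<close>

lemma length_cmds1: "length (cmds1 g) \<le> 40 * (Bk + length \<tau>0) ^ 4"
proof -
  let ?X = "Bk + length \<tau>0"
  have X: "num_vars \<le> ?X" "Bk \<le> ?X" "L \<le> ?X" "length \<tau>0 \<le> ?X" "1 \<le> ?X"
    using num_vars_less(2) less_exp[of L] one_less_Bk by linarith+
  have t: "length (testc num_vars w J) \<le> 1 + 2 * (?X * ?X)" for w J
    unfolding length_testc using mult_le_mono[OF X(2) X(2)] by simp
  have a: "length (concat (map (\<lambda>k. testc num_vars (g I) (Suc k) @ [(m, [])]) [0..<num_vars])) \<le> ?X * (2 + 2 * (?X * ?X))" for I m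
  proof -
    have "length (concat (map (\<lambda>k. testc num_vars (g I) (Suc k) @ [(m, [])]) [0..<num_vars])) \<le> num_vars * (2 + 2 * (?X * ?X))"
    proof (rule length_concat_bound)
      fix k
      show "length (testc num_vars (g I) (Suc k) @ [(m, [])]) \<le> 2 + 2 * (?X * ?X)"
        using t[of "g I" "Suc k"] by simp
    qed
    also have "\<dots> \<le> ?X * (2 + 2 * (?X * ?X))" by (rule mult_le_mono1[OF X(1)])
    finally show ?thesis .
  qed
  have b: "length (compress_block g I)
     \<le> ?X * (2 + 2 * (?X * ?X) + (?X + ?X))" for I
  proof -
    have "length (compress_block g I)
      \<le> num_vars * (2 + 2 * (?X * ?X) + (?X + ?X))"
    proof (rule length_concat_bound)
      fix k
      show "length (testc num_vars (g I) (Suc k) @ [(7, [])] @ ovrc I (Suc k) (Suc k) (g I 0)) \<le> 2 + 2 * (?X * ?X) + (?X + ?X)"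
        using t[of "g I" "Suc k"] length_ovrc[of I "Suc k" "Suc k" "g I 0"] X(3,4) by simp
    qed
    also have "\<dots> \<le> ?X * (2 + 2 * (?X * ?X) + (?X + ?X))" by (rule mult_le_mono1[OF X(1)])
    finally show ?thesis .
  qed
  define Z where "Z = ?X"
  have Z1: "1 \<le> Z" using X(5) by (simp add: Z_def)
  have "length (concat (map (\<lambda>I.
       (search_block g I)) [0..<Bk]))
     \<le> Bk * (Z * (2 + 2 * (Z * Z)) + Z * (2 + 2 * (Z * Z)) + 1)"
  proof (rule length_concat_bound)
    fix I
    show "length (search_block g I)
       \<le> Z * (2 + 2 * (Z * Z)) + Z * (2 + 2 * (Z * Z)) + 1"
      using a[of I 3] a[of I 4] unfolding Z_def[symmetric] by simp
  qed
  also have "\<dots> \<le> Z * (Z * (2 + 2 * (Z * Z)) + Z * (2 + 2 * (Z * Z)) + 1)"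
    using X(2) unfolding Z_def by (rule mult_le_mono1)
  finally have 1: "length (concat (map (\<lambda>I.
       (search_block g I)) [0..<Bk])) \<le>
     Z * (Z * (2 + 2 * (Z * Z)) + Z * (2 + 2 * (Z * Z)) + 1)" .
  have "length (concat (map (\<lambda>I. [(6, [])] @
       (compress_block g I)) [0..<Bk]))
     \<le> Bk * (1 + Z * (2 + 2 * (Z * Z) + (Z + Z)))"
  proof (rule length_concat_bound)
    fix I
    show "length ([(6, [])] @
       (compress_block g I))
       \<le> 1 + Z * (2 + 2 * (Z * Z) + (Z + Z))"
      using b[of I] unfolding Z_def[symmetric] by simp
  qed
  also have "\<dots> \<le> Z * (1 + Z * (2 + 2 * (Z * Z) + (Z + Z)))"
    using X(2) unfolding Z_def by (rule mult_le_mono1)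
  finally have 2: "length (concat (map (\<lambda>I. [(6, [])] @
       (compress_block g I)) [0..<Bk]))
     \<le> Z * (1 + Z * (2 + 2 * (Z * Z) + (Z + Z)))" .
  have p: "Z \<le> Z ^ 4" "Z ^ 2 \<le> Z ^ 4" "Z ^ 3 \<le> Z ^ 4"
    using Z1 power_increasing[of 1 4 Z] power_increasing[of 2 4 Z] power_increasing[of 3 4 Z] by auto
  have e: "Z * (Z * (2 + 2 * (Z * Z)) + Z * (2 + 2 * (Z * Z)) + 1) + Z * (1 + Z * (2 + 2 * (Z * Z) + (Z + Z)))
     = 6 * Z ^ 2 + 6 * Z ^ 4 + 2 * Z + 2 * Z ^ 3"
    by (simp add: algebra_simps power2_eq_square power3_eq_cube power4_eq_xxxx)
  show ?thesis
    unfolding cmds1_def length_append Z_def[symmetric] using 1 2 e p by linarith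
qed

lemma length_cmds2: "length (cmds2 g) \<le> 40 * (Bk + length \<tau>0) ^ 4"
proof -
  define Z where "Z = Bk + length \<tau>0"
  have X: "Bk \<le> Z" "L \<le> Z" "length \<tau>0 \<le> Z" "1 \<le> Z"
    unfolding Z_def using less_exp[of L] one_less_Bk by linarith+
  have "length (cmds2 g) \<le> Bk * (Bk * (3 + 2 * (Z * Z) + (Z + Z)))"
    unfolding cmds2_def Let_def
  proof (rule length_concat_bound, rule length_concat_bound)
    fix I C
    let ?j = "take_bit (L - 1) (g I 0)"
    show "length ([(6, [])] @ testc num_vars ((g I)(?j := C)) ?j @ [(7, [])] @ ovrc I ?j (g I ?j) C) \<le> 3 + 2 * (Z * Z) + (Z + Z)"
      using mult_le_mono[OF X(1) X(1)] X(2,3) by (simp add: length_testc length_ovrc)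
  qed
  also have "\<dots> \<le> Z * (Z * (3 + 2 * (Z * Z) + (Z + Z)))"
    using X(1) by (intro mult_le_mono) auto
  also have "\<dots> = 3 * Z ^ 2 + 2 * Z ^ 4 + 2 * Z ^ 3"
    by (simp add: algebra_simps power2_eq_square power3_eq_cube power4_eq_xxxx)
  also have "\<dots> \<le> 40 * Z ^ 4"
    using X(4) power_increasing[of 2 4 Z] power_increasing[of 3 4 Z] by simp
  finally show ?thesis unfolding Z_def .
qed

lemma testc_op: "c \<in> set (testc n w J) \<Longrightarrow> fst c \<le> 10"
  by (auto simp: testc_def)

lemma ovrc_op: "c \<in> set (ovrc I J v v') \<Longrightarrow> fst c \<le> 10"
  by (auto simp: ovrc_eq tape_ins_def ins_def)

lemma cmds1_op: "\<forall>c\<in>set (cmds1 g). fst c \<le> 10"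
  by (auto simp: cmds1_def dest: testc_op ovrc_op)

lemma cmds2_op: "\<forall>c\<in>set (cmds2 g). fst c \<le> 10"
  by (auto simp: cmds2_def Let_def dest: testc_op ovrc_op)

end

text \<open>At most 10 negative answers, the closing empty query and the operand:
  \<open>12 = 10 + 2\<close>.\<close>

lemma length_queries: "\<forall>c\<in>set cs. fst c \<le> 10 \<Longrightarrow> length (concat (map cmd_queries cs)) \<le> 12 * length cs"
  by (induction cs) (auto simp: cmd_queries_def)

section \<open>The solver\<close>

lemma map_filter_Some: "List.map_filter id (map Some ys) = ys"
  by (induction ys) (auto simp: List.map_filter_def)

text \<open>\<open>480 = 12 * 40\<close>: queries per command times the factor in the bounds on the
  number of commands.\<close>

locale solver = tape x L \<tau>0 + machine prog1 brute_force prog2 kc kq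
  for x L \<tau>0 kc kq +
  assumes L_eq: "L = log_cells 2 (length x)"
    and enough: "480 * (2 ^ L + length \<tau>0) ^ 4 \<le> poly_bound kq (length x)"
begin

lemma queries_bound:
  assumes "\<forall>c\<in>set cs. fst c \<le> 10" "length cs \<le> 40 * (Bk + length \<tau>0) ^ 4"
  shows "length (concat (map cmd_queries cs)) \<le> poly_bound (query_exp M) (length x)"
proof -
  have "length (concat (map cmd_queries cs)) \<le> 12 * length cs" by (rule length_queries[OF assms(1)])
  also have "\<dots> \<le> 480 * (Bk + length \<tau>0) ^ 4" using assms(2) by simp
  also have "\<dots> \<le> poly_bound (query_exp M) (length x)" using enough by simp
  finally show ?thesis .
qed

lemma uz_with_tape: "uz L (with_tape g) = replicate L 0" "drop L (with_tape g) = T g"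
  by (simp_all add: with_tape_def)

text \<open>The Hoare triple supplies the query tape and \<open>run_A\<close> the effect of its
  answers. They fit together because the query program returns the work tape to zeros, as the ring
  \<open>with_tape g\<close> expects.\<close>

lemma round:
  assumes r: "r = 1 \<and> p = prog1 \<or> r = 2 \<and> p = prog2"
    and cl: "cl_phase M x q 0 0 0 u \<tau> y1 (Some (en (Qry r p))) (replicate L 0) (T g)"
    and h: "hoare (Any (\<lambda>_. 0) (T g)) p (cstream cs) (Any (\<lambda>_. 0) (T g))"
    and ops: "\<forall>c\<in>set cs. fst c \<le> 10" and len: "length cs \<le> 40 * (Bk + length \<tau>0) ^ 4"
    and cmds: "run_A cs flags0 (with_tape g) = (f', with_tape g', w)"
    and run: "run M sat_lang x k (en (Ans r 0 False f')) (replicate L 0) (T g') y3 \<tau>'"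
  shows "run M sat_lang x (Suc k) q u \<tau> (y1 @ w @ y3) \<tau>'"
proof (rule run_round[OF cl _ refl _ _ run])
  obtain i h j where "steps x p (0, 0, 0, replicate L 0, T g) (cstream cs) Skip (i, h, j, replicate L 0, T g)"
    using hoare_steps[OF h] by blast
  then show "query_phase M x (T g) (en (Qry r p)) 0 0 0 (replicate L 0) (cstream cs) (en (Ans r 0 False flags0)) (replicate L 0)"
    by (rule query_phase_run) (use r read_only_prog1 read_only_prog2 in auto)
  have qs: "parse_queries [] (cstream cs) = concat (map cmd_queries cs)"
    unfolding cstream_def by (rule parse_qstream)
  show "length (parse_queries [] (cstream cs)) \<le> poly_bound (query_exp M) (length x)"
    unfolding qs by (rule queries_bound[OF ops len])
  have z: "with_tape g \<noteq> []" "L \<le> length (with_tape g)" using L_pos by (simp_all add: with_tape_def)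
  have r2: "r \<in> {1, 2}" using r by auto
  show "answer_phase M (map (\<lambda>p. p \<in> sat_lang) (parse_queries [] (cstream cs))) (en (Ans r 0 False flags0))
     (replicate L 0) (T g) w (en (Ans r 0 False f')) (replicate L 0) (T g')"
    using answer_run_cmds[OF r2 Nil_in_sat_lang false_query_notin ops z cmds]
    unfolding qs uz_with_tape .
qed

lemma correct:
  "\<exists>k'\<le>2. \<exists>y. run M sat_lang x k' 0 (replicate L 0) \<tau>0 y \<tau>0 \<and> (x, y) \<in> FSAT"
proof -
  obtain g where g: "okg g" "T g = \<tau>0" using tape_as_fields by blast
  let ?fo = "\<exists>I<Bk. isolates (g I)"
  define b where "b = (\<not> ?fo \<and> num_vars \<noteq> 0 \<and> sat)"
  define g1 where "g1 = (\<lambda>I. if I < Bk then compressed g b I (g I) else g I)"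
  define w where "w = (case find (\<lambda>I. isolates (g I)) [0..<Bk] of None \<Rightarrow> [] | Some I \<Rightarrow> solution (g I))"
  obtain f1 where f1: "f_sat f1 = (num_vars \<noteq> 0 \<and> sat)" "f_found f1 = ?fo"
    "run_A (cmds1 g) flags0 (with_tape g) = (f1, with_tape g1, w)"
    using run_round1[OF b_def] unfolding g1_def w_def by blast
  have start: "cl_phase M x 0 0 0 0 (replicate L 0) (T g) [] (Some (en (Qry 1 prog1))) (replicate L 0) (T g)"
    by (rule cl_ask) (simp add: M_def)
  note round1 = round[OF _ start h_prog1[OF g(1)] cmds1_op length_cmds1 f1(3)]
  have out: "(x, map y [0..<num_vars]) \<in> FSAT" if "accepts y ts" for y
    unfolding FSAT_def using satisfies_if_accepts[OF _ _ that refl] by blast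
  show ?thesis
  proof (cases b)
    \<comment> \<open>Nothing has been compressed: either a solution was output in the first round,
      or the token list has none.\<close>
    case False
    have "g1 = g" using False by (auto simp: g1_def compressed_def)
    have "cl_phase M x (en (Ans 1 0 False f1)) 0 0 0 (replicate L 0) (T g1) [] None (replicate L 0) (T g1)"
      by (rule cl_halt) (use False f1 in \<open>auto simp: M_def b_def\<close>)
    from round1[OF _ run_halt[OF this]] have "run M sat_lang x (Suc 0) 0 (replicate L 0) \<tau>0 w \<tau>0"
      using \<open>g1 = g\<close> g(2) by simp
    moreover have "(x, w) \<in> FSAT"
    proof (cases sat)
      case True
      have "?fo"
      proof (rule ccontr)
        assume n: "\<not> ?fo"
        then have "num_vars = 0" using False True by (auto simp: b_def)
        then have "isolates (g 0)" by (simp add: isolates_def)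
        then show False using n by auto
      qed
      then obtain I where I: "find (\<lambda>I. isolates (g I)) [0..<Bk] = Some I" "isolates (g I)"
        by (cases "find (\<lambda>I. isolates (g I)) [0..<Bk]") (auto simp: find_None_iff find_Some_iff)
      have "\<forall>k<num_vars. \<not> ambiguous (g I) (Suc k)" using I(2) by (simp add: isolates_def)
      then obtain y where y: "accepts y ts" "\<forall>k<num_vars. prefers_true (g I) (Suc k) = y k"
        using isolated_solution[of "g I"] g(1) True by (auto simp: okg_def)
      have "w = map y [0..<num_vars]" using I(1) y(2) by (simp add: w_def solution_def)
      then show ?thesis using out[OF y(1)] by simp
    next
      case False
      then show ?thesis unfolding FSAT_def using sat_if_satisfies by blast
    qed
    ultimately show ?thesis by (intro exI[of _ "Suc 0"]) auto
  next
    case True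
    then have sat "\<not> ?fo" by (auto simp: b_def)
    have g1': "g1 = (\<lambda>I. if I < Bk then compressed g True I (g I) else g I)"
      using True unfolding g1_def by (simp only: eqTrueI)
    have top: "bit (g1 I 0) (L - 1) = False" if I: "I < Bk" for I
    proof -
      have "first_ambiguous (g I) [0..<num_vars] \<noteq> None"
        using \<open>\<not> ?fo\<close> I by (auto simp: first_ambiguous_def find_None_iff isolates_def)
      then obtain k where k: "first_ambiguous (g I) [0..<num_vars] = Some k" by blast
      then have "k < num_vars" by (auto simp: first_ambiguous_def find_Some_iff)
      then have "Suc k < 2 ^ (L - 1)" using num_vars_less(1) by linarith
      moreover have "g1 I 0 = Suc k" using I k by (simp add: g1' compressed_def)
      ultimately show ?thesis using bit_less_exp[of "Suc k" "L - 1" "L - 1"] by auto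
    qed
    \<comment> \<open>The stored names leave the top bits at 0, so the search starts from the
      assignment 0 without any preparation.\<close>
    have G0: "T (G g1 0) = T g1"
      by (rule T_eqI) (use top in \<open>auto simp: G_def bit_set_to\<close>)
    have okg1: "okg g1"
    proof -
      have "g1 I S < Bk" for I S
      proof (cases "I < Bk")
        case True
        show ?thesis
        proof (cases "first_ambiguous (g I) [0..<num_vars]")
          case None
          then show ?thesis using True g(1) by (simp add: g1' compressed_def okg_def)
        next
          case (Some k)
          then have "k < num_vars" by (auto simp: first_ambiguous_def find_Some_iff)
          then have "Suc k < Bk" using num_vars_less(2) num_vars_less(1) by linarith
          then show ?thesis using True Some g(1) by (simp add: g1' compressed_def okg_def fun_upd_apply)
        qed
      next
        case False
        then show ?thesis using g(1) by (simp add: g1' okg_def)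
      qed
      then show ?thesis by (simp add: okg_def)
    qed
    obtain Y0 :: nat where "Y0 < 2 ^ Bk" "accepts (bit Y0) ts" using sat_nat[OF \<open>sat\<close>] by blast
    from h_brute_force[OF this, of g1] obtain Y :: nat where Y: "accepts (bit Y) ts"
      "hoare (Any (\<lambda>_. 0) (T (G g1 0))) brute_force
        (map (\<lambda>k. Some (bit Y k)) [0..<num_vars]) (Any (\<lambda>_. 0) (T (G g1 Y)))" by blast
    let ?y = "map (bit Y) [0..<num_vars]"
    obtain i h j where "steps x brute_force (0, 0, 0, replicate L 0, T g1) (map Some ?y) Skip (i, h, j, replicate L 0, T (G g1 Y))"
      using hoare_steps[OF Y(2)] unfolding G0 by (auto simp: o_def)
    then have brute: "cl_phase M x (en (Brute brute_force)) 0 0 0 (replicate L 0) (T g1) ?y (Some (en (Qry 2 prog2))) (replicate L 0) (T (G g1 Y))"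
      using brute_phase[of x brute_force 0 0 0 "replicate L 0" "T g1" "map Some ?y"] by (simp add: map_filter_Some del: map_map)
    \<comment> \<open>All heads stand on left end markers, so the symbols of this step are not
      written.\<close>
    have d: "cl_delta M (en (Ans 1 0 False f1)) (scan x 0) (scan (replicate L 0) 0) (scan (T g1) 0) =
       Cl_Step (en (Brute brute_force)) 0 False Stay Stay Stay None"
      using True f1 by (simp add: M_def b_def)
    have middle: "cl_phase M x (en (Ans 1 0 False f1)) 0 0 0 (replicate L 0) (T g1) (emit None @ ?y) (Some (en (Qry 2 prog2))) (replicate L 0) (T (G g1 Y))"
      by (rule cl_step[OF d]) (use brute in \<open>simp add: put_def\<close>)
    obtain f2 where f2: "run_A (cmds2 (G g1 Y)) flags0 (with_tape (G g1 Y)) = (f2, with_tape g, [])"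
      using run_round2[OF g(1) \<open>sat\<close> \<open>\<not> ?fo\<close> g1'] by blast
    have halt: "cl_phase M x (en (Ans 2 0 False f2)) 0 0 0 (replicate L 0) (T g) [] None (replicate L 0) (T g)"
      by (rule cl_halt) (simp add: M_def)
    have "run M sat_lang x (Suc 0) (en (Ans 1 0 False f1)) (replicate L 0) (T g1) (emit None @ ?y) (T g)"
      using round[OF _ middle h_prog2[OF okg_G[OF okg1]] cmds2_op length_cmds2 f2 run_halt[OF halt]] by simp
    from round1[OF _ this] have "run M sat_lang x (Suc (Suc 0)) 0 (replicate L 0) \<tau>0 (w @ ?y) \<tau>0"
      using g(2) by (simp add: emit_def)
    \<comment> \<open>No block isolates, so the first round has written nothing and the output is
      the assignment found by the search.\<close>
    moreover have "w = []"
      using \<open>\<not> ?fo\<close> by (cases "find (\<lambda>I. isolates (g I)) [0..<Bk]") (auto simp: w_def find_Some_iff)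
    ultimately have "run M sat_lang x 2 0 (replicate L 0) \<tau>0 ?y \<tau>0" by (simp add: numeral_2_eq_2)
    then show ?thesis using out[OF Y(1)] by blast
  qed
qed

end

theorem mainTheorem7:
  shows "FSAT \<in> CL_NP_rounds 2"
proof -
  \<comment> \<open>With \<open>2 ^ L \<le> 4 * (N + 2) ^ 2\<close> and
    \<open>L \<le> 2 ^ L\<close>, the cells of all blocks number at most the cube of
    \<open>4 * (N + 2) ^ 2\<close>.\<close>
  obtain kc where kc: "\<And>N. 64 * (N + 2) ^ 6 \<le> poly_bound kc N" using poly_bound_dominates by blast
  \<comment> \<open>\<open>kq\<close> depends on \<open>kc\<close>, since a pass of rotations is as
    long as the catalytic tape.\<close>
  obtain kq where kq: "\<And>N. 480 * (kc + 5) ^ 4 * (N + 2) ^ (4 * (kc + 2)) \<le> poly_bound kq N"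
    using poly_bound_dominates by blast
  interpret machine prog1 brute_force prog2 kc kq .
  have "\<exists>k'\<le>2. \<exists>y. run M sat_lang x k' 0 (replicate (log_cells (work_const M) (length x)) 0) \<tau> y \<tau> \<and> (x, y) \<in> FSAT"
    if len: "length \<tau> = poly_bound (cat_exp M) (length x)" for x \<tau>
  proof -
    let ?N = "length x" and ?L = "log_cells 2 (length x)"
    have B: "2 ^ ?L \<le> 4 * (?N + 2) ^ 2" by (rule exp_log_cells)
    have "2 ^ ?L * 2 ^ ?L * ?L \<le> 2 ^ ?L * 2 ^ ?L * 2 ^ ?L"
      by (intro mult_le_mono2 less_imp_le less_exp)
    also have "\<dots> = (2 ^ ?L) ^ 3" by (simp add: power3_eq_cube)
    also have "\<dots> \<le> (4 * (?N + 2) ^ 2) ^ 3" using B by (rule power_mono) simp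
    also have "\<dots> = 64 * (?N + 2) ^ 6" by (simp add: power_mult_distrib power_mult[symmetric])
    also have "\<dots> \<le> length \<tau>" using kc len by simp
    finally have long: "2 ^ ?L * 2 ^ ?L * ?L \<le> length \<tau>" .
    \<comment> \<open>\<open>kc + 5 = 4 + 1 + kc\<close>: the factor 4 comes from
      \<open>2 ^ L\<close>, the rest from the two summands of the tape length
      \<open>N ^ kc + kc\<close>.\<close>
    have "2 ^ ?L + length \<tau> \<le> (kc + 5) * (?N + 2) ^ (kc + 2)"
    proof -
      let ?P = "(?N + 2) ^ (kc + 2)"
      have "(?N + 2) ^ 2 \<le> ?P" by (intro power_increasing) auto
      moreover have "?N ^ kc \<le> ?P"
        using power_mono[of ?N "?N + 2" kc] power_increasing[of kc "kc + 2" "?N + 2"] by simp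
      moreover have "kc * 1 \<le> kc * ?P" by (intro mult_le_mono2 one_le_power) simp
      moreover have "(kc + 5) * ?P = 4 * ?P + ?P + kc * ?P" by (simp add: algebra_simps)
      ultimately show ?thesis using B len unfolding M_simps poly_bound_def by linarith
    qed
    then have "(2 ^ ?L + length \<tau>) ^ 4 \<le> ((kc + 5) * (?N + 2) ^ (kc + 2)) ^ 4" by (rule power_mono) simp
    also have "\<dots> = (kc + 5) ^ 4 * (?N + 2) ^ (4 * (kc + 2))"
      by (simp only: power_mult_distrib power_mult[symmetric] mult.commute)
    finally have "480 * (2 ^ ?L + length \<tau>) ^ 4 \<le> 480 * (kc + 5) ^ 4 * (?N + 2) ^ (4 * (kc + 2))" by simp
    then have enough: "480 * (2 ^ ?L + length \<tau>) ^ 4 \<le> poly_bound kq ?N" using kq by (rule order_trans)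
    interpret solver x ?L \<tau> kc kq
      by unfold_locales (use long enough less_exp_log_cells in \<open>auto simp: log_cells_def\<close>)
    show ?thesis using correct by simp
  qed
  then show ?thesis
    unfolding CL_NP_rounds_def using sat_lang_NP wf_M by blast
qed

end
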